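(* For every integer $n\geq 2661$, $$\mathrm{ex}_{\mathcal{P}}(n,2C_4)=\begin{cases}\frac{19n}{7}-6 & \text{if } 7\mid n,\\[2pt] \left\lfloor\frac{19n-34}{7}\right\rfloor & \text{otherwise.}\end{cases}$$
   Context: All graphs are finite and simple. $2C_4$ is the disjoint union of two cycles of length 4. $\mathrm{ex}_{\mathcal{P}}(n,2C_4)$ is the maximum number of edges in an $n$-vertex planar graph that does not contain $2C_4$ as a (not necessarily induced) subgraph. *)

theory Defs
  imports "HOL-Analysis.Analysis"
begin

text \<open>A graph is a pair of its vertex set and its set of edges, an edge being the set of its two ends.\<close>

type_synonym 'a sgraph = "'a set \<times> 'a set set"

abbreviation verts :: "'a sgraph \<Rightarrow> 'a set" where "verts \<equiv> fst"
abbreviation edges :: "'a sgraph \<Rightarrow> 'a set set" where "edges \<equiv> snd"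

definition simple_graph :: "'a sgraph \<Rightarrow> bool" where
  "simple_graph G \<longleftrightarrow> finite (verts G) \<and> (\<forall>e\<in>edges G. e \<subseteq> verts G \<and> card e = 2)"

definition contains_copy :: "'a sgraph \<Rightarrow> 'b sgraph \<Rightarrow> bool" where
  "contains_copy G H \<longleftrightarrow>
     (\<exists>f. inj_on f (verts H) \<and> f ` verts H \<subseteq> verts G \<and> (\<forall>e\<in>edges H. f ` e \<in> edges G))"

text \<open>
  A drawing in the plane (taken to be \<^typ>\<open>complex\<close>) places the vertices at distinct points and
  draws every edge as an arc, i.e. an injective path, between its ends. An arc meets no
  vertex other than its ends, and two different arcs meet at most in common ends.
\<close>

definition plane_drawing ::
    "'a sgraph \<Rightarrow> ('a \<Rightarrow> complex) \<Rightarrow> ('a set \<Rightarrow> real \<Rightarrow> complex) \<Rightarrow> bool" where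
  "plane_drawing G p \<gamma> \<longleftrightarrow>
     inj_on p (verts G) \<and>
     (\<forall>e\<in>edges G. arc (\<gamma> e) \<and> {pathstart (\<gamma> e), pathfinish (\<gamma> e)} = p ` e \<and>
        path_image (\<gamma> e) \<inter> p ` verts G = p ` e) \<and>
     (\<forall>e\<in>edges G. \<forall>e'\<in>edges G. e \<noteq> e' \<longrightarrow>
        path_image (\<gamma> e) \<inter> path_image (\<gamma> e') \<subseteq> p ` (e \<inter> e'))"

definition planar :: "'a sgraph \<Rightarrow> bool" where
  "planar G \<longleftrightarrow> (\<exists>p \<gamma>. plane_drawing G p \<gamma>)"

text \<open>This is a cycle of length \<open>k\<close> for \<open>k \<ge> 3\<close> only.\<close>

definition cycle_graph :: "nat \<Rightarrow> nat sgraph" where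
  "cycle_graph k = ({..<k}, (\<lambda>i. {i, Suc i mod k}) ` {..<k})"

definition disjoint_union :: "'a sgraph \<Rightarrow> 'b sgraph \<Rightarrow> ('a + 'b) sgraph" where
  "disjoint_union G H =
     (Inl ` verts G \<union> Inr ` verts H, (`) Inl ` edges G \<union> (`) Inr ` edges H)"

definition two_C4 :: "(nat + nat) sgraph" where
  "two_C4 = disjoint_union (cycle_graph 4) (cycle_graph 4)"

text \<open>
  Every finite graph is isomorphic to one whose vertices are natural numbers, so the
  maximum is taken over those.
\<close>

definition planar_free_sizes :: "nat \<Rightarrow> 'b sgraph \<Rightarrow> nat set" where
  "planar_free_sizes n H =
     {card (edges G) | G :: nat sgraph.
        simple_graph G \<and> card (verts G) = n \<and> planar G \<and> \<not> contains_copy G H}"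

definition ex_planar :: "nat \<Rightarrow> 'b sgraph \<Rightarrow> nat" where
  "ex_planar n H = Max (planar_free_sizes n H)"

text \<open>The maximum exists as soon as \<open>H\<close> has an edge.\<close>

lemma finite_planar_free_sizes: "finite (planar_free_sizes n H)"
proof (rule finite_subset)
  show "planar_free_sizes n H \<subseteq> {..2 ^ n}"
  proof
    fix m assume "m \<in> planar_free_sizes n H"
    then obtain G :: "nat sgraph" where G: "simple_graph G" "card (verts G) = n"
      and m: "m = card (edges G)"
      unfolding planar_free_sizes_def by blast
    have "edges G \<subseteq> Pow (verts G)" "finite (verts G)"
      using G(1) unfolding simple_graph_def by blast+
    then have "card (edges G) \<le> card (Pow (verts G))"
      by (intro card_mono) auto
    then show "m \<in> {..2 ^ n}"
      using G(2) m \<open>finite (verts G)\<close> by (simp add: card_Pow)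
  qed
qed simp

lemma planar_free_sizes_nonempty:
  assumes "edges H \<noteq> {}"
  shows "planar_free_sizes n H \<noteq> {}"
proof -
  let ?G = "({..<n}, {}) :: nat sgraph"
  have "plane_drawing ?G of_nat (\<lambda>e t. 0)"
    by (simp add: plane_drawing_def inj_on_def)
  then have "planar ?G" unfolding planar_def by blast
  moreover have "simple_graph ?G" "card (verts ?G) = n" "\<not> contains_copy ?G H"
    using assms by (auto simp: simple_graph_def contains_copy_def)
  ultimately have "card (edges ?G) \<in> planar_free_sizes n H"
    unfolding planar_free_sizes_def by blast
  then show ?thesis by blast
qed

end

theory Submission
  imports Defs
begin

text \<open>
  Faces of a drawing are the components of its complement. Janiszewski's theorem shows that deleting an edge
  merges at most two faces and that joining two components by an edge splits none, and the Jordan curve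
  theorem that closing a cycle splits one. This yields half of Euler's formula together with
  a family of face boundaries, each a nonempty edge set with even degrees, that covers every edge at most
  twice (as in MacLane's criterion).

  If a vertex \<open>v\<close> lies on all 4-cycles, then away from \<open>v\<close> no two triangular faces share an edge and no face has
  length 4, while every face at \<open>v\<close> uses up two of the sides of edges at \<open>v\<close> and at least one other side;
  Euler's formula turns this into \<open>7e + 34 \<le> 19n\<close>, where the two sides never
  differ by exactly 1.
  Otherwise every vertex is avoided by some 4-cycle, while any two 4-cycles meet. A set \<open>S\<close> of five vertices
  then meets all 4-cycles, and up to a bounded number of exceptions the triangles with one vertex in \<open>S\<close>
  share no edge at \<open>S\<close> and the 4-faces alternate between \<open>S\<close> and the other vertices. With \<open>D \<le> 2n - 4\<close> edges
  leaving \<open>S\<close>, this gives \<open>e \<le> 15n/7 + D/4 + O(1)\<close>, which is less than \<open>19n/7\<close> by \<open>n/14 - O(1)\<close>.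

  The bound is attained by a vertex joined to all vertices of an outerplanar graph without 4-cycles that is
  grown from a small one by repeatedly attaching a path of four triangles to the ends of an outer edge, which adds
  7 vertices and 12 edges.
\<close>

section \<open>Faces of a plane drawing\<close>

text \<open>Only an upper bound on the number of edges is wanted, so one inequality of Euler's
  formula suffices, and faces need only be bounded in size from below. This is why boundaries may
  forget bridges: a nonempty edge set with even degrees still has at least three edges, and three or
  four only if it is a triangle or a 4-cycle. If 7 divides \<open>n\<close>, then
  \<open>19n - 34 - 7e\<close> is 1 modulo 7; excluding the value 1 makes it at least 8, which
  lowers the bound from \<open>19n/7 - 5\<close> to \<open>19n/7 - 6\<close>. The hard case is that
  of pairwise meeting 4-cycles without a common vertex, where no count around a single vertex is
  available. What helps is that a vertex outside \<open>S\<close> has few neighbours in common with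
  any \<open>s\<close> in \<open>S\<close>. So \<open>s\<close> sends boundedly many edges to the
  4-cycle \<open>Q s\<close> that avoids it and to the common neighbours of \<open>s\<close> and the
  vertices of \<open>Q s\<close> outside \<open>S\<close>; apart from edges inside \<open>S\<close>,
  only these spoil the generic face pattern. The sparsity of the bipartite graph of edges leaving
  \<open>S\<close> makes room for the bounded error.\<close>

inductive upath :: "'a set set \<Rightarrow> 'a \<Rightarrow> 'a \<Rightarrow> 'a set set \<Rightarrow> bool" for E where
  single: "{u, v} \<in> E \<Longrightarrow> u \<noteq> v \<Longrightarrow> upath E u v {{u, v}}"
| step: "{u, w} \<in> E \<Longrightarrow> u \<noteq> w \<Longrightarrow> upath E w v P \<Longrightarrow> u \<notin> \<Union>P \<Longrightarrow> upath E u v (insert {u, w} P)"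

definition even_degrees :: "'a set set \<Rightarrow> bool" where
  "even_degrees B \<longleftrightarrow> (\<forall>x. even (card {e \<in> B. x \<in> e}))"

abbreviation adj :: "'a set set \<Rightarrow> ('a \<times> 'a) set" where
  "adj E \<equiv> {(x, y). {x, y} \<in> E}"

lemma even_card_sym_diff:
  assumes "finite A" "finite B"
  shows "even (card (sym_diff A B)) \<longleftrightarrow> (even (card A) \<longleftrightarrow> even (card B))"
proof -
  have "card (sym_diff A B) = card (A - B) + card (B - A)"
    using assms by (intro card_Un_disjoint) auto
  moreover have "card A = card (A - B) + card (A \<inter> B)"
    using assms by (metis Int_Diff_Un Int_Diff_disjoint card_Un_disjoint finite_Diff finite_Int inf_commute sup_commute)
  moreover have "card B = card (B - A) + card (A \<inter> B)"
    using assms by (metis Int_Diff_Un Int_Diff_disjoint card_Un_disjoint finite_Diff finite_Int inf_commute sup_commute)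
  ultimately show ?thesis by presburger
qed

lemma even_degrees_sym_diff:
  assumes "finite A" "finite B" "even_degrees A" "even_degrees B"
  shows "even_degrees (sym_diff A B)"
  unfolding even_degrees_def
proof
  fix x
  have "{e \<in> sym_diff A B. x \<in> e} = sym_diff {e \<in> A. x \<in> e} {e \<in> B. x \<in> e}" by auto
  then show "even (card {e \<in> sym_diff A B. x \<in> e})"
    using assms even_card_sym_diff[of "{e \<in> A. x \<in> e}" "{e \<in> B. x \<in> e}"]
    by (simp add: even_degrees_def)
qed

lemma upath_props:
  assumes "upath E u v P"
  shows "P \<subseteq> E" "finite P" "u \<in> \<Union>P" "v \<in> \<Union>P" "u \<noteq> v"
  using assms by (induction rule: upath.induct) auto

text \<open>Inner vertices lie on two edges of the path and its ends on one. Closing the path by an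
  edge between its ends therefore makes every degree even.\<close>

lemma upath_degree:
  assumes "upath E u v P"
  shows "odd (card {e \<in> P. x \<in> e}) \<longleftrightarrow> x = u \<or> x = v"
  using assms
proof (induction arbitrary: x rule: upath.induct)
  case (single u v)
  have "{e \<in> {{u, v}}. x \<in> e} = (if x = u \<or> x = v then {{u, v}} else {})" by auto
  then show ?case by simp
next
  case (step u w v P)
  note P = upath_props[OF step.hyps(3)]
  have fin: "finite {e \<in> P. x \<in> e}" using P(2) by simp
  have new: "{u, w} \<notin> P" using step.hyps(4) by blast
  have *: "{e \<in> insert {u, w} P. x \<in> e} =
      (if x = u \<or> x = w then insert {u, w} {e \<in> P. x \<in> e} else {e \<in> P. x \<in> e})" by auto
  have c: "card (insert {u, w} {e \<in> P. x \<in> e}) = Suc (card {e \<in> P. x \<in> e})"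
    using fin new by simp
  have u: "x = u \<Longrightarrow> {e \<in> P. x \<in> e} = {}" using step.hyps(4) by blast
  have "u \<noteq> v" using step.hyps(4) P(4) by blast
  show ?case
  proof (cases "x = u")
    case True
    have "{e \<in> insert {u, w} P. x \<in> e} = {{u, w}}" using * u[OF True] True by metis
    then have "card {e \<in> insert {u, w} P. x \<in> e} = 1" by (metis card_1_singleton_iff One_nat_def)
    then show ?thesis using True by (metis odd_one)
  next
    case False
    show ?thesis
    proof (cases "x = w")
      case True
      then have "odd (card {e \<in> P. x \<in> e})" using step.IH by simp
      then show ?thesis using * c True step.hyps(2) P(5) by simp
    next
      case F: False
      then show ?thesis using * \<open>x \<noteq> u\<close> step.IH by simp
    qed
  qed
qed

lemma upath_closed_even_degrees:
  assumes "upath E u v P" "{u, v} \<notin> P"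
  shows "even_degrees (insert {u, v} P)"
  unfolding even_degrees_def
proof
  fix x
  have fin: "finite {e \<in> P. x \<in> e}" using upath_props(2)[OF assms(1)] by simp
  show "even (card {e \<in> insert {u, v} P. x \<in> e})"
  proof (cases "x = u \<or> x = v")
    case True
    then have "{e \<in> insert {u, v} P. x \<in> e} = insert {u, v} {e \<in> P. x \<in> e}" by auto
    moreover have "card (insert {u, v} {e \<in> P. x \<in> e}) = Suc (card {e \<in> P. x \<in> e})"
      using fin assms(2) by (intro card_insert_disjoint) auto
    moreover have "odd (card {e \<in> P. x \<in> e})" using upath_degree[OF assms(1)] True by blast
    ultimately show ?thesis by (metis even_Suc)
  next
    case False
    then have "{e \<in> insert {u, v} P. x \<in> e} = {e \<in> P. x \<in> e}" by auto
    moreover have "even (card {e \<in> P. x \<in> e})" using upath_degree[OF assms(1)] False by blast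
    ultimately show ?thesis by metis
  qed
qed

lemma upath_suffix:
  assumes "upath E w v P" "x \<in> \<Union>P" "x \<noteq> v"
  shows "\<exists>Q \<subseteq> P. upath E x v Q"
  using assms
proof (induction rule: upath.induct)
  case (single u v)
  then show ?case using upath.single[of u v E] by auto
next
  case (step u w v P)
  show ?case
  proof (cases "x \<in> \<Union>P")
    case True
    then show ?thesis using step.IH[OF _ step.prems(2)] by (meson subset_insertI2)
  next
    case False
    then have "x = u" using step.prems(1) upath_props(3)[OF step.hyps(3)] by blast
    then show ?thesis using upath.step[OF step.hyps] by blast
  qed
qed

text \<open>The path is grown backwards along a walk; if the new first vertex already lies on the
  path, the suffix from there is taken instead.\<close>

lemma reachable_imp_upath:
  assumes "(u, v) \<in> (adj E)\<^sup>*" "u \<noteq> v"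
  shows "\<exists>P. upath E u v P"
  using assms
proof (induction rule: converse_rtrancl_induct)
  case base
  then show ?case by simp
next
  case (step u w)
  then have uw: "{u, w} \<in> E" by simp
  consider "w = v" | "w = u" | "w \<noteq> v" "w \<noteq> u" by blast
  then show ?case
  proof cases
    case 1
    then show ?thesis using upath.single[OF uw] step.prems by blast
  next
    case 2
    then show ?thesis using step by blast
  next
    case 3
    then obtain P where P: "upath E w v P" using step by blast
    show ?thesis
    proof (cases "u \<in> \<Union>P")
      case True
      then show ?thesis using upath_suffix[OF P] step.prems by blast
    next
      case False
      then show ?thesis using upath.step[OF uw _ P] 3 by blast
    qed
  qed
qed

section \<open>Drawings of edge sets and connection in their complement\<close>

locale drawing =
  fixes E :: "'a set set" and p :: "'a \<Rightarrow> complex" and \<gamma> :: "'a set \<Rightarrow> real \<Rightarrow> complex"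
  assumes fin_edges: "finite E"
    and card_edge: "e \<in> E \<Longrightarrow> card e = 2"
    and arc_edge: "e \<in> E \<Longrightarrow> arc (\<gamma> e)"
    and ends_edge: "e \<in> E \<Longrightarrow> {pathstart (\<gamma> e), pathfinish (\<gamma> e)} = p ` e"
    and edges_meet: "e \<in> E \<Longrightarrow> e' \<in> E \<Longrightarrow> e \<noteq> e' \<Longrightarrow>
      path_image (\<gamma> e) \<inter> path_image (\<gamma> e') \<subseteq> p ` (e \<inter> e')"

text \<open>The locale speaks of edges alone so that it is inherited by every set of edges: the
  inductions below delete edges one at a time.\<close>

lemma drawing_subset: "drawing E p \<gamma> \<Longrightarrow> E' \<subseteq> E \<Longrightarrow> drawing E' p \<gamma>"
proof -
  assume d: "drawing E p \<gamma>" and sub: "E' \<subseteq> E"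
  interpret drawing E p \<gamma> by (rule d)
  show ?thesis
  proof
    show "finite E'" using fin_edges sub by (rule finite_subset[rotated])
  qed (use sub card_edge arc_edge ends_edge edges_meet in blast)+
qed

lemma plane_drawing_imp_drawing:
  assumes "plane_drawing G p \<gamma>" "simple_graph G"
  shows "drawing (edges G) p \<gamma>"
proof
  have sub: "\<Union>(edges G) \<subseteq> verts G" and fv: "finite (verts G)"
    using assms(2) by (auto simp: simple_graph_def)
  then show "finite (edges G)"
    using assms(2) by (meson finite_UnionD finite_subset)
qed (use assms in \<open>auto simp: plane_drawing_def simple_graph_def\<close>)

definition draw :: "('a set \<Rightarrow> real \<Rightarrow> complex) \<Rightarrow> 'a set set \<Rightarrow> complex set" where
  "draw \<gamma> E = (\<Union>e\<in>E. path_image (\<gamma> e))"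

abbreviation con :: "('a set \<Rightarrow> real \<Rightarrow> complex) \<Rightarrow> 'a set set \<Rightarrow> complex \<Rightarrow> complex \<Rightarrow> bool" where
  "con \<gamma> E \<equiv> connected_component (- draw \<gamma> E)"

lemma draw_insert: "draw \<gamma> (insert e E) = path_image (\<gamma> e) \<union> draw \<gamma> E"
  and draw_empty [simp]: "draw \<gamma> {} = {}"
  and draw_Un: "draw \<gamma> (A \<union> B) = draw \<gamma> A \<union> draw \<gamma> B"
  and draw_mono: "A \<subseteq> B \<Longrightarrow> draw \<gamma> A \<subseteq> draw \<gamma> B"
  by (auto simp: draw_def)

lemma con_mono: "con \<gamma> E a b \<Longrightarrow> E' \<subseteq> E \<Longrightarrow> con \<gamma> E' a b"
  by (meson Compl_anti_mono connected_component_of_subset draw_mono)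

lemma con_sym: "con \<gamma> E a b \<Longrightarrow> con \<gamma> E b a"
  by (rule connected_component_sym)

lemma con_trans: "con \<gamma> E a b \<Longrightarrow> con \<gamma> E b c \<Longrightarrow> con \<gamma> E a c"
  by (rule connected_component_trans)

lemma con_in: "con \<gamma> E a b \<Longrightarrow> a \<notin> draw \<gamma> E" "con \<gamma> E a b \<Longrightarrow> b \<notin> draw \<gamma> E"
  using connected_component_in by fastforce+

lemma con_refl: "a \<notin> draw \<gamma> E \<Longrightarrow> con \<gamma> E a a"
  by (simp add: connected_component_refl)

text \<open>A nonempty open part of the arc would embed in the real line, against invariance of
  dimension.\<close>

lemma interior_arc_image:
  fixes g :: "real \<Rightarrow> complex"
  assumes "arc g"
  shows "interior (path_image g) = {}"
proof (rule ccontr)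
  assume ne: "interior (path_image g) \<noteq> {}"
  obtain h where h: "homeomorphism {0..1} (path_image g) g h"
    using homeomorphism_arc[OF assms] by blast
  have "continuous_on (interior (path_image g)) h" "inj_on h (interior (path_image g))"
    using h interior_subset unfolding homeomorphism_def
    by (meson continuous_on_subset, metis inj_on_inverseI inj_on_subset interior_subset)
  then have "DIM(complex) \<le> DIM(real)"
    using invariance_of_dimension ne open_interior by blast
  then show False by simp
qed

context drawing
begin

lemma compact_draw: "compact (draw \<gamma> E)"
  unfolding draw_def using fin_edges arc_edge by (auto intro: compact_arc_image)

lemma open_compl_draw: "open (- draw \<gamma> E)"
  using compact_draw compact_imp_closed by blast

lemma oriented_edge_arc:
  assumes "{u, v} \<in> E"
  shows "\<exists>g. arc g \<and> pathstart g = p u \<and> pathfinish g = p v \<and> path_image g = path_image (\<gamma> {u, v})"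
proof -
  have a: "arc (\<gamma> {u, v})" and en: "{pathstart (\<gamma> {u, v}), pathfinish (\<gamma> {u, v})} = {p u, p v}"
    using assms arc_edge ends_edge by auto
  show ?thesis
  proof (cases "pathstart (\<gamma> {u, v}) = p u")
    case True
    then have "pathfinish (\<gamma> {u, v}) = p v" using en by (metis doubleton_eq_iff)
    then show ?thesis using a True by blast
  next
    case False
    then have "pathstart (\<gamma> {u, v}) = p v" "pathfinish (\<gamma> {u, v}) = p u" using en by (metis doubleton_eq_iff)+
    then show ?thesis using a by (intro exI[of _ "reversepath (\<gamma> {u, v})"]) (simp add: arc_reversepath)
  qed
qed

lemma upath_arc:
  assumes "upath E u v P"
  shows "\<exists>g. arc g \<and> pathstart g = p u \<and> pathfinish g = p v \<and> path_image g = draw \<gamma> P"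
  using assms
proof (induction rule: upath.induct)
  case (single u v)
  then show ?case using oriented_edge_arc by (simp add: draw_def)
next
  case (step u w v P)
  obtain h where h: "arc h" "pathstart h = p w" "pathfinish h = p v" "path_image h = draw \<gamma> P"
    using step.IH by blast
  obtain g where g: "arc g" "pathstart g = p u" "pathfinish g = p w" "path_image g = path_image (\<gamma> {u, w})"
    using oriented_edge_arc[OF step.hyps(1)] by blast
  have "path_image (\<gamma> {u, w}) \<inter> path_image (\<gamma> e) \<subseteq> {p w}" if "e \<in> P" for e
  proof -
    have "u \<notin> e" using that step.hyps(4) by blast
    moreover have "e \<in> E" using that upath_props(1)[OF step.hyps(3)] by blast
    ultimately show ?thesis using edges_meet[OF step.hyps(1), of e] by auto
  qed
  then have "path_image g \<inter> path_image h \<subseteq> {pathstart h}"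
    unfolding g h draw_def by blast
  then have "arc (g +++ h)" using g h by (simp add: arc_join)
  moreover have "path_image (g +++ h) = draw \<gamma> (insert {u, w} P)"
    using g h by (simp add: path_image_join draw_insert)
  ultimately show ?case using g h by (intro exI[of _ "g +++ h"]) simp
qed

lemma inner_edge_disjoint:
  assumes "e \<in> E" "E' \<subseteq> E - {e}"
  shows "path_image (\<gamma> e) \<inter> draw \<gamma> E' \<subseteq> p ` e"
  unfolding draw_def using edges_meet[OF assms(1)] assms(2) by blast

end

section \<open>Unions of faces and their boundaries as edge sets\<close>

definition face_union :: "('a set \<Rightarrow> real \<Rightarrow> complex) \<Rightarrow> 'a set set \<Rightarrow> complex set \<Rightarrow> bool" where
  "face_union \<gamma> E A \<longleftrightarrow> A \<subseteq> - draw \<gamma> E \<and> (\<forall>a\<in>A. \<forall>b. con \<gamma> E a b \<longrightarrow> b \<in> A)"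

text \<open>The boundary of a union \<open>A\<close> of faces: the two sides of an edge are the faces that merge when the edge is
  deleted, so no local structure of the drawing along the edge is needed.\<close>

definition bd :: "('a set \<Rightarrow> real \<Rightarrow> complex) \<Rightarrow> 'a set set \<Rightarrow> complex set \<Rightarrow> 'a set set" where
  "bd \<gamma> E A = {e \<in> E. \<exists>a\<in>A. \<exists>b. b \<notin> A \<and> b \<notin> draw \<gamma> E \<and> con \<gamma> (E - {e}) a b}"

lemma connected_subset_singleton: "S \<subseteq> {x} \<Longrightarrow> connected S"
  by (metis connected_empty connected_sing subset_singleton_iff)

context drawing
begin

lemma draw_remove: "e \<in> E \<Longrightarrow> draw \<gamma> E = path_image (\<gamma> e) \<union> draw \<gamma> (E - {e})"
  by (auto simp: draw_def)

lemma near_con: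
  assumes "E' \<subseteq> E" "y \<notin> draw \<gamma> E'"
  shows "\<exists>r>0. \<forall>x\<in>ball y r. con \<gamma> E' y x"
proof -
  interpret d: drawing E' p \<gamma> using drawing_axioms assms(1) by (rule drawing_subset)
  obtain r where r: "r > 0" "ball y r \<subseteq> - draw \<gamma> E'"
    using d.open_compl_draw assms(2) openE by blast
  then have "con \<gamma> E' y x" if "x \<in> ball y r" for x
    using that unfolding connected_component_def by (intro exI[of _ "ball y r"]) auto
  then show ?thesis using r(1) by blast
qed

text \<open>Deleting a bridge merges no faces. The other edges fall into \<open>E1\<close>,
  reachable from \<open>u\<close>, and \<open>E2\<close>; their drawings are disjoint and meet the
  arc at most in \<open>p u\<close> and \<open>p v\<close> respectively. As the complement of an arc
  is connected, Janiszewski's theorem adds first \<open>E1\<close> and then \<open>E2\<close> to the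
  arc.\<close>

lemma bridge_con:
  assumes e: "{u, v} \<in> E" and nr: "(u, v) \<notin> (adj (E - {{u, v}}))\<^sup>*"
    and ab: "con \<gamma> (E - {{u, v}}) a b" "a \<notin> draw \<gamma> E" "b \<notin> draw \<gamma> E"
  shows "con \<gamma> E a b"
proof -
  define E' where "E' = E - {{u, v}}"
  define E1 where "E1 = {f \<in> E'. \<exists>x\<in>f. (u, x) \<in> (adj E')\<^sup>*}"
  define E2 where "E2 = E' - E1"
  let ?T = "path_image (\<gamma> {u, v})"
  have subs: "E1 \<subseteq> E" "E2 \<subseteq> E" "E' = E1 \<union> E2" "{u, v} \<notin> E1" "{u, v} \<notin> E2"
    by (auto simp: E1_def E2_def E'_def)
  interpret d1: drawing E1 p \<gamma> using drawing_axioms subs(1) by (rule drawing_subset)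
  interpret d2: drawing E2 p \<gamma> using drawing_axioms subs(2) by (rule drawing_subset)
  have reach: "(u, y) \<in> (adj E')\<^sup>*" if "f \<in> E1" "y \<in> f" for f y
  proof -
    obtain x where x: "x \<in> f" "(u, x) \<in> (adj E')\<^sup>*" and f: "f \<in> E'" using \<open>f \<in> E1\<close> E1_def by blast
    show ?thesis
    proof (cases "x = y")
      case False
      have "card f = 2" using f card_edge E'_def by blast
      then have "f = {x, y}" using False x(1) that(2) by (metis card_2_iff doubleton_eq_iff insert_iff singletonD)
      then have "(x, y) \<in> adj E'" using f by simp
      then show ?thesis using x(2) by (rule rtrancl_into_rtrancl[rotated])
    qed (use x in simp)
  qed
  have sing: "path_image (\<gamma> f) \<inter> ?T \<subseteq> {p u}" if "f \<in> E1" for f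
  proof -
    have "v \<notin> f" using reach[OF that] nr E'_def by blast
    moreover have "path_image (\<gamma> f) \<inter> ?T \<subseteq> p ` (f \<inter> {u, v})"
      using edges_meet[of f "{u, v}"] e subs that by blast
    ultimately show ?thesis by blast
  qed
  have sing2: "path_image (\<gamma> f) \<inter> ?T \<subseteq> {p v}" if "f \<in> E2" for f
  proof -
    have "u \<notin> f" using that by (auto simp: E1_def E2_def)
    moreover have "path_image (\<gamma> f) \<inter> ?T \<subseteq> p ` (f \<inter> {u, v})"
      using edges_meet[of f "{u, v}"] e subs that by blast
    ultimately show ?thesis by blast
  qed
  have disj: "path_image (\<gamma> f) \<inter> path_image (\<gamma> f') = {}" if "f \<in> E1" "f' \<in> E2" for f f'
  proof -
    have "f \<inter> f' = {}" using reach[OF that(1)] that(2) unfolding E2_def E1_def by blast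
    moreover have "path_image (\<gamma> f) \<inter> path_image (\<gamma> f') \<subseteq> p ` (f \<inter> f')"
      using edges_meet[of f f'] that subs E2_def by blast
    ultimately show ?thesis by blast
  qed
  have arcT: "arc (\<gamma> {u, v})" using e by (rule arc_edge)
  have T: "compact ?T" "closed ?T" using arcT by (simp_all add: compact_arc_image closed_arc_image)
  have notT: "a \<notin> ?T" "b \<notin> ?T" using ab(2,3) e by (auto simp: draw_remove)
  have conT: "connected_component (- ?T) a b"
    using connected_arc_complement[OF arcT] notT
    by (simp add: connected_iff_connected_component)
  have 1: "connected_component (- (draw \<gamma> E1 \<union> ?T)) a b"
  proof (rule Janiszewski[OF d1.compact_draw T(2) _ _ conT])
    show "connected (draw \<gamma> E1 \<inter> ?T)"
      by (rule connected_subset_singleton[of _ "p u"]) (use sing in \<open>auto simp: draw_def\<close>)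
    show "con \<gamma> E1 a b" using ab(1) by (rule con_mono) (use subs E'_def in blast)
  qed
  have "connected_component (- ((draw \<gamma> E1 \<union> ?T) \<union> draw \<gamma> E2)) a b"
  proof (rule Janiszewski[OF _ _ _ 1])
    show "compact (draw \<gamma> E1 \<union> ?T)" using d1.compact_draw T(1) by (rule compact_Un)
    show "closed (draw \<gamma> E2)" using d2.compact_draw by (rule compact_imp_closed)
    show "connected ((draw \<gamma> E1 \<union> ?T) \<inter> draw \<gamma> E2)"
      by (rule connected_subset_singleton[of _ "p v"]) (use sing2 disj in \<open>fastforce simp: draw_def\<close>)
    show "con \<gamma> E2 a b" using ab(1) by (rule con_mono) (use subs E'_def in blast)
  qed
  moreover have "(draw \<gamma> E1 \<union> ?T) \<union> draw \<gamma> E2 = draw \<gamma> E"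
    using draw_remove[OF e] subs(3) E'_def draw_Un[of \<gamma> E1 E2] by auto
  ultimately show ?thesis by simp
qed

text \<open>The closed curve and the drawing of the remaining edges intersect exactly in the arc
  drawn by \<open>P\<close>, which is connected, so Janiszewski's theorem applies to the
  two.\<close>

lemma cycle_con:
  assumes e: "{u, v} \<in> E" and P: "upath (E - {{u, v}}) u v P"
    and ab: "con \<gamma> (E - {{u, v}}) a b"
    and same: "connected_component (- draw \<gamma> (insert {u, v} P)) a b"
  shows "con \<gamma> E a b"
proof -
  define E' where "E' = E - {{u, v}}"
  interpret d': drawing E' p \<gamma> using drawing_axioms by (rule drawing_subset) (auto simp: E'_def)
  have PE: "P \<subseteq> E'" using upath_props(1)[OF P] E'_def by blast
  obtain g where g: "arc g" "pathstart g = p u" "pathfinish g = p v" "path_image g = draw \<gamma> P"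
    using d'.upath_arc P E'_def by blast
  have ends: "p u \<in> draw \<gamma> P" "p v \<in> draw \<gamma> P"
    using g by (metis pathstart_in_path_image, metis pathfinish_in_path_image g(3,4))
  have "path_image (\<gamma> {u, v}) \<inter> draw \<gamma> E' \<subseteq> p ` {u, v}"
    using inner_edge_disjoint[OF e, of E'] E'_def by blast
  then have "draw \<gamma> E' \<inter> draw \<gamma> (insert {u, v} P) = draw \<gamma> P"
    using ends draw_mono[OF PE, of \<gamma>] unfolding draw_insert by auto
  then have c: "connected (draw \<gamma> E' \<inter> draw \<gamma> (insert {u, v} P))"
    using g by (metis connected_arc_image)
  have "closed (draw \<gamma> (insert {u, v} P))"
  proof -
    have "drawing (insert {u, v} P) p \<gamma>"
      using drawing_axioms by (rule drawing_subset) (use e PE E'_def in auto)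
    then show ?thesis by (simp add: drawing.compact_draw compact_imp_closed)
  qed
  then have "connected_component (- (draw \<gamma> E' \<union> draw \<gamma> (insert {u, v} P))) a b"
    using Janiszewski[OF d'.compact_draw _ c] ab same E'_def by blast
  moreover have "draw \<gamma> E' \<union> draw \<gamma> (insert {u, v} P) = draw \<gamma> E"
    using draw_remove[OF e] draw_mono[OF PE, of \<gamma>] E'_def unfolding draw_insert by blast
  ultimately show ?thesis by simp
qed

lemma cycle_curve:
  assumes e: "{u, v} \<in> E" and P: "upath (E - {{u, v}}) u v P"
  obtains c where "simple_path c" "pathfinish c = pathstart c" "path_image c = draw \<gamma> (insert {u, v} P)"
proof -
  define E' where "E' = E - {{u, v}}"
  interpret d': drawing E' p \<gamma> using drawing_axioms by (rule drawing_subset) (auto simp: E'_def)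
  have PE: "P \<subseteq> E'" using upath_props(1)[OF P] E'_def by blast
  obtain g where g: "arc g" "pathstart g = p u" "pathfinish g = p v" "path_image g = draw \<gamma> P"
    using d'.upath_arc P E'_def by blast
  have e': "{v, u} \<in> E" using e by (simp add: insert_commute)
  obtain h where h: "arc h" "pathstart h = p v" "pathfinish h = p u" "path_image h = path_image (\<gamma> {v, u})"
    using oriented_edge_arc[OF e'] by blast
  have "path_image (\<gamma> {u, v}) \<inter> draw \<gamma> E' \<subseteq> p ` {u, v}"
    using inner_edge_disjoint[OF e, of E'] E'_def by blast
  then have "path_image g \<inter> path_image h \<subseteq> {p u, p v}"
    using g h draw_mono[OF PE, of \<gamma>] by (auto simp: insert_commute)
  then have "simple_path (g +++ h)" using g h by (intro simple_path_join_loop) auto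
  moreover have "path_image (g +++ h) = draw \<gamma> (insert {u, v} P)"
    using g h by (simp add: path_image_join draw_insert insert_commute Un_commute)
  ultimately show thesis using that[of "g +++ h"] g h by simp
qed

lemma inner_point:
  assumes "e \<in> E" "0 < t" "t < 1"
  shows "\<gamma> e t \<in> path_image (\<gamma> e)" "\<gamma> e t \<notin> draw \<gamma> (E - {e})" "\<gamma> e t \<notin> p ` e"
proof -
  show 1: "\<gamma> e t \<in> path_image (\<gamma> e)" using assms by (auto simp: path_image_def)
  have "inj_on (\<gamma> e) {0..1}" using arc_edge[OF assms(1)] arc_def by blast
  then have "\<gamma> e t \<noteq> \<gamma> e 0" "\<gamma> e t \<noteq> \<gamma> e 1"
    using assms inj_on_eq_iff[of "\<gamma> e" "{0..1}" t 0] inj_on_eq_iff[of "\<gamma> e" "{0..1}" t 1] by auto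
  then show 3: "\<gamma> e t \<notin> p ` e"
    using ends_edge[OF assms(1)] unfolding pathstart_def pathfinish_def by (metis insert_iff singletonD)
  then show "\<gamma> e t \<notin> draw \<gamma> (E - {e})"
    using 1 inner_edge_disjoint[OF assms(1) order_refl] by blast
qed

text \<open>All faces that merge when \<open>e\<close> is deleted merge in one place: the enlarged
  component must contain a point of the arc, and the points of the arc off the other edges form a
  connected set with its midpoint.\<close>

lemma edge_face:
  assumes e: "e \<in> E" and ab: "con \<gamma> (E - {e}) a b" "\<not> con \<gamma> E a b"
  shows "con \<gamma> (E - {e}) a (\<gamma> e (1/2))"
proof -
  let ?E = "E - {e}"
  define K where "K = connected_component_set (- draw \<gamma> ?E) a"
  have K: "connected K" "K \<subseteq> - draw \<gamma> ?E" "a \<in> K" "b \<in> K"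
    using ab(1) by (auto simp: K_def connected_component_subset connected_component_refl con_in)
  have "K \<inter> path_image (\<gamma> e) \<noteq> {}"
  proof
    assume "K \<inter> path_image (\<gamma> e) = {}"
    then have "K \<subseteq> - draw \<gamma> E" using K(2) draw_remove[OF e] by blast
    then show False using ab(2) K unfolding connected_component_def by blast
  qed
  then obtain x where x: "x \<in> K" "x \<in> path_image (\<gamma> e)" by blast
  \<comment> \<open>An end of the arc that lies on no other edge belongs to \<open>J\<close>, so
    \<open>J\<close> is only known to lie between the open interval and its closure.\<close>
  define J where "J = {t \<in> {0..1}. \<gamma> e t \<notin> draw \<gamma> ?E}"
  have "connected J"
  proof (rule connected_intermediate_closure)
    show "connected {0<..<1::real}" by simp
    show "{0<..<1} \<subseteq> J" using inner_point[OF e] by (auto simp: J_def)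
    show "J \<subseteq> closure {0<..<1}" by (auto simp: J_def)
  qed
  moreover have "continuous_on J (\<gamma> e)"
  proof (rule continuous_on_subset)
    show "continuous_on {0..1} (\<gamma> e)" using arc_edge[OF e] by (simp add: arc_def path_def)
  qed (auto simp: J_def)
  ultimately have "connected (\<gamma> e ` J)" by (rule connected_continuous_image[rotated])
  moreover have "\<gamma> e ` J \<subseteq> - draw \<gamma> ?E" by (auto simp: J_def)
  moreover have "x \<in> \<gamma> e ` J" using x K(2) by (auto simp: J_def path_image_def)
  moreover have "\<gamma> e (1/2) \<in> \<gamma> e ` J" using inner_point[OF e] by (auto simp: J_def)
  ultimately have "con \<gamma> ?E x (\<gamma> e (1/2))" unfolding connected_component_def by blast
  moreover have "con \<gamma> ?E a x" using x(1) K_def by simp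
  ultimately show ?thesis by (rule con_trans[rotated])
qed

end

lemma face_unionD: "face_union \<gamma> E A \<Longrightarrow> a \<in> A \<Longrightarrow> con \<gamma> E a b \<Longrightarrow> b \<in> A"
  and face_union_subset: "face_union \<gamma> E A \<Longrightarrow> a \<in> A \<Longrightarrow> a \<notin> draw \<gamma> E"
  unfolding face_union_def by blast+

lemma face_union_iff: "face_union \<gamma> E A \<Longrightarrow> con \<gamma> E a b \<Longrightarrow> a \<in> A \<longleftrightarrow> b \<in> A"
  using face_unionD con_sym by metis

lemma face_union_sym_diff: "face_union \<gamma> E A \<Longrightarrow> face_union \<gamma> E B \<Longrightarrow> face_union \<gamma> E (sym_diff A B)"
  unfolding face_union_def using con_sym by fast

lemma bd_subset: "bd \<gamma> E A \<subseteq> E"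
  by (auto simp: bd_def)

text \<open>As \<open>M\<close> is connected, removing \<open>Q\<close> can separate it only if
  \<open>Q\<close> lies in \<open>M\<close> and both closures meet \<open>Q\<close>. Having no
  interior, \<open>Q\<close> is covered by the two closures; being connected, it then has a point in
  both. In \<open>bd_merged\<close>, \<open>Q\<close> is the deleted edge without its ends.\<close>

lemma common_frontier_point:
  fixes M :: "'a::real_normed_vector set"
  assumes M: "open M" "connected M" and Q: "connected Q" "interior Q = {}" "Q \<subseteq> M \<or> Q \<inter> M = {}"
    and 12: "open M1" "open M2" "M1 \<noteq> {}" "M2 \<noteq> {}" "M1 \<inter> M2 = {}" "M1 \<union> M2 = M - Q"
  shows "\<exists>y\<in>Q. y \<in> closure M1 \<and> y \<in> closure M2"
proof -
  have QM: "Q \<subseteq> M"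
  proof (rule ccontr)
    assume "\<not> Q \<subseteq> M"
    then have "M1 \<union> M2 = M" using Q(3) 12(6) by blast
    then show False using M(2) 12 unfolding connected_def by blast
  qed
  have cover: "Q \<subseteq> closure M1 \<union> closure M2"
  proof (rule ccontr)
    assume "\<not> Q \<subseteq> closure M1 \<union> closure M2"
    then obtain y where y: "y \<in> Q" "y \<notin> closure (M1 \<union> M2)" by auto
    let ?U = "M - closure (M1 \<union> M2)"
    have "open ?U" using M(1) by blast
    moreover have "?U \<subseteq> Q" using 12(6) closure_subset[of "M1 \<union> M2"] by blast
    moreover have "y \<in> ?U" using y QM by blast
    ultimately show False using Q(2) by (metis empty_iff interiorI)
  qed
  have ne: "Q \<inter> closure X \<noteq> {}"
    if X: "open X" "open Y" "X \<noteq> {}" "Y \<noteq> {}" "X \<inter> Y = {}" "X \<union> Y = M - Q" for X Y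
  proof
    assume a: "Q \<inter> closure X = {}"
    have "open (M - closure X)" using M(1) by blast
    moreover have "Y \<inter> closure X = {}" using X(2,5) by (metis Int_commute open_Int_closure_eq_empty)
    then have "M \<subseteq> X \<union> (M - closure X)" using a X(6) by blast
    moreover have "X \<inter> (M - closure X) \<inter> M = {}" using closure_subset by blast
    moreover have "X \<inter> M \<noteq> {}" "(M - closure X) \<inter> M \<noteq> {}"
      using X(3,4,6) \<open>Y \<inter> closure X = {}\<close> by blast+
    ultimately show False using M(2) X(1) unfolding connected_def by blast
  qed
  have "Q \<inter> closure M1 \<noteq> {}" "Q \<inter> closure M2 \<noteq> {}"
    using ne[of M1 M2] ne[of M2 M1] 12 by (auto simp: Int_commute Un_commute)
  then have "closure M1 \<inter> closure M2 \<inter> Q \<noteq> {}"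
    using Q(1) cover closed_closure[of M1] closed_closure[of M2] unfolding connected_closed
    by (simp add: Int_commute) blast
  then show ?thesis by blast
qed

context drawing
begin

lemma edge_doubleton: "e \<in> E \<Longrightarrow> \<exists>u v. e = {u, v} \<and> u \<noteq> v"
  using card_edge by (meson card_2_iff)

lemma compl_draw_nonempty: "\<exists>x. x \<notin> draw \<gamma> E"
proof (rule ccontr)
  assume "\<not> ?thesis"
  then have "draw \<gamma> E = UNIV" by blast
  then show False using compact_imp_bounded[OF compact_draw] not_bounded_UNIV by simp
qed

lemma separating_edge_cycle:
  assumes e: "{u, v} \<in> E" and uv: "u \<noteq> v" and con: "con \<gamma> (E - {{u, v}}) a b" "\<not> con \<gamma> E a b"
    and ab: "a \<notin> draw \<gamma> E" "b \<notin> draw \<gamma> E"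
  shows "\<exists>P. upath (E - {{u, v}}) u v P"
  using bridge_con[OF e _ con(1) ab] con(2) reachable_imp_upath[OF _ uv] by blast

lemma same_side_con:
  assumes e: "{u, v} \<in> E" and P: "upath (E - {{u, v}}) u v P"
    and con: "con \<gamma> (E - {{u, v}}) a b" and ab: "a \<notin> draw \<gamma> E" "b \<notin> draw \<gamma> E"
    and side: "a \<in> inside (draw \<gamma> (insert {u, v} P)) \<longleftrightarrow> b \<in> inside (draw \<gamma> (insert {u, v} P))"
  shows "con \<gamma> E a b"
proof (rule cycle_con[OF e P con])
  let ?C = "draw \<gamma> (insert {u, v} P)"
  obtain c where c: "simple_path c" "pathfinish c = pathstart c" "path_image c = ?C"
    by (rule cycle_curve[OF e P])
  note J = Jordan_inside_outside[OF c(1,2), unfolded c(3)]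
  have "insert {u, v} P \<subseteq> E" using e upath_props(1)[OF P] by blast
  from draw_mono[OF this, of \<gamma>] have "a \<in> - ?C" "b \<in> - ?C" using ab by blast+
  then have "a \<in> inside ?C \<and> b \<in> inside ?C \<or> a \<in> outside ?C \<and> b \<in> outside ?C"
    using J side by blast
  then show "connected_component (- ?C) a b"
    using J connected_componentI by (metis Un_upper1 Un_upper2)
qed

text \<open>If deleting \<open>e\<close> merges two different faces, then \<open>e\<close> lies on a
  cycle, and the merging points are told apart by lying inside or outside of it; so exactly two
  faces merge. Otherwise \<open>e\<close> belongs to no boundary, and a single point serves as both
  sides.\<close>

lemma edge_sides:
  assumes e: "e \<in> E"
  shows "\<exists>l r. l \<notin> draw \<gamma> E \<and> r \<notin> draw \<gamma> E \<and>
    (\<forall>A. face_union \<gamma> E A \<longrightarrow> (e \<in> bd \<gamma> E A \<longleftrightarrow> (l \<in> A) \<noteq> (r \<in> A)))"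
proof (cases "\<exists>l r. l \<notin> draw \<gamma> E \<and> r \<notin> draw \<gamma> E \<and> con \<gamma> (E - {e}) l r \<and> \<not> con \<gamma> E l r")
  case False
  obtain x where x: "x \<notin> draw \<gamma> E" using compl_draw_nonempty by blast
  have "e \<notin> bd \<gamma> E A" if "face_union \<gamma> E A" for A
    using False face_unionD[OF that] face_union_subset[OF that] unfolding bd_def by blast
  then show ?thesis using x by blast
next
  case True
  then obtain l r where lr: "l \<notin> draw \<gamma> E" "r \<notin> draw \<gamma> E" "con \<gamma> (E - {e}) l r" "\<not> con \<gamma> E l r" by blast
  obtain u v where uv: "e = {u, v}" "u \<noteq> v" using edge_doubleton[OF e] by blast
  have e': "{u, v} \<in> E" using e uv by simp
  obtain P where P: "upath (E - {e}) u v P"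
    using separating_edge_cycle[OF e' uv(2)] lr uv by blast
  let ?in = "inside (draw \<gamma> (insert {u, v} P))"
  have side: "con \<gamma> E a b" if "con \<gamma> (E - {e}) a b" "a \<notin> draw \<gamma> E" "b \<notin> draw \<gamma> E" "a \<in> ?in \<longleftrightarrow> b \<in> ?in" for a b
    using same_side_con[OF e', of P a b] P uv that by blast
  have "e \<in> bd \<gamma> E A \<longleftrightarrow> (l \<in> A) \<noteq> (r \<in> A)" if A: "face_union \<gamma> E A" for A
  proof
    assume "e \<in> bd \<gamma> E A"
    then obtain a b where ab: "a \<in> A" "b \<notin> A" "b \<notin> draw \<gamma> E" "con \<gamma> (E - {e}) a b"
      unfolding bd_def by blast
    have a: "a \<notin> draw \<gamma> E" using face_union_subset[OF A ab(1)] .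
    have nab: "\<not> con \<gamma> E a b" using face_unionD[OF A ab(1)] ab(2) by blast
    \<comment> \<open>Both pairs merge through the midpoint of the arc, so all four points are
      connected once \<open>e\<close> is deleted. Each pair has one point inside the cycle and one
      not inside, which matches the faces of \<open>a\<close>, \<open>b\<close> with those of
      \<open>l\<close>, \<open>r\<close>.\<close>
    have "con \<gamma> (E - {e}) a l"
      using edge_face[OF e ab(4) nab] edge_face[OF e lr(3,4)] con_sym con_trans by metis
    then have all: "con \<gamma> (E - {e}) a l" "con \<gamma> (E - {e}) a r" "con \<gamma> (E - {e}) b l" "con \<gamma> (E - {e}) b r"
      using ab(4) lr(3) con_sym con_trans by metis+
    have "(a \<in> ?in) \<noteq> (b \<in> ?in)" "(l \<in> ?in) \<noteq> (r \<in> ?in)"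
      using side[OF ab(4) a ab(3)] nab side[OF lr(3,1,2)] lr(4) by blast+
    then have "con \<gamma> E a l \<and> con \<gamma> E b r \<or> con \<gamma> E a r \<and> con \<gamma> E b l"
      using side[OF all(1) a lr(1)] side[OF all(2) a lr(2)] side[OF all(3) ab(3) lr(1)]
        side[OF all(4) ab(3) lr(2)] by blast
    then show "(l \<in> A) \<noteq> (r \<in> A)"
      using ab(1,2) face_union_iff[OF A] by blast
  next
    assume "(l \<in> A) \<noteq> (r \<in> A)"
    then show "e \<in> bd \<gamma> E A"
      using e lr con_sym[OF lr(3)] unfolding bd_def by blast
  qed
  then show ?thesis using lr by blast
qed

text \<open>Whether \<open>e\<close> is in the boundary is the parity of the number of its two sides
  in the set, and this parity is additive.\<close>

lemma bd_sym_diff: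
  assumes "face_union \<gamma> E A" "face_union \<gamma> E B"
  shows "bd \<gamma> E (sym_diff A B) = sym_diff (bd \<gamma> E A) (bd \<gamma> E B)"
proof -
  have "e \<in> bd \<gamma> E (sym_diff A B) \<longleftrightarrow> e \<in> sym_diff (bd \<gamma> E A) (bd \<gamma> E B)" if e: "e \<in> E" for e
  proof -
    obtain l r where lr: "\<forall>A. face_union \<gamma> E A \<longrightarrow> (e \<in> bd \<gamma> E A \<longleftrightarrow> (l \<in> A) \<noteq> (r \<in> A))"
      using edge_sides[OF e] by blast
    show ?thesis using lr assms face_union_sym_diff[OF assms] by blast
  qed
  then show ?thesis using bd_subset[of \<gamma> E] by blast
qed

lemma dense_compl_edge:
  assumes "e \<in> E" "open U" "x \<in> U"
  shows "\<exists>y\<in>U. y \<notin> path_image (\<gamma> e)"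
  using interior_arc_image[OF arc_edge[OF assms(1)]] assms(2,3)
  by (metis empty_iff interiorI subsetI)

text \<open>By the Jordan curve theorem, points inside and outside the cycle occur arbitrarily close
  to the midpoint of \<open>f\<close>, and a small disc there avoids all other edges.\<close>

lemma near_edge_sides:
  assumes e: "{u, v} \<in> E" and P: "upath (E - {{u, v}}) u v P" and f: "f \<in> insert {u, v} P"
  shows "\<exists>l r. l \<notin> draw \<gamma> E \<and> r \<notin> draw \<gamma> E \<and> con \<gamma> (E - {f}) l r \<and>
    l \<in> inside (draw \<gamma> (insert {u, v} P)) \<and> r \<notin> inside (draw \<gamma> (insert {u, v} P))"
proof -
  let ?C = "draw \<gamma> (insert {u, v} P)"
  obtain c where c: "simple_path c" "pathfinish c = pathstart c" "path_image c = ?C"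
    by (rule cycle_curve[OF e P])
  note J = Jordan_inside_outside[OF c(1,2), unfolded c(3)]
  have fE: "f \<in> E" using f e upath_props(1)[OF P] by blast
  let ?y = "\<gamma> f (1/2)"
  have y: "?y \<in> path_image (\<gamma> f)" "?y \<notin> draw \<gamma> (E - {f})" using inner_point[OF fE] by auto
  have fC: "path_image (\<gamma> f) \<subseteq> ?C" using f by (auto simp: draw_def)
  obtain \<delta> where \<delta>: "\<delta> > 0" "\<forall>x\<in>ball ?y \<delta>. con \<gamma> (E - {f}) ?y x"
    using near_con[of "E - {f}" ?y] y(2) by blast
  have "?y \<in> frontier (inside ?C)" "?y \<in> frontier (outside ?C)" using J y(1) fC by blast+
  then obtain l r where lr: "l \<in> inside ?C" "l \<in> ball ?y \<delta>" "r \<in> outside ?C" "r \<in> ball ?y \<delta>"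
    using \<delta>(1) unfolding frontier_straddle by (metis mem_ball)
  have "l \<notin> path_image (\<gamma> f)" "r \<notin> path_image (\<gamma> f)" "r \<notin> inside ?C" using lr J fC by blast+
  moreover have "con \<gamma> (E - {f}) ?y l" "con \<gamma> (E - {f}) ?y r" using \<delta>(2) lr by blast+
  moreover from this have "con \<gamma> (E - {f}) l r" using con_sym con_trans by metis
  ultimately show ?thesis using lr(1) con_in draw_remove[OF fE] by (metis UnE)
qed

lemma face_union_inside:
  assumes e: "{u, v} \<in> E" and P: "upath (E - {{u, v}}) u v P"
  shows "face_union \<gamma> E (inside (draw \<gamma> (insert {u, v} P)) - draw \<gamma> E)"
proof -
  let ?C = "draw \<gamma> (insert {u, v} P)"
  have sub: "insert {u, v} P \<subseteq> E" using e upath_props(1)[OF P] by blast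
  have "b \<in> inside ?C - draw \<gamma> E" if "a \<in> inside ?C" "con \<gamma> E a b" for a b
    using inside_same_component[OF con_mono[OF that(2) sub] that(1)] con_in(2)[OF that(2)] by blast
  then show ?thesis unfolding face_union_def by blast
qed

lemma bd_inside:
  assumes e: "{u, v} \<in> E" and P: "upath (E - {{u, v}}) u v P"
  shows "bd \<gamma> E (inside (draw \<gamma> (insert {u, v} P)) - draw \<gamma> E) = insert {u, v} P"
proof (intro subset_antisym subsetI)
  have sub: "insert {u, v} P \<subseteq> E" using e upath_props(1)[OF P] by blast
  fix f assume f: "f \<in> insert {u, v} P"
  then have fE: "f \<in> E" using sub by blast
  show "f \<in> bd \<gamma> E (inside (draw \<gamma> (insert {u, v} P)) - draw \<gamma> E)"
    using near_edge_sides[OF e P f] fE unfolding bd_def by blast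
next
  have sub: "insert {u, v} P \<subseteq> E" using e upath_props(1)[OF P] by blast
  let ?C = "draw \<gamma> (insert {u, v} P)"
  fix f assume "f \<in> bd \<gamma> E (inside ?C - draw \<gamma> E)"
  then obtain a b where ab: "a \<in> inside ?C" "b \<notin> inside ?C" "con \<gamma> (E - {f}) a b"
    unfolding bd_def by blast
  show "f \<in> insert {u, v} P"
  proof (rule ccontr)
    assume "f \<notin> insert {u, v} P"
    then have "insert {u, v} P \<subseteq> E - {f}" using sub by blast
    then show False using ab con_mono inside_same_component by metis
  qed
qed

definition merged :: "'a set \<Rightarrow> complex set \<Rightarrow> complex set" where
  "merged e A = {x. \<exists>a\<in>A. con \<gamma> (E - {e}) a x}"

lemma face_union_merged: "face_union \<gamma> (E - {e}) (merged e A)"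
  unfolding face_union_def merged_def using con_in con_trans by blast

lemma merged_inter:
  assumes A: "face_union \<gamma> E A" and e: "e \<in> E" "e \<notin> bd \<gamma> E A"
  shows "A \<subseteq> merged e A" "x \<in> merged e A \<Longrightarrow> x \<notin> draw \<gamma> E \<Longrightarrow> x \<in> A"
proof -
  show "A \<subseteq> merged e A"
    using face_union_subset[OF A] draw_mono[of "E - {e}" E \<gamma>] con_refl unfolding merged_def by blast
  show "x \<in> merged e A \<Longrightarrow> x \<notin> draw \<gamma> E \<Longrightarrow> x \<in> A"
    using e unfolding merged_def bd_def by blast
qed

end

context drawing
begin

text \<open>One inclusion is monotonicity. For the other, suppose that \<open>e'\<close> bounds the
  merged set but not \<open>A\<close>. With both edges deleted, a single component then meets both
  \<open>A2\<close>, which is what \<open>A\<close> becomes without \<open>e'\<close>, and the rest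
  \<open>B2\<close>. Only the arc of \<open>e\<close> can separate the two there, so near some point
  of the arc \<open>A\<close> and its complement come together when \<open>e\<close> alone is
  deleted, which puts \<open>e\<close> into \<open>bd \<gamma> E A\<close>.\<close>

lemma bd_merged:
  assumes A: "face_union \<gamma> E A" and e: "e \<in> E" "e \<notin> bd \<gamma> E A"
  shows "bd \<gamma> (E - {e}) (merged e A) = bd \<gamma> E A"
proof (intro subset_antisym subsetI)
  fix e' assume e': "e' \<in> bd \<gamma> E A"
  then have ne: "e' \<noteq> e" "e' \<in> E" using e bd_subset[of \<gamma> E A] by blast+
  obtain a b where ab: "a \<in> A" "b \<notin> A" "b \<notin> draw \<gamma> E" "con \<gamma> (E - {e'}) a b"
    using e' unfolding bd_def by blast
  have "con \<gamma> (E - {e} - {e'}) a b" using ab(4) by (rule con_mono) blast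
  moreover have "a \<in> merged e A" "b \<notin> merged e A" using merged_inter[OF A e] ab by blast+
  moreover have "b \<notin> draw \<gamma> (E - {e})" using ab(3) draw_mono[of "E - {e}" E \<gamma>] by blast
  ultimately show "e' \<in> bd \<gamma> (E - {e}) (merged e A)" using ne unfolding bd_def by blast
next
  fix e' assume "e' \<in> bd \<gamma> (E - {e}) (merged e A)"
  then obtain a b where e': "e' \<in> E" "e' \<noteq> e" and ab: "a \<in> merged e A" "b \<notin> merged e A"
    "b \<notin> draw \<gamma> (E - {e})" "con \<gamma> (E - {e} - {e'}) a b"
    unfolding bd_def by blast
  show "e' \<in> bd \<gamma> E A"
  proof (rule ccontr)
    assume "e' \<notin> bd \<gamma> E A"
    then have H: "y \<in> A" if "x \<in> A" "con \<gamma> (E - {e'}) x y" "y \<notin> draw \<gamma> E" for x y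
      using that e' unfolding bd_def by blast
    define E2 where "E2 = E - {e} - {e'}"
    interpret d2: drawing E2 p \<gamma> using drawing_axioms by (rule drawing_subset) (auto simp: E2_def)
    interpret d': drawing "E - {e'}" p \<gamma> using drawing_axioms by (rule drawing_subset) auto
    have d'E: "draw \<gamma> (E - {e'}) = path_image (\<gamma> e) \<union> draw \<gamma> E2"
      using e(1) e'(2) by (auto simp: draw_def E2_def)
    have dE: "draw \<gamma> E = path_image (\<gamma> e) \<union> draw \<gamma> (E - {e})"
      using draw_remove[OF e(1)] .
    have pe: "p ` e \<subseteq> path_image (\<gamma> e)"
      using ends_edge[OF e(1)] pathstart_in_path_image pathfinish_in_path_image
      by (metis empty_subsetI insert_subset)
    obtain a0 where a0: "a0 \<in> A" "con \<gamma> (E - {e}) a0 a" using ab(1) unfolding merged_def by blast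
    have a0E: "a0 \<notin> draw \<gamma> E" using face_union_subset[OF A a0(1)] .
    \<comment> \<open>The point \<open>b\<close> may lie on the arc of \<open>e\<close>; a nearby
      point off the arc replaces it.\<close>
    obtain \<delta> where \<delta>: "\<delta> > 0" "\<forall>x\<in>ball b \<delta>. con \<gamma> (E - {e}) b x"
      using near_con[of "E - {e}" b] ab(3) by blast
    obtain b0 where b0: "b0 \<in> ball b \<delta>" "b0 \<notin> path_image (\<gamma> e)"
      using dense_compl_edge[OF e(1) open_ball, of b b \<delta>] \<delta>(1) by auto
    then have b0c: "con \<gamma> (E - {e}) b b0" using \<delta>(2) by blast
    have b0E: "b0 \<notin> draw \<gamma> E" using b0(2) con_in(2)[OF b0c] dE by blast
    have b0A: "b0 \<notin> A"
      using ab(2) face_union_iff[OF face_union_merged b0c] merged_inter(1)[OF A e] by blast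
    define M0 where "M0 = connected_component_set (- draw \<gamma> E2) a"
    \<comment> \<open>Other edges may end where the arc ends, so both ends are left out. An open
      connected set of the plane stays connected without finitely many points, and \<open>Q\<close>
      now lies in \<open>M\<close> or misses it.\<close>
    define M where "M = M0 - p ` e"
    define Q where "Q = path_image (\<gamma> e) - p ` e"
    define A2 where "A2 = {x. \<exists>y\<in>A. con \<gamma> (E - {e'}) y x}"
    define B2 where "B2 = - draw \<gamma> (E - {e'}) - A2"
    have "con \<gamma> E2 a0 a" using a0(2) by (rule con_mono) (auto simp: E2_def)
    then have a0M: "a0 \<in> M0" using con_sym unfolding M0_def by blast
    have "con \<gamma> E2 b b0" using b0c by (rule con_mono) (auto simp: E2_def)
    then have b0M: "b0 \<in> M0" using ab(4) con_trans unfolding M0_def E2_def by blast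
    have oM0: "open M0" "connected M0"
      unfolding M0_def using open_connected_component[OF d2.open_compl_draw] by auto
    have fe: "finite (p ` e)" using card_edge[OF e(1)] by (metis card.infinite finite_imageI zero_neq_numeral)
    have oM: "open M" "connected M"
      unfolding M_def using oM0 fe by (auto intro: connected_open_delete_finite finite_imp_closed)
    have Qeq: "Q = \<gamma> e ` {0<..<1}"
    proof
      show "\<gamma> e ` {0<..<1} \<subseteq> Q" using inner_point[OF e(1)] unfolding Q_def
        by (metis (no_types, lifting) DiffI greaterThanLessThan_iff image_subsetI)
      show "Q \<subseteq> \<gamma> e ` {0<..<1}"
      proof
        fix x assume x: "x \<in> Q"
        then obtain t where t: "t \<in> {0..1}" "x = \<gamma> e t" unfolding Q_def path_image_def by blast
        have "t \<noteq> 0" "t \<noteq> 1"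
          using x t ends_edge[OF e(1)] unfolding Q_def pathstart_def pathfinish_def by blast+
        then show "x \<in> \<gamma> e ` {0<..<1}" using t by force
      qed
    qed
    have "continuous_on {0<..<1} (\<gamma> e)"
      using arc_edge[OF e(1)] unfolding arc_def path_def
      by (meson continuous_on_subset greaterThanLessThan_subseteq_atLeastAtMost_iff order_refl)
    then have cQ: "connected Q" unfolding Qeq by (intro connected_continuous_image) auto
    have iQ: "interior Q = {}"
      using interior_arc_image[OF arc_edge[OF e(1)]] interior_mono[of Q "path_image (\<gamma> e)"]
      unfolding Q_def by blast
    have QE: "Q \<subseteq> - draw \<gamma> (E - {e})" unfolding Qeq using inner_point[OF e(1)] by auto
    then have QE2: "Q \<subseteq> - draw \<gamma> E2"
      using draw_mono[of E2 "E - {e}" \<gamma>] by (auto simp: E2_def)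
    have QM: "Q \<subseteq> M \<or> Q \<inter> M = {}"
    proof (cases "Q \<inter> M0 = {}")
      case False
      then obtain x where x: "x \<in> Q" "x \<in> M0" by blast
      have "con \<gamma> E2 x z" if "z \<in> Q" for z
        using connected_componentI[OF cQ QE2 x(1) that] .
      then have "Q \<subseteq> M0" using x(2) con_trans unfolding M0_def by blast
      then show ?thesis unfolding M_def Q_def by blast
    qed (auto simp: M_def)
    have "A2 = (\<Union>y\<in>A. connected_component_set (- draw \<gamma> (E - {e'})) y)" unfolding A2_def by blast
    then have oA2: "open A2" using open_connected_component[OF d'.open_compl_draw] by auto
    have "B2 = (\<Union>y\<in>B2. connected_component_set (- draw \<gamma> (E - {e'})) y)"
    proof
      show "B2 \<subseteq> (\<Union>y\<in>B2. connected_component_set (- draw \<gamma> (E - {e'})) y)"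
        using con_refl[of _ \<gamma> "E - {e'}"] unfolding B2_def by blast
      have "z \<in> B2" if "y \<in> B2" "con \<gamma> (E - {e'}) y z" for y z
        using that con_in(2)[OF that(2)] con_trans[OF _ con_sym[OF that(2)]]
        unfolding B2_def A2_def by blast
      then show "(\<Union>y\<in>B2. connected_component_set (- draw \<gamma> (E - {e'})) y) \<subseteq> B2" by blast
    qed
    then have oB2: "open B2" using open_connected_component[OF d'.open_compl_draw] by (metis open_UN)
    have WM: "M - Q = M \<inter> - draw \<gamma> (E - {e'})"
      using d'E connected_component_subset[of "- draw \<gamma> E2" a] unfolding M_def M0_def Q_def by blast
    have A2W: "A2 \<subseteq> - draw \<gamma> (E - {e'})" unfolding A2_def using con_in(2) by blast
    have d'sub: "- draw \<gamma> E \<subseteq> - draw \<gamma> (E - {e'})" using draw_mono[of "E - {e'}" E \<gamma>] by blast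
    have "\<exists>y\<in>Q. y \<in> closure (M \<inter> A2) \<and> y \<in> closure (M \<inter> B2)"
    proof (rule common_frontier_point[OF oM cQ iQ QM])
      show "open (M \<inter> A2)" "open (M \<inter> B2)" using oM oA2 oB2 by auto
      have "a0 \<in> A2" using a0(1) a0E d'sub con_refl[of a0 \<gamma> "E - {e'}"] unfolding A2_def by blast
      moreover have "a0 \<in> M" using a0M a0E pe dE unfolding M_def by blast
      ultimately show "M \<inter> A2 \<noteq> {}" by blast
      have "b0 \<notin> A2" using H[OF _ _ b0E] b0A unfolding A2_def by blast
      then have "b0 \<in> B2" using b0E d'sub unfolding B2_def by blast
      moreover have "b0 \<in> M" using b0M b0E pe dE unfolding M_def by blast
      ultimately show "M \<inter> B2 \<noteq> {}" by blast
      show "M \<inter> A2 \<inter> (M \<inter> B2) = {}" unfolding B2_def by blast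
      show "M \<inter> A2 \<union> M \<inter> B2 = M - Q" unfolding WM using A2W unfolding B2_def by blast
    qed
    then obtain y where y: "y \<in> Q" "y \<in> closure (M \<inter> A2)" "y \<in> closure (M \<inter> B2)" by blast
    obtain \<epsilon> where \<epsilon>: "\<epsilon> > 0" "\<forall>x\<in>ball y \<epsilon>. con \<gamma> (E - {e}) y x"
      using near_con[of "E - {e}" y] QE y(1) by blast
    obtain m1 m2 where m: "m1 \<in> M \<inter> A2" "m2 \<in> M \<inter> B2" "m1 \<in> ball y \<epsilon>" "m2 \<in> ball y \<epsilon>"
      using y(2,3) \<epsilon>(1) unfolding closure_approachable by (metis dist_commute mem_ball)
    have mc: "con \<gamma> (E - {e}) y m1" "con \<gamma> (E - {e}) y m2" using \<epsilon>(2) m by blast+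
    have mE: "m1 \<notin> draw \<gamma> E" "m2 \<notin> draw \<gamma> E"
      using m con_in(2)[OF mc(1)] con_in(2)[OF mc(2)] A2W d'E dE unfolding B2_def by blast+
    have "m1 \<in> A" using m(1) H[OF _ _ mE(1)] unfolding A2_def by blast
    moreover have "m2 \<notin> A"
      using m(2) con_refl[of m2 \<gamma> "E - {e'}"] unfolding A2_def B2_def by blast
    moreover have "con \<gamma> (E - {e}) m1 m2" using mc con_sym con_trans by metis
    ultimately show False using e mE(2) unfolding bd_def by blast
  qed
qed

end

text \<open>An edge outside the boundary can be deleted without changing the boundary. If every edge
  is in the boundary, each lies on a cycle; adding the inside of such a cycle to \<open>A\<close>
  changes the boundary by the cycle, whose degrees are even, and frees an edge for deletion.\<close>

lemma even_degrees_bd: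
  assumes "drawing E p \<gamma>" "face_union \<gamma> E A"
  shows "even_degrees (bd \<gamma> E A)"
  using assms
proof (induction "card E" arbitrary: E A rule: less_induct)
  case less
  interpret drawing E p \<gamma> by (rule less.prems)
  have step: "even_degrees (bd \<gamma> E B)" if B: "face_union \<gamma> E B" and e: "e \<in> E" "e \<notin> bd \<gamma> E B" for B e
  proof -
    have "even_degrees (bd \<gamma> (E - {e}) (merged e B))"
    proof (rule less.hyps)
      show "card (E - {e}) < card E" using fin_edges e(1) by (rule card_Diff1_less)
      show "drawing (E - {e}) p \<gamma>" using drawing_axioms by (rule drawing_subset) blast
    qed (rule face_union_merged)
    then show ?thesis using bd_merged[OF B e] by simp
  qed
  show ?case
  proof (cases "\<exists>e\<in>E. e \<notin> bd \<gamma> E A")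
    case True
    then show ?thesis using step less.prems(2) by blast
  next
    case False
    show ?thesis
    proof (cases "E = {}")
      case True
      then show ?thesis using bd_subset[of \<gamma> E A] by (simp add: even_degrees_def)
    next
      case ne: False
      then obtain e where e: "e \<in> E" by blast
      then have "e \<in> bd \<gamma> E A" using False by blast
      then obtain a b where ab: "a \<in> A" "b \<notin> A" "b \<notin> draw \<gamma> E" "con \<gamma> (E - {e}) a b"
        unfolding bd_def by blast
      have a: "a \<notin> draw \<gamma> E" "\<not> con \<gamma> E a b"
        using face_union_subset[OF less.prems(2) ab(1)] face_unionD[OF less.prems(2) ab(1)] ab(2) by blast+
      obtain u v where uv: "e = {u, v}" "u \<noteq> v" using edge_doubleton[OF e] by blast
      have e': "{u, v} \<in> E" using e uv(1) by simp
      obtain P where P: "upath (E - {{u, v}}) u v P"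
        using separating_edge_cycle[OF e' uv(2)] ab a uv(1) by blast
      let ?I = "inside (draw \<gamma> (insert {u, v} P)) - draw \<gamma> E"
      let ?B = "sym_diff A ?I"
      note I = face_union_inside[OF e' P]
      have B: "face_union \<gamma> E ?B" using less.prems(2) I by (rule face_union_sym_diff)
      have bdB: "bd \<gamma> E ?B = sym_diff (bd \<gamma> E A) (insert {u, v} P)"
        using bd_sym_diff[OF less.prems(2) I] bd_inside[OF e' P] by simp
      then have "e \<notin> bd \<gamma> E ?B" using uv(1) \<open>e \<in> bd \<gamma> E A\<close> by blast
      then have ev: "even_degrees (bd \<gamma> E ?B)" using step[OF B e] by blast
      have notin: "{u, v} \<notin> P" using upath_props(1)[OF P] by blast
      have "bd \<gamma> E A = sym_diff (bd \<gamma> E ?B) (insert {u, v} P)" using bdB by blast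
      moreover have "finite (bd \<gamma> E ?B)" using bd_subset fin_edges by (rule finite_subset)
      moreover have "finite (insert {u, v} P)" using upath_props(2)[OF P] by simp
      ultimately show ?thesis
        using even_degrees_sym_diff ev upath_closed_even_degrees[OF P notin] by metis
    qed
  qed
qed

text \<open>With an empty boundary all edges can be deleted in turn, until the complement is the
  whole plane, which is connected.\<close>

lemma bd_empty_imp_trivial:
  assumes "drawing E p \<gamma>" "face_union \<gamma> E A" "bd \<gamma> E A = {}"
  shows "A = {} \<or> A = - draw \<gamma> E"
  using assms
proof (induction "card E" arbitrary: E A rule: less_induct)
  case less
  interpret drawing E p \<gamma> by (rule less.prems)
  show ?case
  proof (cases "E = {}")
    case True
    have "connected_component UNIV a b" for a b :: complex
      by (rule connected_componentI[OF connected_UNIV]) auto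
    then show ?thesis using less.prems(2) True unfolding face_union_def by auto
  next
    case False
    then obtain e where e: "e \<in> E" by blast
    have ne: "e \<notin> bd \<gamma> E A" using less.prems(3) by simp
    have "merged e A = {} \<or> merged e A = - draw \<gamma> (E - {e})"
    proof (rule less.hyps)
      show "card (E - {e}) < card E" using fin_edges e by (rule card_Diff1_less)
      show "drawing (E - {e}) p \<gamma>" using drawing_axioms by (rule drawing_subset) blast
      show "bd \<gamma> (E - {e}) (merged e A) = {}" using bd_merged[OF less.prems(2) e ne] less.prems(3) by simp
    qed (rule face_union_merged)
    then show ?thesis
      using merged_inter[OF less.prems(2) e ne] draw_mono[of "E - {e}" E \<gamma>] less.prems(2)
      unfolding face_union_def by blast
  qed
qed

section \<open>Single faces and Euler's inequality\<close>

definition face :: "('a set \<Rightarrow> real \<Rightarrow> complex) \<Rightarrow> 'a set set \<Rightarrow> complex \<Rightarrow> complex set" where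
  "face \<gamma> E x = {y. con \<gamma> E x y}"

definition faces :: "('a set \<Rightarrow> real \<Rightarrow> complex) \<Rightarrow> 'a set set \<Rightarrow> complex set set" where
  "faces \<gamma> E = face \<gamma> E ` (- draw \<gamma> E)"

lemma face_eq_iff: "y \<notin> draw \<gamma> E \<Longrightarrow> face \<gamma> E x = face \<gamma> E y \<longleftrightarrow> con \<gamma> E x y"
  unfolding face_def using con_refl con_sym con_trans
  by (smt (verit, ccfv_threshold) Collect_cong mem_Collect_eq)

lemma face_union_face: "face_union \<gamma> E (face \<gamma> E x)"
  unfolding face_union_def face_def using con_in con_trans by blast

lemma face_union_faces: "f \<in> faces \<gamma> E \<Longrightarrow> face_union \<gamma> E f"
  using face_union_face by (auto simp: faces_def)

lemma faces_disjoint: "f \<in> faces \<gamma> E \<Longrightarrow> g \<in> faces \<gamma> E \<Longrightarrow> f \<noteq> g \<Longrightarrow> f \<inter> g = {}"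
  unfolding faces_def face_def using con_sym con_trans by blast

lemma faces_nonempty: "f \<in> faces \<gamma> E \<Longrightarrow> f \<noteq> {}"
  unfolding faces_def face_def using con_refl by blast

lemma faces_subset: "f \<in> faces \<gamma> E \<Longrightarrow> f \<subseteq> - draw \<gamma> E"
  unfolding faces_def face_def using con_in(2) by blast

context drawing
begin

text \<open>The two faces together have empty boundary and hence fill the complement of the drawing.
  A drawing of a single cycle shows that this happens.\<close>

lemma same_bd_imp_two_faces:
  assumes "f \<in> faces \<gamma> E" "g \<in> faces \<gamma> E" "f \<noteq> g" "bd \<gamma> E f = bd \<gamma> E g"
  shows "faces \<gamma> E = {f, g}"
proof -
  note fg = face_union_faces[OF assms(1)] face_union_faces[OF assms(2)]
  have "bd \<gamma> E (sym_diff f g) = {}" using bd_sym_diff[OF fg] assms(4) by simp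
  moreover have "sym_diff f g = f \<union> g" using faces_disjoint[OF assms(1-3)] by blast
  ultimately have "f \<union> g = {} \<or> f \<union> g = - draw \<gamma> E"
    using bd_empty_imp_trivial[OF drawing_axioms face_union_sym_diff[OF fg]] by simp
  then have "f \<union> g = - draw \<gamma> E" using faces_nonempty[OF assms(1)] by blast
  then have "h = f \<or> h = g" if "h \<in> faces \<gamma> E" for h
    using that faces_nonempty[OF that] faces_subset[OF that] faces_disjoint[OF that] assms(1,2) by blast
  then show ?thesis using assms(1,2) by blast
qed

lemma finite_faces: "finite (faces \<gamma> E)"
proof (cases "inj_on (bd \<gamma> E) (faces \<gamma> E)")
  case True
  moreover have "bd \<gamma> E ` faces \<gamma> E \<subseteq> Pow E" using bd_subset by blast
  ultimately show ?thesis using fin_edges by (meson finite_Pow_iff finite_imageD finite_subset)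
next
  case False
  then obtain f g where "f \<in> faces \<gamma> E" "g \<in> faces \<gamma> E" "f \<noteq> g" "bd \<gamma> E f = bd \<gamma> E g"
    unfolding inj_on_def by blast
  then show ?thesis using same_bd_imp_two_faces by (metis finite.emptyI finite.insertI)
qed

lemma merged_face:
  assumes "x \<notin> draw \<gamma> E"
  shows "merged e (face \<gamma> E x) = face \<gamma> (E - {e}) x"
proof -
  have "con \<gamma> (E - {e}) x a" if "con \<gamma> E x a" for a using that by (rule con_mono) blast
  then show ?thesis unfolding merged_def face_def using con_refl[OF assms] con_trans by blast
qed

lemma faces_delete:
  assumes "e \<in> E"
  shows "merged e ` faces \<gamma> E = faces \<gamma> (E - {e})"
proof -
  have sub: "- draw \<gamma> E \<subseteq> - draw \<gamma> (E - {e})" using draw_mono[of "E - {e}" E \<gamma>] by blast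
  have "face \<gamma> (E - {e}) x \<in> merged e ` faces \<gamma> E" if x: "x \<notin> draw \<gamma> (E - {e})" for x
  proof -
    obtain \<delta> where \<delta>: "\<delta> > 0" "\<forall>y\<in>ball x \<delta>. con \<gamma> (E - {e}) x y"
      using near_con[of "E - {e}" x] x by blast
    obtain y where y: "y \<in> ball x \<delta>" "y \<notin> path_image (\<gamma> e)"
      using dense_compl_edge[OF assms open_ball, of x x \<delta>] \<delta>(1) by auto
    then have c: "con \<gamma> (E - {e}) x y" using \<delta>(2) by blast
    then have yE: "y \<notin> draw \<gamma> E" using y(2) con_in(2)[OF c] draw_remove[OF assms] by blast
    have "face \<gamma> (E - {e}) x = face \<gamma> (E - {e}) y" using c con_in(2)[OF c] face_eq_iff by metis
    also have "\<dots> = merged e (face \<gamma> E y)" using merged_face[OF yE] by simp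
    finally show ?thesis using yE unfolding faces_def by blast
  qed
  then have "faces \<gamma> (E - {e}) \<subseteq> merged e ` faces \<gamma> E" unfolding faces_def by blast
  moreover have "merged e ` faces \<gamma> E \<subseteq> faces \<gamma> (E - {e})"
    unfolding faces_def using merged_face sub by force
  ultimately show ?thesis by blast
qed

lemma card_faces_delete_le: "e \<in> E \<Longrightarrow> card (faces \<gamma> (E - {e})) \<le> card (faces \<gamma> E)"
  using faces_delete card_image_le[OF finite_faces] by metis

text \<open>Points close to the edge on either side of the cycle lie in different faces, and
  deleting the edge joins them.\<close>

lemma card_faces_delete_less:
  assumes e: "{u, v} \<in> E" and P: "upath (E - {{u, v}}) u v P"
  shows "card (faces \<gamma> (E - {{u, v}})) < card (faces \<gamma> E)"
proof -
  let ?C = "draw \<gamma> (insert {u, v} P)"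
  have sub: "insert {u, v} P \<subseteq> E" using e upath_props(1)[OF P] by blast
  obtain l r where lr: "l \<notin> draw \<gamma> E" "r \<notin> draw \<gamma> E" "con \<gamma> (E - {{u, v}}) l r" "l \<in> inside ?C" "r \<notin> inside ?C"
    using near_edge_sides[OF e P, of "{u, v}"] by blast
  have "\<not> con \<gamma> E l r" using inside_same_component[OF con_mono[OF _ sub] lr(4)] lr(5) by blast
  then have ne: "face \<gamma> E l \<noteq> face \<gamma> E r" using face_eq_iff lr(2) by metis
  have "merged {u, v} (face \<gamma> E l) = merged {u, v} (face \<gamma> E r)"
    unfolding merged_face[OF lr(1)] merged_face[OF lr(2)] using face_eq_iff con_in(2)[OF lr(3)] lr(3) by metis
  then have "\<not> inj_on (merged {u, v}) (faces \<gamma> E)"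
    using ne lr(1,2) unfolding inj_on_def faces_def by blast
  then have "card (merged {u, v} ` faces \<gamma> E) \<noteq> card (faces \<gamma> E)"
    using eq_card_imp_inj_on[OF finite_faces] by blast
  then show ?thesis using faces_delete[OF e] card_image_le[OF finite_faces, of "merged {u, v}"] by simp
qed

end

text \<open>The map \<open>\<kappa>\<close> labels the vertices by components, so the bound is one half of Euler's formula.\<close>

lemma euler_ge:
  assumes "drawing E p \<gamma>" "\<Union>E \<subseteq> V" "finite V"
  shows "\<exists>\<kappa> :: 'a \<Rightarrow> 'a. (\<forall>x y. \<kappa> x = \<kappa> y \<longrightarrow> (x, y) \<in> (adj E)\<^sup>*) \<and>
    card E + 1 + card (\<kappa> ` V) \<le> card (faces \<gamma> E) + card V"
  using assms(1,2)
proof (induction "card E" arbitrary: E)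
  case 0
  interpret drawing E p \<gamma> by (rule 0)
  have E: "E = {}" using 0 fin_edges by simp
  have "faces \<gamma> E \<noteq> {}" using compl_draw_nonempty unfolding faces_def by blast
  then have "card (faces \<gamma> E) > 0" using finite_faces by (simp add: card_gt_0_iff)
  then show ?case using E by (intro exI[of _ id]) simp
next
  case (Suc n)
  interpret drawing E p \<gamma> by (rule Suc.prems(1))
  obtain e where e: "e \<in> E" using Suc.hyps(2) by (metis card.empty ex_in_conv nat.distinct(1))
  then obtain u v where uv: "e = {u, v}" "u \<noteq> v" using edge_doubleton by blast
  have e': "{u, v} \<in> E" using e uv by simp
  define E' where "E' = E - {{u, v}}"
  have c: "card E = Suc (card E')" unfolding E'_def using e' fin_edges by (metis card_Suc_Diff1)
  have "drawing E' p \<gamma>" using drawing_axioms by (rule drawing_subset) (auto simp: E'_def)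
  moreover have "\<Union>E' \<subseteq> V" using Suc.prems(2) E'_def by blast
  moreover have "n = card E'" using Suc.hyps(2) c by simp
  ultimately obtain \<kappa> :: "'a \<Rightarrow> 'a" where \<kappa>: "\<And>x y. \<kappa> x = \<kappa> y \<Longrightarrow> (x, y) \<in> (adj E')\<^sup>*"
    "card E' + 1 + card (\<kappa> ` V) \<le> card (faces \<gamma> E') + card V"
    using Suc.hyps(1) by blast
  have mono: "(adj E')\<^sup>* \<subseteq> (adj E)\<^sup>*" by (rule rtrancl_mono) (auto simp: E'_def)
  show ?case
  \<comment> \<open>An edge within a class of \<open>\<kappa>\<close> closes a cycle and adds a
    face. An edge between two classes merges their labels, and it is enough that no face is
    lost.\<close>
  proof (cases "\<kappa> u = \<kappa> v")
    case True
    then obtain P where "upath E' u v P" using reachable_imp_upath[OF \<kappa>(1) uv(2)] by blast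
    then have "card (faces \<gamma> E') < card (faces \<gamma> E)" using card_faces_delete_less[OF e'] E'_def by blast
    then show ?thesis using \<kappa> mono c by (intro exI[of _ \<kappa>]) (auto dest: \<kappa>(1))
  next
    case False
    define \<kappa>' where "\<kappa>' x = (if \<kappa> x = \<kappa> v then \<kappa> u else \<kappa> x)" for x
    have "u \<in> V" "v \<in> V" using e' Suc.prems(2) by blast+
    then have "\<kappa>' ` V \<subseteq> \<kappa> ` V" "\<kappa> v \<in> \<kappa> ` V" by (auto simp: \<kappa>'_def)
    moreover have "\<kappa> v \<notin> \<kappa>' ` V" using False by (auto simp: \<kappa>'_def)
    ultimately have "\<kappa>' ` V \<subset> \<kappa> ` V" by blast
    then have le: "card (\<kappa>' ` V) < card (\<kappa> ` V)" using assms(3) by (intro psubset_card_mono) auto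
    have uvr: "(u, v) \<in> (adj E)\<^sup>*" "(v, u) \<in> (adj E)\<^sup>*" using e' by (auto simp: insert_commute)
    have r: "\<kappa> x = \<kappa> y \<Longrightarrow> (x, y) \<in> (adj E)\<^sup>*" for x y using \<kappa>(1) mono by blast
    have "(x, y) \<in> (adj E)\<^sup>*" if eq: "\<kappa>' x = \<kappa>' y" for x y
    proof -
      consider "\<kappa> x = \<kappa> y" | "\<kappa> x = \<kappa> v" "\<kappa> u = \<kappa> y" | "\<kappa> y = \<kappa> v" "\<kappa> x = \<kappa> u"
        using eq unfolding \<kappa>'_def by (cases "\<kappa> x = \<kappa> v"; cases "\<kappa> y = \<kappa> v") auto
      then show ?thesis
      proof cases
        case 1
        then show ?thesis by (rule r)
      next
        case 2
        from rtrancl_trans[OF rtrancl_trans[OF r[OF 2(1)] uvr(2)] r[OF 2(2)]] show ?thesis .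
      next
        case 3
        from rtrancl_trans[OF rtrancl_trans[OF r[OF 3(2)] uvr(1)] r[OF 3(1)[symmetric]]] show ?thesis .
      qed
    qed
    moreover have "card (faces \<gamma> E') \<le> card (faces \<gamma> E)" using card_faces_delete_le[OF e'] E'_def by blast
    ultimately show ?thesis using \<kappa>(2) le c by (intro exI[of _ \<kappa>']) auto
  qed
qed

text \<open>By Euler's inequality, more edges than vertices force three faces. Then no boundary is
  empty and different faces have different boundaries, so that faces may be counted by their
  boundaries.\<close>

lemma planar_faces:
  fixes G :: "'a sgraph"
  assumes G: "simple_graph G" "planar G" and E: "E \<subseteq> edges G" "card (verts G) < card E"
  obtains F where "F \<subseteq> Pow E" "card E + 2 \<le> card F + card (verts G)"
    "\<And>B. B \<in> F \<Longrightarrow> B \<noteq> {}" "\<And>B. B \<in> F \<Longrightarrow> even_degrees B"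
    "\<And>e. e \<in> E \<Longrightarrow> card {B \<in> F. e \<in> B} \<le> 2"
proof -
  let ?V = "verts G"
  obtain p \<gamma> where "plane_drawing G p \<gamma>" using G(2) planar_def by blast
  then have d: "drawing E p \<gamma>"
    using plane_drawing_imp_drawing G(1) drawing_subset E(1) by metis
  interpret drawing E p \<gamma> by (rule d)
  have fV: "finite ?V" using G(1) by (simp add: simple_graph_def)
  have EV: "\<Union>E \<subseteq> ?V" using G(1) E(1) unfolding simple_graph_def by blast
  obtain e where e: "e \<in> E" using E(2) by (metis card.empty ex_in_conv not_less_zero)
  then have "e \<subseteq> ?V" using G(1) E(1) unfolding simple_graph_def by blast
  then have "?V \<noteq> {}" using card_edge[OF e] by auto
  obtain \<kappa> :: "'a \<Rightarrow> 'a" where "card E + 1 + card (\<kappa> ` ?V) \<le> card (faces \<gamma> E) + card ?V"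
    using euler_ge[OF d EV fV] by blast
  moreover have "card (\<kappa> ` ?V) \<ge> 1" using \<open>?V \<noteq> {}\<close> fV by (simp add: Suc_leI card_gt_0_iff)
  ultimately have eu: "card E + 2 \<le> card (faces \<gamma> E) + card ?V" by linarith
  then have 3: "card (faces \<gamma> E) \<ge> 3" using E(2) by linarith
  have inj: "inj_on (bd \<gamma> E) (faces \<gamma> E)"
  proof (rule inj_onI, rule ccontr)
    fix f g assume "f \<in> faces \<gamma> E" "g \<in> faces \<gamma> E" "bd \<gamma> E f = bd \<gamma> E g" "f \<noteq> g"
    then have "faces \<gamma> E = {f, g}" using same_bd_imp_two_faces by blast
    then have "card (faces \<gamma> E) \<le> 2" by (metis card_2_iff card.insert_remove \<open>f \<noteq> g\<close> order_refl)
    then show False using 3 by simp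
  qed
  show thesis
  proof
    let ?F = "bd \<gamma> E ` faces \<gamma> E"
    show "?F \<subseteq> Pow E" using bd_subset by blast
    show "card E + 2 \<le> card ?F + card ?V" using eu card_image[OF inj] by simp
    show "even_degrees B" if "B \<in> ?F" for B
      using that even_degrees_bd[OF d] face_union_faces by blast
    show "B \<noteq> {}" if B: "B \<in> ?F" for B
    proof
      assume "B = {}"
      then obtain f where f: "f \<in> faces \<gamma> E" "bd \<gamma> E f = {}" using B by blast
      then have "f = - draw \<gamma> E"
        using bd_empty_imp_trivial[OF d face_union_faces[OF f(1)]] faces_nonempty by blast
      then have "g = f" if "g \<in> faces \<gamma> E" for g
        using that faces_subset[OF that] faces_nonempty[OF that] faces_disjoint[OF that f(1)] by blast
      then have "faces \<gamma> E = {f}" using f(1) by blast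
      then show False using 3 by simp
    qed
    show "card {B \<in> ?F. e \<in> B} \<le> 2" if e: "e \<in> E" for e
    proof -
      obtain l r where lr: "\<And>A. face_union \<gamma> E A \<Longrightarrow> e \<in> bd \<gamma> E A \<longleftrightarrow> (l \<in> A) \<noteq> (r \<in> A)"
        using edge_sides[OF e] by blast
      have "f = face \<gamma> E l \<or> f = face \<gamma> E r" if f: "f \<in> faces \<gamma> E" "e \<in> bd \<gamma> E f" for f
      proof -
        obtain x where x: "f = face \<gamma> E x" using f(1) by (auto simp: faces_def)
        have "l \<in> f \<or> r \<in> f" using lr[OF face_union_faces[OF f(1)]] f(2) by blast
        then show ?thesis using x con_in(2) face_eq_iff unfolding face_def by (metis mem_Collect_eq)
      qed
      then have "{B \<in> ?F. e \<in> B} \<subseteq> {bd \<gamma> E (face \<gamma> E l), bd \<gamma> E (face \<gamma> E r)}" by blast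
      then have "card {B \<in> ?F. e \<in> B} \<le> card {bd \<gamma> E (face \<gamma> E l), bd \<gamma> E (face \<gamma> E r)}"
        by (rule card_mono[rotated]) simp
      also have "\<dots> \<le> 2" by (simp add: card_insert_if)
      finally show ?thesis .
    qed
  qed
qed

section \<open>Counting faces\<close>

definition c4 :: "'a set set \<Rightarrow> 'a \<Rightarrow> 'a \<Rightarrow> 'a \<Rightarrow> 'a \<Rightarrow> bool" where
  "c4 E a b c d \<longleftrightarrow> distinct [a, b, c, d] \<and> {a, b} \<in> E \<and> {b, c} \<in> E \<and> {c, d} \<in> E \<and> {d, a} \<in> E"

lemma c4_rotate: "c4 E a b c d \<Longrightarrow> c4 E b c d a"
  by (auto simp: c4_def)

lemma c4_mono: "c4 B a b c d \<Longrightarrow> B \<subseteq> E \<Longrightarrow> c4 E a b c d"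
  unfolding c4_def by (meson subsetD)

lemma even_degrees_other_edge:
  assumes "finite B" "even_degrees B" "e \<in> B" "x \<in> e"
  shows "\<exists>f\<in>B. f \<noteq> e \<and> x \<in> f"
proof (rule ccontr)
  assume "\<not> ?thesis"
  then have "{f \<in> B. x \<in> f} = {e}" using assms(3,4) by blast
  then have "card {f \<in> B. x \<in> f} = 1" by simp
  then show False using assms(2) unfolding even_degrees_def by (metis odd_one)
qed

lemma even_degrees_neighbour:
  assumes B: "finite B" "even_degrees B" "\<And>e. e \<in> B \<Longrightarrow> card e = 2" and e: "{y, x} \<in> B"
  obtains z where "{x, z} \<in> B" "z \<noteq> y" "z \<noteq> x"
proof -
  obtain f where f: "f \<in> B" "f \<noteq> {y, x}" "x \<in> f"
    using even_degrees_other_edge[OF B(1,2) e, of x] by blast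
  obtain z where z: "f = {x, z}" "x \<noteq> z"
    using B(3)[OF f(1)] f(3) by (metis card_2_iff insert_commute insertE singletonD)
  show thesis using that[of z] f z by (auto simp: insert_commute)
qed

text \<open>By evenness a path can be continued at both ends. If three edges close up, the remaining
  edges again have even degrees and so cannot be a single edge. Otherwise the path of three edges
  has a further edge at either end: either one edge closes a 4-cycle, or these are two edges, five
  in all.\<close>

lemma even_degrees_cases:
  assumes B: "finite B" "even_degrees B" "\<And>e. e \<in> B \<Longrightarrow> card e = 2" and ne: "B \<noteq> {}"
  obtains (tri) a b c where "distinct [a, b, c]" "B = {{a, b}, {b, c}, {c, a}}" "card B = 3"
    | (quad) a b c d where "c4 B a b c d" "B = {{a, b}, {b, c}, {c, d}, {d, a}}" "card B = 4"
    | (large) "card B \<ge> 5"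
proof -
  obtain e where e: "e \<in> B" using ne by blast
  obtain a b where ab: "{a, b} \<in> B" "a \<noteq> b" using B(3)[OF e] e by (metis card_2_iff)
  obtain c where c: "{b, c} \<in> B" "c \<noteq> a" "c \<noteq> b" using even_degrees_neighbour[OF B ab(1)] .
  obtain d where d: "{c, d} \<in> B" "d \<noteq> b" "d \<noteq> c" using even_degrees_neighbour[OF B c(1)] .
  show thesis
  proof (cases "d = a")
    case True
    let ?T = "{{a, b}, {b, c}, {c, a}}"
    have T: "?T \<subseteq> B" using ab c d True by simp
    have dist: "{a, b} \<noteq> {b, c}" "{a, b} \<noteq> {c, a}" "{b, c} \<noteq> {c, a}" using ab c by (auto simp: doubleton_eq_iff)
    then have cT: "card ?T = 3" by simp
    have evT: "even_degrees ?T"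
      unfolding even_degrees_def
    proof
      fix x
      consider "x = a" | "x = b" | "x = c" | "x \<notin> {a, b, c}" by blast
      then show "even (card {e \<in> ?T. x \<in> e})"
      proof cases
        case 1
        then have "{e \<in> ?T. x \<in> e} = {{a, b}, {c, a}}" using ab c by auto
        then show ?thesis using dist by simp
      next
        case 2
        then have "{e \<in> ?T. x \<in> e} = {{a, b}, {b, c}}" using ab c by auto
        then show ?thesis using dist by simp
      next
        case 3
        then have "{e \<in> ?T. x \<in> e} = {{b, c}, {c, a}}" using ab c by auto
        then show ?thesis using dist by simp
      next
        case 4
        then have "{e \<in> ?T. x \<in> e} = {}" by auto
        then show ?thesis by (metis card.empty even_zero)
      qed
    qed
    have "even_degrees (sym_diff B ?T)"
      using even_degrees_sym_diff[OF B(1) _ B(2) evT] by simp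
    moreover have "sym_diff B ?T = B - ?T" using T by blast
    ultimately have ev: "even_degrees (B - ?T)" by simp
    have cB: "card B = 3 + card (B - ?T)" using card_Diff_subset[OF _ T] cT card_mono[OF B(1) T] by simp
    have "card (B - ?T) \<noteq> 1"
    proof
      assume "card (B - ?T) = 1"
      then obtain f where f: "B - ?T = {f}" by (meson card_1_singletonE)
      then obtain x where "x \<in> f" using B(3)[of f] by (metis Diff_iff all_not_in_conv card.empty insertI1 zero_neq_numeral)
      then show False using even_degrees_other_edge[OF _ ev, of f x] f by simp
    qed
    moreover have "card (B - ?T) = 0 \<Longrightarrow> B = ?T" using B(1) T by auto
    moreover have "distinct [a, b, c]" using ab c by auto
    ultimately show thesis using tri[of a b c] large cB by linarith
  next
    case False
    let ?P = "{{a, b}, {b, c}, {c, d}}"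
    have P: "?P \<subseteq> B" using ab c d by simp
    have dist: "distinct [a, b, c, d]" using ab c d False by auto
    have cP: "card ?P = 3" using dist by (auto simp: doubleton_eq_iff)
    obtain f where f: "{d, f} \<in> B" "f \<noteq> c" "f \<noteq> d" using even_degrees_neighbour[OF B d(1)] .
    have "{b, a} \<in> B" using ab(1) by (simp add: insert_commute)
    then obtain g where g: "{a, g} \<in> B" "g \<noteq> b" "g \<noteq> a" using even_degrees_neighbour[OF B] by metis
    have fP: "{d, f} \<notin> ?P" using f dist by (auto simp: doubleton_eq_iff)
    have gP: "{a, g} \<notin> ?P" using g dist by (auto simp: doubleton_eq_iff)
    have P4: "card (insert {d, f} ?P) = 4" using fP cP by simp
    have sub4: "insert {d, f} ?P \<subseteq> B" using P f by blast
    show thesis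
    proof (cases "{a, g} = {d, f}")
      case True
      then have fa: "f = a" using False by (auto simp: doubleton_eq_iff)
      show thesis
      proof (cases "card B = 4")
        case True
        then have "insert {d, a} ?P = B" using card_subset_eq[OF B(1) sub4] P4 fa by simp
        then have "B = {{a, b}, {b, c}, {c, d}, {d, a}}" by blast
        moreover have "c4 B a b c d" using dist P f fa by (auto simp: c4_def)
        ultimately show thesis using quad True by blast
      next
        case False
        then show thesis using large card_mono[OF B(1) sub4] P4 by linarith
      qed
    next
      case ne: False
      then have "card (insert {a, g} (insert {d, f} ?P)) = 5" using gP P4 by simp
      moreover have "insert {a, g} (insert {d, f} ?P) \<subseteq> B" using sub4 g by blast
      ultimately show thesis using large card_mono[OF B(1)] by metis
    qed
  qed
qed

text \<open>What the counting needs of a plane drawing: \<open>F\<close> is the set of face boundaries. Bridges lie in no boundary.\<close>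

locale face_family =
  fixes V :: "'a set" and E :: "'a set set" and F :: "'a set set set"
  assumes finite_V: "finite V"
    and edge: "\<And>e. e \<in> E \<Longrightarrow> e \<subseteq> V" "\<And>e. e \<in> E \<Longrightarrow> card e = 2"
    and F_sub: "F \<subseteq> Pow E"
    and euler: "card E + 2 \<le> card F + card V"
    and F_ne: "\<And>B. B \<in> F \<Longrightarrow> B \<noteq> {}"
    and F_even: "\<And>B. B \<in> F \<Longrightarrow> even_degrees B"
    and F_two: "\<And>e. e \<in> E \<Longrightarrow> card {B \<in> F. e \<in> B} \<le> 2"
begin

lemma finite_E: "finite E"
proof (rule finite_subset)
  show "E \<subseteq> Pow V" using edge(1) by blast
qed (simp add: finite_V)

lemma finite_F: "finite F"
  using finite_subset[OF F_sub] finite_E by simp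

lemma finite_face: "B \<in> F \<Longrightarrow> finite B"
  using F_sub finite_E finite_subset by blast

lemma face_cases:
  assumes "B \<in> F"
  obtains (tri) a b c where "distinct [a, b, c]" "B = {{a, b}, {b, c}, {c, a}}" "card B = 3"
    | (quad) a b c d where "c4 E a b c d" "B = {{a, b}, {b, c}, {c, d}, {d, a}}" "card B = 4"
    | (large) "card B \<ge> 5"
proof (rule even_degrees_cases[OF finite_face[OF assms] F_even[OF assms] _ F_ne[OF assms]])
  have BE: "B \<subseteq> E" using assms F_sub by blast
  show "card e = 2" if "e \<in> B" for e using that BE edge(2) by blast
  show thesis if "c4 B a b c d" "B = {{a, b}, {b, c}, {c, d}, {d, a}}" "card B = 4" for a b c d
    using quad[OF c4_mono[OF that(1) BE] that(2,3)] .
qed (use tri large in blast)+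

lemma double_count:
  assumes "H \<subseteq> F" "D \<subseteq> E" "\<And>e. e \<in> D \<Longrightarrow> card {B \<in> H. e \<in> B} \<le> m"
  shows "(\<Sum>B\<in>H. card (B \<inter> D)) \<le> m * card D"
proof -
  have fH: "finite H" and fD: "finite D" using assms finite_F finite_E finite_subset by blast+
  have "(\<Sum>B\<in>H. card (B \<inter> D)) = (\<Sum>B\<in>H. \<Sum>e\<in>D. of_bool (e \<in> B))"
    by (rule sum.cong) (simp_all add: fD Int_commute Int_def)
  also have "\<dots> = (\<Sum>e\<in>D. \<Sum>B\<in>H. of_bool (e \<in> B))" by (rule sum.swap)
  also have "\<dots> = (\<Sum>e\<in>D. card {B \<in> H. e \<in> B})"
    by (rule sum.cong) (simp_all add: fH Int_def)
  also have "\<dots> \<le> (\<Sum>e\<in>D. m)" using assms(3) by (rule sum_mono)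
  finally show ?thesis by (simp add: mult.commute)
qed

lemma two_subfamily:
  assumes "H \<subseteq> F" "e \<in> E"
  shows "card {B \<in> H. e \<in> B} \<le> 2"
proof -
  have "card {B \<in> H. e \<in> B} \<le> card {B \<in> F. e \<in> B}"
    using assms finite_F by (intro card_mono) auto
  then show ?thesis using F_two[OF assms(2)] by linarith
qed

lemma double_count2:
  assumes "H \<subseteq> F" "D \<subseteq> E"
  shows "(\<Sum>B\<in>H. card (B \<inter> D)) \<le> 2 * card D"
  using assms two_subfamily[OF assms(1)] by (intro double_count) auto

lemma card_hitting:
  assumes "X \<subseteq> E"
  shows "card {B \<in> F. B \<inter> X \<noteq> {}} \<le> 2 * card X"
proof -
  let ?H = "{B \<in> F. B \<inter> X \<noteq> {}}"
  have "card ?H = (\<Sum>B\<in>?H. 1)" by simp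
  also have "\<dots> \<le> (\<Sum>B\<in>?H. card (B \<inter> X))"
  proof (rule sum_mono)
    fix B assume "B \<in> ?H"
    then show "1 \<le> card (B \<inter> X)" using finite_face by (simp add: Suc_leI card_gt_0_iff)
  qed
  also have "\<dots> \<le> 2 * card X" using assms by (intro double_count2) auto
  finally show ?thesis .
qed

text \<open>Two triangles on a common edge \<open>{x, y}\<close> have different apices
  \<open>z\<close> and \<open>w\<close>, and \<open>x, z, y, w\<close> runs around the edge.\<close>

lemma two_triangles_c4:
  assumes "distinct [a, b, c]" "{{a, b}, {b, c}, {c, a}} \<subseteq> E"
    and "distinct [a', b', c']" "{{a', b'}, {b', c'}, {c', a'}} \<subseteq> E"
    and "{{a, b}, {b, c}, {c, a}} \<noteq> {{a', b'}, {b', c'}, {c', a'}}"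
    and "e \<in> {{a, b}, {b, c}, {c, a}}" "e \<in> {{a', b'}, {b', c'}, {c', a'}}"
  shows "\<exists>x y z w. c4 E x y z w \<and> {x, y, z, w} \<subseteq> {a, b, c} \<union> {a', b', c'}"
proof -
  have norm: "\<exists>x y z. e = {x, y} \<and> distinct [x, y, z] \<and> {x, y, z} = {a, b, c} \<and>
      {{a, b}, {b, c}, {c, a}} = {{x, y}, {y, z}, {z, x}}"
    if "distinct [a, b, c]" "e \<in> {{a, b}, {b, c}, {c, a}}" for a b c :: 'a
  proof -
    have "e = {a, b} \<or> e = {b, c} \<or> e = {c, a}" using that(2) by blast
    then show ?thesis
    proof (elim disjE)
      assume "e = {a, b}"
      then show ?thesis using that(1) by (intro exI[of _ a] exI[of _ b] exI[of _ c] conjI) (blast | simp)+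
    next
      assume "e = {b, c}"
      then show ?thesis using that(1) by (intro exI[of _ b] exI[of _ c] exI[of _ a] conjI) (blast | simp)+
    next
      assume "e = {c, a}"
      then show ?thesis using that(1) by (intro exI[of _ c] exI[of _ a] exI[of _ b] conjI) (blast | simp)+
    qed
  qed
  obtain x y z where 1: "e = {x, y}" "distinct [x, y, z]" "{x, y, z} = {a, b, c}"
    "{{a, b}, {b, c}, {c, a}} = {{x, y}, {y, z}, {z, x}}" using norm[OF assms(1,6)] by blast
  obtain x' y' w where 2: "e = {x', y'}" "distinct [x', y', w]" "{x', y', w} = {a', b', c'}"
    "{{a', b'}, {b', c'}, {c', a'}} = {{x', y'}, {y', w}, {w, x'}}" using norm[OF assms(3,7)] by blast
  have xy: "x' = x \<and> y' = y \<or> x' = y \<and> y' = x" using 1(1) 2(1) by (auto simp: doubleton_eq_iff)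
  then have 3: "distinct [x, y, w]" "{x, y, w} = {a', b', c'}"
    "{{a', b'}, {b', c'}, {c', a'}} = {{x, y}, {y, w}, {w, x}}"
    using 2(2-4) by auto
  have "z \<noteq> w" using assms(5) 1(4) 3(3) by metis
  then have "c4 E x z y w"
    using 1(2) 3(1) assms(2,4) unfolding 1(4) 3(3) c4_def by (auto simp: insert_commute)
  moreover have "{x, z, y, w} \<subseteq> {a, b, c} \<union> {a', b', c'}" using 1(3) 3(2) by blast
  ultimately show ?thesis by blast
qed

lemma two_triangle_faces_c4:
  assumes B: "B \<in> F" "card B = 3" and B': "B' \<in> F" "card B' = 3"
    and ne: "B \<noteq> B'" and e: "e \<in> B" "e \<in> B'"
  obtains x y z w where "c4 E x y z w" "{x, y, z, w} \<subseteq> \<Union>B \<union> \<Union>B'"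
proof -
  obtain a b c where 1: "distinct [a, b, c]" "B = {{a, b}, {b, c}, {c, a}}"
    using B by (cases B rule: face_cases) auto
  obtain a' b' c' where 2: "distinct [a', b', c']" "B' = {{a', b'}, {b', c'}, {c', a'}}"
    using B' by (cases B' rule: face_cases) auto
  have BE: "B \<subseteq> E" "B' \<subseteq> E" using B(1) B'(1) F_sub by blast+
  obtain x y z w where xyzw: "c4 E x y z w" "{x, y, z, w} \<subseteq> {a, b, c} \<union> {a', b', c'}"
    using two_triangles_c4[OF 1(1) BE(1)[unfolded 1(2)] 2(1) BE(2)[unfolded 2(2)]
      ne[unfolded 1(2) 2(2)] e(1)[unfolded 1(2)] e(2)[unfolded 2(2)]] by metis
  have "{a, b, c} \<union> {a', b', c'} \<subseteq> \<Union>B \<union> \<Union>B'" unfolding 1(2) 2(2) by blast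
  then show thesis using that[OF xyzw(1) subset_trans[OF xyzw(2)]] by metis
qed

lemma triangle_face_adjacent:
  assumes B: "B \<in> F" "card B = 3" and xy: "x \<in> \<Union>B" "y \<in> \<Union>B" "x \<noteq> y"
  shows "{x, y} \<in> B"
proof -
  obtain a b c where "B = {{a, b}, {b, c}, {c, a}}"
    using B by (cases B rule: face_cases) auto
  then show ?thesis using xy by (auto simp: insert_commute)
qed

text \<open>In case of equality, all faces at \<open>v\<close> are triangles, \<open>v\<close> is
  adjacent to all other vertices, every edge off \<open>v\<close> is on exactly one triangular face
  off \<open>v\<close>, and the faces in \<open>P\<close> are pentagons.\<close>

lemma hitting_vertex_bound:
  assumes v: "v \<in> V" and hit: "\<And>a b c d. c4 E a b c d \<Longrightarrow> v \<in> {a, b, c, d}"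
  shows "7 * card E + 34 \<le> 19 * card V \<and> 7 * card E + 35 \<noteq> 19 * card V"
proof -
  define Ev where "Ev = {e \<in> E. v \<in> e}"
  define Ea where "Ea = {e \<in> E. v \<notin> e}"
  define Fv where "Fv = {B \<in> F. B \<inter> Ev \<noteq> {}}"
  define T where "T = {B \<in> F. B \<inter> Ev = {} \<and> card B = 3}"
  define P where "P = {B \<in> F. B \<inter> Ev = {} \<and> card B \<noteq> 3}"
  have sub: "Ev \<subseteq> E" "Ea \<subseteq> E" "Fv \<subseteq> F" "T \<subseteq> F" "P \<subseteq> F" by (auto simp: Ev_def Ea_def Fv_def T_def P_def)
  have fin: "finite Fv" "finite T" "finite P" "finite Ev" "finite Ea"
    using sub finite_F finite_E finite_subset by blast+
  have F: "F = T \<union> P \<union> Fv" "T \<inter> P = {}" "(T \<union> P) \<inter> Fv = {}" by (auto simp: Fv_def T_def P_def)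
  have cF: "card F = card T + card P + card Fv"
    using F fin by (metis card_Un_disjoint finite_UnI)
  have cE: "card E = card Ea + card Ev"
  proof -
    have "E = Ea \<union> Ev" "Ea \<inter> Ev = {}" by (auto simp: Ea_def Ev_def)
    then show ?thesis using fin by (metis card_Un_disjoint)
  qed
  have off: "B \<subseteq> Ea" if "B \<in> F" "B \<inter> Ev = {}" for B
    using that F_sub by (auto simp: Ea_def Ev_def)
  have dn: "card Ev + 1 \<le> card V"
  proof -
    have "Ev \<subseteq> (\<lambda>x. {v, x}) ` (V - {v})"
    proof
      fix e assume "e \<in> Ev"
      then have e: "e \<in> E" "v \<in> e" by (auto simp: Ev_def)
      then obtain x where "e = {v, x}" "x \<noteq> v" using edge(2)[OF e(1)] by (metis card_2_iff insert_commute insertE singletonD)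
      then show "e \<in> (\<lambda>x. {v, x}) ` (V - {v})" using edge(1)[OF e(1)] by blast
    qed
    then have "card Ev \<le> card (V - {v})" using finite_V by (meson finite_Diff surj_card_le)
    then show ?thesis using v finite_V by (metis Suc_eq_plus1 Suc_le_mono card_Suc_Diff1)
  qed
  have fd: "card Fv \<le> card Ev"
  proof -
    have "(\<Sum>B\<in>Fv. 2) \<le> (\<Sum>B\<in>Fv. card (B \<inter> Ev))"
    proof (rule sum_mono)
      fix B assume B: "B \<in> Fv"
      then have BF: "B \<in> F" by (simp add: Fv_def)
      have eq: "B \<inter> Ev = {e \<in> B. v \<in> e}" using BF F_sub by (auto simp: Ev_def)
      have "even (card (B \<inter> Ev))" using F_even[OF BF] unfolding eq even_degrees_def by blast
      moreover have "card (B \<inter> Ev) > 0" using B finite_face[OF BF] by (simp add: Fv_def card_gt_0_iff)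
      ultimately show "2 \<le> card (B \<inter> Ev)" by presburger
    qed
    also have "\<dots> \<le> 2 * card Ev" using sub by (intro double_count2)
    finally show ?thesis by simp
  qed
  define L where "L = (\<Sum>B\<in>Fv. card (B \<inter> Ea))"
  \<comment> \<open>An edge \<open>{v, x}\<close> of the boundary is continued at \<open>x\<close>
    by another edge, which cannot contain \<open>v\<close> as well.\<close>
  have fL: "card Fv \<le> L"
  proof -
    have "(\<Sum>B\<in>Fv. 1) \<le> L" unfolding L_def
    proof (rule sum_mono)
      fix B assume "B \<in> Fv"
      then obtain e where e: "B \<in> F" "e \<in> B" "e \<in> Ev" by (auto simp: Fv_def)
      have BE: "B \<subseteq> E" using e(1) F_sub by blast
      obtain x where x: "e = {v, x}" "x \<noteq> v"
        using e(3) edge(2)[of e] unfolding Ev_def by (metis (lifting) card_2_iff insert_commute insertE mem_Collect_eq singletonD)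
      obtain f where f: "f \<in> B" "f \<noteq> e" "x \<in> f"
        using even_degrees_other_edge[OF finite_face[OF e(1)] F_even[OF e(1)] e(2), of x] x by blast
      have "v \<notin> f"
      proof
        assume "v \<in> f"
        then have "e \<subseteq> f" using x f by blast
        moreover have "card f = 2" "card e = 2" using f(1) e(2) BE edge(2) by blast+
        ultimately show False using f(2) by (metis card.infinite card_subset_eq zero_neq_numeral)
      qed
      then have "f \<in> B \<inter> Ea" using f BE by (auto simp: Ea_def)
      then show "1 \<le> card (B \<inter> Ea)" using finite_face[OF e(1)] by (metis Suc_leI One_nat_def card_gt_0_iff empty_iff finite_Int)
    qed
    then show ?thesis by simp
  qed
  have T3: "3 * card T \<le> card Ea"
  proof -
    have "(\<Sum>B\<in>T. card (B \<inter> Ea)) = (\<Sum>B\<in>T. 3)"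
    proof (rule sum.cong)
      fix B assume "B \<in> T"
      then show "card (B \<inter> Ea) = 3" using off[of B] by (simp add: T_def Int_absorb2)
    qed simp
    moreover have "(\<Sum>B\<in>T. card (B \<inter> Ea)) \<le> 1 * card Ea"
    proof (rule double_count[OF sub(4,2)])
      fix e assume "e \<in> Ea"
      have "B = B'" if B: "B \<in> T" "e \<in> B" and B': "B' \<in> T" "e \<in> B'" for B B'
      proof (rule ccontr)
        assume ne: "B \<noteq> B'"
        have BF: "B \<in> F" "card B = 3" "B \<subseteq> Ea" "B' \<in> F" "card B' = 3" "B' \<subseteq> Ea"
          using B(1) B'(1) off unfolding T_def by blast+
        have v: "v \<notin> \<Union>B \<union> \<Union>B'" using BF(3,6) by (auto simp: Ea_def)
        obtain x y z w where q: "c4 E x y z w" "{x, y, z, w} \<subseteq> \<Union>B \<union> \<Union>B'"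
          by (rule two_triangle_faces_c4[OF BF(1,2,4,5) ne B(2) B'(2)])
        show False using subsetD[OF q(2) hit[OF q(1)]] v by contradiction
      qed
      then have "card {B \<in> T. e \<in> B} \<le> Suc 0" by (simp add: card_le_Suc0_iff_eq fin)
      then show "card {B \<in> T. e \<in> B} \<le> 1" by simp
    qed
    ultimately show ?thesis by simp
  qed
  have sides: "3 * card T + 5 * card P + L \<le> 2 * card Ea"
  proof -
    have "(\<Sum>B\<in>F. card (B \<inter> Ea)) \<le> 2 * card Ea" using sub by (intro double_count2) auto
    moreover have "(\<Sum>B\<in>F. card (B \<inter> Ea)) = (\<Sum>B\<in>T. card (B \<inter> Ea)) + (\<Sum>B\<in>P. card (B \<inter> Ea)) + L"
      unfolding L_def using F fin by (simp add: sum.union_disjoint)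
    moreover have "(\<Sum>B\<in>T. card (B \<inter> Ea)) = (\<Sum>B\<in>T. 3)"
    proof (rule sum.cong)
      fix B assume "B \<in> T"
      then show "card (B \<inter> Ea) = 3" using off[of B] by (simp add: T_def Int_absorb2)
    qed simp
    moreover have "(\<Sum>B\<in>P. 5) \<le> (\<Sum>B\<in>P. card (B \<inter> Ea))"
    proof (rule sum_mono)
      fix B assume "B \<in> P"
      then have B: "B \<in> F" "B \<subseteq> Ea" "card B \<noteq> 3" using off unfolding P_def by blast+
      then have "card B \<ge> 5"
      proof (cases B rule: face_cases)
        case (quad a b c d)
        then have "v \<notin> {a, b, c, d}" using B(2) by (auto simp: Ea_def)
        then show ?thesis using hit[OF quad(1)] by blast
      qed auto
      then show "5 \<le> card (B \<inter> Ea)" using B(2) by (simp add: Int_absorb2)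
    qed
    ultimately show ?thesis by simp
  qed
  \<comment> \<open>Each estimate becomes an equation with a natural number as slack:
    \<open>\<alpha>\<close> counts edges off \<open>v\<close> on no face of \<open>T\<close>,
    \<open>x\<close> spare sides of edges off \<open>v\<close>, \<open>y\<close> surplus sides on
    faces at \<open>v\<close>, \<open>z\<close> faces missing at \<open>v\<close>, \<open>w\<close>
    vertices not adjacent to \<open>v\<close>, and \<open>t\<close> the excess in Euler's
    inequality. This makes the total slack explicit, so that its possible values can be read
    off.\<close>
  obtain \<alpha> where 1: "card Ea = 3 * card T + \<alpha>" using T3 le_Suc_ex by blast
  obtain x where 2: "2 * card Ea = 3 * card T + 5 * card P + L + x" using sides le_Suc_ex by blast
  obtain y where 3: "L = card Fv + y" using fL le_Suc_ex by blast
  obtain z where 4: "card Ev = card Fv + z" using fd le_Suc_ex by blast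
  obtain w where 5: "card V = card Ev + 1 + w" using dn le_Suc_ex by blast
  obtain t where 6: "card F + card V = card E + 2 + t" using euler le_Suc_ex by blast
  have "19 * card V = 7 * card E + 34 + (2 * \<alpha> + 3 * x + 3 * y + 12 * z + 4 * w + 15 * t)"
  proof -
    have "3 * card T + 2 * \<alpha> = 5 * card P + card Fv + y + x" using 1 2 3 by simp
    moreover have E: "card E = 3 * card T + \<alpha> + card Fv + z" using cE 1 4 by simp
    moreover have V: "card V = card Fv + z + 1 + w" using 5 4 by simp
    moreover have "card P + card Fv + w = 2 * card T + \<alpha> + 1 + t" using 6 cF E V by simp
    ultimately show ?thesis by simp
  qed
  \<comment> \<open>That the slack cannot be 1 is what costs one more edge when 7 divides the number of vertices.\<close>
  moreover have "2 * \<alpha> + 3 * x + 3 * y + 12 * z + 4 * w + 15 * t \<noteq> 1"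
  proof
    assume eq: "2 * \<alpha> + 3 * x + 3 * y + 12 * z + 4 * w + 15 * t = 1"
    have "x = 0" "y = 0" "z = 0" "w = 0" "t = 0" using eq by arith+
    then have "even (1 :: nat)" using eq by (metis dvd_triv_left add_0_right mult_0_right)
    then show False by simp
  qed
  ultimately show ?thesis by linarith
qed

text \<open>A triangle cannot have exactly one end of each edge in \<open>S\<close>, so every
  boundary has at least four edges.\<close>

lemma bipartite_bound:
  assumes "\<And>e. e \<in> E \<Longrightarrow> card (e \<inter> S) = 1"
  shows "card E + 4 \<le> 2 * card V"
proof -
  have "(\<Sum>B\<in>F. 4) \<le> (\<Sum>B\<in>F. card (B \<inter> E))"
  proof (rule sum_mono)
    fix B assume B: "B \<in> F"
    then have BE: "B \<subseteq> E" using F_sub by blast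
    have "card B \<ge> 4"
      using B
    proof (cases B rule: face_cases)
      case (tri a b c)
      have x: "x \<in> S \<longleftrightarrow> y \<notin> S" if "{x, y} \<in> B" "x \<noteq> y" for x y
      proof -
        have "card ({x, y} \<inter> S) = 1" using that BE assms by blast
        then show ?thesis using that(2) by (cases "x \<in> S"; cases "y \<in> S") auto
      qed
      show ?thesis using x[of a b] x[of b c] x[of c a] tri by auto
    qed auto
    then show "4 \<le> card (B \<inter> E)" using BE by (simp add: Int_absorb2)
  qed
  also have "\<dots> \<le> 2 * card E" by (intro double_count2) auto
  finally show ?thesis using euler by simp
qed

end

section \<open>Pairwise meeting 4-cycles without a common vertex\<close>

context face_family
begin

definition nbrs :: "'a \<Rightarrow> 'a set" where "nbrs x = {y. {x, y} \<in> E}"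

definition quad :: "'a set \<Rightarrow> bool" where
  "quad Q \<longleftrightarrow> (\<exists>a b c d. Q = {a, b, c, d} \<and> c4 E a b c d)"

text \<open>Of six common neighbours at least two lie outside any given set of four vertices. A
  linked pair that misses a 4-cycle would thus lie on a second 4-cycle disjoint from it.\<close>

definition linked :: "'a \<Rightarrow> 'a \<Rightarrow> bool" where
  "linked x y \<longleftrightarrow> x \<noteq> y \<and> 6 \<le> card (nbrs x \<inter> nbrs y)"

lemma quadI: "c4 E a b c d \<Longrightarrow> quad {a, b, c, d}"
  unfolding quad_def by blast

lemma quad_card: "quad Q \<Longrightarrow> card Q = 4"
  unfolding quad_def c4_def by auto

lemma finite_nbrs: "finite (nbrs x)"
proof (rule finite_subset[OF _ finite_V])
  show "nbrs x \<subseteq> V" using edge(1) unfolding nbrs_def by blast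
qed

lemma edge_ne: "{x, y} \<in> E \<Longrightarrow> x \<noteq> y"
  using edge(2) by fastforce

lemma linked_sym: "linked x y \<Longrightarrow> linked y x"
  unfolding linked_def by (metis Int_commute)

lemma linked_c4:
  assumes "linked x y" "finite R" "card R \<le> 4"
  obtains s t where "c4 E x s y t" "s \<notin> R" "t \<notin> R"
proof -
  let ?C = "nbrs x \<inter> nbrs y - R"
  have "card (nbrs x \<inter> nbrs y) - card R \<le> card ?C" using assms(2) by (rule diff_card_le_card_Diff)
  then have "2 \<le> card ?C" using assms(1,3) unfolding linked_def by linarith
  then obtain T where T: "T \<subseteq> ?C" "card T = 2" by (meson obtain_subset_with_card_n)
  then obtain s t where st: "T = {s, t}" "s \<noteq> t" by (meson card_2_iff)
  then have e: "{x, s} \<in> E" "{y, s} \<in> E" "{x, t} \<in> E" "{y, t} \<in> E" "s \<notin> R" "t \<notin> R"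
    using T(1) by (auto simp: nbrs_def)
  have "c4 E x s y t"
    using e edge_ne[OF e(1)] edge_ne[OF e(2)] edge_ne[OF e(3)] edge_ne[OF e(4)] st(2) assms(1)
    unfolding c4_def linked_def by (auto simp: insert_commute)
  then show thesis using that e by blast
qed

text \<open>The bipartite bound enters as the hypothesis \<open>bip\<close> because it rests on the
  faces of the drawing of \<open>D\<close> alone, not on the family \<open>F\<close>.\<close>

lemma no_hitting_vertex_bound:
  assumes inter: "\<And>Q R. quad Q \<Longrightarrow> quad R \<Longrightarrow> Q \<inter> R \<noteq> {}"
    and avoid: "\<And>v. \<exists>Q. quad Q \<and> v \<notin> Q"
    and bip: "\<And>D S. D \<subseteq> E \<Longrightarrow> (\<And>e. e \<in> D \<Longrightarrow> card (e \<inter> S) = 1) \<Longrightarrow> card D + 4 \<le> 2 * card V"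
    and n: "card V \<ge> 2661"
  shows "7 * card E + 42 \<le> 19 * card V"
proof -
  obtain Q where Q: "\<And>v. quad (Q v)" "\<And>v. v \<notin> Q v" using avoid by metis
  have cQ: "card (Q v) = 4" "finite (Q v)" for v
    using quad_card[OF Q(1)] by (simp, metis card.infinite zero_neq_numeral quad_card[OF Q(1)])
  have hit_linked: "x \<in> R \<or> y \<in> R" if xy: "linked x y" and R: "quad R" for x y R
  proof (rule ccontr)
    assume no: "\<not> ?thesis"
    have "card R = 4" using R by (rule quad_card)
    then have "finite R" "card R \<le> 4" by (metis card.infinite zero_neq_numeral, simp)
    then obtain s t where "c4 E x s y t" "s \<notin> R" "t \<notin> R" using linked_c4[OF xy] by metis
    then show False using inter[OF quadI R] no by blast
  qed
  have meet_linked: "{x, y} \<inter> {z, w} \<noteq> {}" if xy: "linked x y" and zw: "linked z w" for x y z w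
  proof
    assume d: "{x, y} \<inter> {z, w} = {}"
    have "card {z, w} \<le> 4" by (simp add: card_insert_if)
    then obtain s t where "c4 E x s y t" "s \<notin> {z, w}" "t \<notin> {z, w}" using linked_c4[OF xy, of "{z, w}"] by auto
    then show False using hit_linked[OF zw quadI] d by blast
  qed
  \<comment> \<open>A linked pair through \<open>a\<close> has its other vertex in
    \<open>Q a\<close>, which \<open>Q a\<close> must contain because it avoids \<open>a\<close>. If
    some linked pair is not covered by \<open>insert a (Q a)\<close>, it avoids \<open>a\<close> and
    so is \<open>{c, q}\<close> for a given linked pair \<open>{a, c}\<close>. Then \<open>c\<close>
    serves: a linked pair without \<open>c\<close> could only be \<open>{a, q}\<close>, which would
    put both \<open>q\<close> and \<open>c\<close> into \<open>Q a\<close>.\<close>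
  obtain a where a: "\<And>x y. linked x y \<Longrightarrow> {x, y} \<subseteq> insert a (Q a)"
  proof (cases "\<exists>a c. linked a c")
    case False
    then show thesis using that by blast
  next
    case True
    then obtain a c where ac: "linked a c" by blast
    show thesis
    proof (cases "\<forall>x y. linked x y \<longrightarrow> {x, y} \<subseteq> insert a (Q a)")
      case True
      then show thesis using that by blast
    next
      case False
      then obtain p r where pr: "linked p r" "\<not> {p, r} \<subseteq> insert a (Q a)" by blast
      have "a \<notin> {p, r}" using hit_linked[OF pr(1) Q(1)[of a]] Q(2)[of a] pr(2) by blast
      then have "c \<in> {p, r}" using meet_linked[OF ac pr(1)] by blast
      then obtain q where q: "linked c q" "{p, r} = {c, q}" using pr(1) linked_sym by blast
      have "q \<noteq> a" using q(2) \<open>a \<notin> {p, r}\<close> by blast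
      have "{x, y} \<subseteq> insert c (Q c)" if xy: "linked x y" for x y
      proof (cases "c \<in> {x, y}")
        case True
        then show ?thesis using hit_linked[OF xy Q(1)[of c]] Q(2)[of c] by blast
      next
        case False
        then have "a \<in> {x, y}" using meet_linked[OF ac xy] by blast
        moreover have "q \<in> {x, y}" using meet_linked[OF q(1) xy] False by blast
        ultimately have "x = a \<and> y = q \<or> x = q \<and> y = a" using \<open>q \<noteq> a\<close> by blast
        then have "linked a q" using xy linked_sym[OF xy] by blast
        then have "q \<in> Q a" "c \<in> Q a"
          using hit_linked[OF _ Q(1)[of a], of a q] hit_linked[OF ac Q(1)[of a]] Q(2)[of a] by blast+
        then show ?thesis using pr(2) unfolding q(2) by blast
      qed
      then show thesis using that by blast
    qed
  qed
  \<comment> \<open>\<open>S\<close> meets every 4-cycle, and two vertices have many common neighbours only if both lie in \<open>S\<close>.\<close>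
  define S where "S = insert a (Q a)"
  have S: "finite S" "card S = 5" unfolding S_def using cQ Q(2)[of a] by simp_all
  have hit_S: "R \<inter> S \<noteq> {}" if "quad R" for R using inter[OF that Q(1)[of a]] unfolding S_def by blast
  have few: "card (nbrs s \<inter> nbrs y) \<le> 5" if "s \<in> S" "y \<notin> S" for s y
  proof (rule ccontr)
    assume "\<not> ?thesis"
    then have "linked s y" using that unfolding linked_def by auto
    then show False using a that(2) unfolding S_def by blast
  qed
  \<comment> \<open>Two triangular faces that share an edge at \<open>s \<in> S\<close>, and likewise a 4-face with \<open>s\<close> as its only vertex in
    \<open>S\<close>, give a 4-cycle through \<open>s\<close>. As it meets \<open>Q s\<close>, one of these faces has an edge in the small set
    \<open>X1\<close> or \<open>X2\<close>.\<close>
  define ES where "ES = {e \<in> E. e \<subseteq> S}"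
  define D where "D = {e \<in> E. card (e \<inter> S) = 1}"
  define ER where "ER = {e \<in> E. e \<inter> S = {}}"
  define X1 where "X1 = {{s, x} | s x. s \<in> S \<and> x \<in> Q s} \<inter> E"
  \<comment> \<open>If \<open>s\<close> is the only vertex of a 4-face in \<open>S\<close> and the
    opposite vertex is in \<open>Q s\<close>, the other two vertices are common neighbours of
    \<open>s\<close> and a vertex of \<open>Q s - S\<close>. By \<open>few\<close>,
    \<open>N2 s\<close> has at most \<open>4 + 4 * 5 = 24\<close> elements. For the five vertices of
    \<open>S\<close> this yields 120 edges in \<open>X2\<close>, and \<open>5 * 4 = 20\<close> in
    \<open>X1\<close>.\<close>
  define N2 where "N2 s = Q s \<union> (\<Union>y\<in>Q s - S. nbrs s \<inter> nbrs y)" for s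
  define X2 where "X2 = {{s, x} | s x. s \<in> S \<and> x \<in> N2 s} \<inter> E"
  have cES: "card ES \<le> 10"
  proof -
    have "ES \<subseteq> {e. e \<subseteq> S \<and> card e = 2}" using edge(2) by (auto simp: ES_def)
    then have "card ES \<le> card {e. e \<subseteq> S \<and> card e = 2}" using S(1) by (intro card_mono) auto
    also have "\<dots> = card S choose 2" by (rule n_subsets[OF S(1)])
    also have "\<dots> = 10" by (simp add: S(2) choose_two)
    finally show ?thesis .
  qed
  have cX: "card ({{s, x} | s x. s \<in> S \<and> x \<in> N s} \<inter> E) \<le> 5 * m"
    if N: "\<And>s. s \<in> S \<Longrightarrow> finite (N s) \<and> card (N s) \<le> m" for N m
  proof -
    have "{{s, x} | s x. s \<in> S \<and> x \<in> N s} = (\<Union>s\<in>S. (\<lambda>x. {s, x}) ` N s)" by blast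
    then have "card ({{s, x} | s x. s \<in> S \<and> x \<in> N s} \<inter> E) \<le> card (\<Union>s\<in>S. (\<lambda>x. {s, x}) ` N s)"
      using N S(1) by (intro card_mono) auto
    also have "\<dots> \<le> (\<Sum>s\<in>S. card ((\<lambda>x. {s, x}) ` N s))" by (rule card_UN_le[OF S(1)])
    also have "\<dots> \<le> (\<Sum>s\<in>S. m)"
    proof (rule sum_mono)
      fix s assume "s \<in> S"
      then show "card ((\<lambda>x. {s, x}) ` N s) \<le> m"
        using N card_image_le[of "N s" "\<lambda>x. {s, x}"] le_trans by blast
    qed
    finally show ?thesis using S(2) by simp
  qed
  have cX1: "card X1 \<le> 20" unfolding X1_def using cX[of Q 4] cQ by simp
  have cX2: "card X2 \<le> 120"
  proof -
    have "finite (N2 s) \<and> card (N2 s) \<le> 24" if s: "s \<in> S" for s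
    proof
      show "finite (N2 s)" unfolding N2_def using cQ finite_nbrs by auto
      have "card (\<Union>y\<in>Q s - S. nbrs s \<inter> nbrs y) \<le> (\<Sum>y\<in>Q s - S. card (nbrs s \<inter> nbrs y))"
        using cQ by (intro card_UN_le) simp
      also have "\<dots> \<le> (\<Sum>y\<in>Q s - S. 5)" using few[OF s] by (intro sum_mono) blast
      also have "\<dots> \<le> 20" using card_mono[of "Q s" "Q s - S"] cQ[of s] by simp
      finally have "card (\<Union>y\<in>Q s - S. nbrs s \<inter> nbrs y) \<le> 20" .
      then show "card (N2 s) \<le> 24" unfolding N2_def using card_Un_le[of "Q s" "\<Union>y\<in>Q s - S. nbrs s \<inter> nbrs y"] cQ[of s] by linarith
    qed
    then show ?thesis unfolding X2_def using cX[of N2 24] by simp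
  qed
  define FS where "FS = {B \<in> F. B \<inter> ES \<noteq> {}}"
  define F3 where "F3 = {B \<in> F. B \<inter> X1 \<noteq> {}}"
  define F4 where "F4 = {B \<in> F. B \<inter> X2 \<noteq> {}}"
  define T0 where "T0 = {B \<in> F. card B = 3 \<and> B \<subseteq> ER}"
  define T1 where "T1 = {B \<in> F. card B = 3 \<and> B \<inter> X1 = {} \<and> 2 \<le> card (B \<inter> D)}"
  define q where "q = {B \<in> F. card B = 4 \<and> B \<subseteq> D}"
  have subE: "ES \<subseteq> E" "D \<subseteq> E" "ER \<subseteq> E" "X1 \<subseteq> E" "X2 \<subseteq> E" by (auto simp: ES_def D_def ER_def X1_def X2_def)
  have subF: "FS \<subseteq> F" "F3 \<subseteq> F" "F4 \<subseteq> F" "T0 \<subseteq> F" "T1 \<subseteq> F" "q \<subseteq> F"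
    by (auto simp: FS_def F3_def F4_def T0_def T1_def q_def)
  have fin: "finite T0" "finite T1" "finite q" "finite D" "finite ER"
    using subE subF finite_E finite_F finite_subset by blast+
  have b1: "card FS \<le> 20" using card_hitting[OF subE(1)] cES unfolding FS_def by linarith
  have b2: "card F3 \<le> 40" using card_hitting[OF subE(4)] cX1 unfolding F3_def by linarith
  have b3: "card F4 \<le> 240" using card_hitting[OF subE(5)] cX2 unfolding F4_def by linarith
  have triE: "B \<subseteq> E" if "B \<in> F" for B using that F_sub by blast
  have b4: "3 * card T0 + card D \<le> card E"
  proof -
    have "(\<Sum>B\<in>T0. card (B \<inter> ER)) = (\<Sum>B\<in>T0. 3)"
      by (rule sum.cong) (auto simp: T0_def Int_absorb2)
    moreover have "(\<Sum>B\<in>T0. card (B \<inter> ER)) \<le> 1 * card ER"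
    proof (rule double_count[OF subF(4) subE(3)])
      fix e assume "e \<in> ER"
      have "B = B'" if B: "B \<in> T0" "e \<in> B" and B': "B' \<in> T0" "e \<in> B'" for B B'
      proof (rule ccontr)
        assume ne: "B \<noteq> B'"
        have BF: "B \<in> F" "card B = 3" "B \<subseteq> ER" "B' \<in> F" "card B' = 3" "B' \<subseteq> ER"
          using B(1) B'(1) unfolding T0_def by blast+
        have v: "S \<inter> (\<Union>B \<union> \<Union>B') = {}" using BF(3,6) by (fastforce simp: ER_def)
        obtain x y z w where q: "c4 E x y z w" "{x, y, z, w} \<subseteq> \<Union>B \<union> \<Union>B'"
          by (rule two_triangle_faces_c4[OF BF(1,2,4,5) ne B(2) B'(2)])
        show False using Int_mono[OF q(2) order_refl, of S] hit_S[OF quadI[OF q(1)]] v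
          by (simp only: Int_commute subset_empty)
      qed
      then have "card {B \<in> T0. e \<in> B} \<le> Suc 0" by (simp add: card_le_Suc0_iff_eq fin)
      then show "card {B \<in> T0. e \<in> B} \<le> 1" by simp
    qed
    moreover have "card ER + card D \<le> card E"
    proof -
      have "ER \<inter> D = {}" by (auto simp: ER_def D_def)
      then have "card ER + card D = card (ER \<union> D)" using fin by (simp add: card_Un_disjoint)
      also have "\<dots> \<le> card E" using subE finite_E by (intro card_mono) auto
      finally show ?thesis .
    qed
    ultimately show ?thesis by simp
  qed
  have b5: "2 * card T1 \<le> card D"
  proof -
    have "(\<Sum>B\<in>T1. 2) \<le> (\<Sum>B\<in>T1. card (B \<inter> D))" by (rule sum_mono) (simp add: T1_def)
    also have "\<dots> \<le> 1 * card D"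
    proof (rule double_count[OF subF(5) subE(2)])
      fix e assume e: "e \<in> D"
      obtain s where s: "s \<in> e" "s \<in> S" 
      proof -
        have "e \<inter> S \<noteq> {}" using e unfolding D_def by auto
        then show thesis using that by blast
      qed
      have "B = B'" if B: "B \<in> T1" "e \<in> B" and B': "B' \<in> T1" "e \<in> B'" for B B'
      proof (rule ccontr)
        assume ne: "B \<noteq> B'"
        have BF: "B \<in> F" "card B = 3" "B \<inter> X1 = {}" "B' \<in> F" "card B' = 3" "B' \<inter> X1 = {}"
          using B(1) B'(1) unfolding T1_def by blast+
        have x1: "y \<notin> Q s" if "{s, y} \<in> B \<union> B'" for y
        proof
          assume "y \<in> Q s"
          moreover have "{s, y} \<in> E" using that triE[OF BF(1)] triE[OF BF(4)] by blast
          ultimately have "{s, y} \<in> X1" using s(2) unfolding X1_def by blast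
          then show False using that BF(3,6) by blast
        qed
        have adj: "y = s \<or> {s, y} \<in> B \<union> B'" if "y \<in> \<Union>B \<union> \<Union>B'" for y
          using that triangle_face_adjacent[OF BF(1,2), of s y] triangle_face_adjacent[OF BF(4,5), of s y]
            s(1) B(2) B'(2) by blast
        obtain x y z w where q: "c4 E x y z w" "{x, y, z, w} \<subseteq> \<Union>B \<union> \<Union>B'"
          by (rule two_triangle_faces_c4[OF BF(1,2,4,5) ne B(2) B'(2)])
        obtain y' where y': "y' \<in> {x, y, z, w}" "y' \<in> Q s" using inter[OF quadI[OF q(1)] Q(1)[of s]] by blast
        show False using adj[OF subsetD[OF q(2) y'(1)]] x1[of y'] y'(2) Q(2)[of s] by metis
      qed
      then have "card {B \<in> T1. e \<in> B} \<le> Suc 0" by (simp add: card_le_Suc0_iff_eq fin)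
      then show "card {B \<in> T1. e \<in> B} \<le> 1" by simp
    qed
    finally show ?thesis by simp
  qed
  \<comment> \<open>Here both sides of the edges in \<open>D\<close> are counted: a face in
    \<open>T1\<close> takes at least two of them and a face in \<open>q\<close> four.\<close>
  have b6: "card T1 + 2 * card q \<le> card D"
  proof -
    have disj: "T1 \<inter> q = {}" by (auto simp: T1_def q_def)
    have "2 * card T1 + 4 * card q \<le> (\<Sum>B\<in>T1. card (B \<inter> D)) + (\<Sum>B\<in>q. card (B \<inter> D))"
    proof (rule add_mono)
      have "(\<Sum>B\<in>T1. 2) \<le> (\<Sum>B\<in>T1. card (B \<inter> D))" by (rule sum_mono) (simp add: T1_def)
      then show "2 * card T1 \<le> (\<Sum>B\<in>T1. card (B \<inter> D))" by simp
      have "(\<Sum>B\<in>q. 4) \<le> (\<Sum>B\<in>q. card (B \<inter> D))" by (rule sum_mono) (simp add: q_def Int_absorb2)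
      then show "4 * card q \<le> (\<Sum>B\<in>q. card (B \<inter> D))" by simp
    qed
    also have "\<dots> = (\<Sum>B\<in>T1 \<union> q. card (B \<inter> D))" using fin disj by (simp add: sum.union_disjoint)
    also have "\<dots> \<le> 2 * card D" using subF subE by (intro double_count2) auto
    finally show ?thesis by simp
  qed
  have b7: "card D + 4 \<le> 2 * card V" using bip[OF subE(2), of S] D_def by blast
  \<comment> \<open>The truncated difference is 2 for triangles, 1 for 4-faces and 0 otherwise.
    Families that may have to account for a triangle get weight 2; \<open>F4\<close> and
    \<open>q\<close> only account for 4-faces.\<close>
  have split: "5 - card B \<le> 2 * of_bool (B \<in> FS) + 2 * of_bool (B \<in> F3) + of_bool (B \<in> F4)
      + 2 * of_bool (B \<in> T0) + 2 * of_bool (B \<in> T1) + (of_bool (B \<in> q) :: nat)" if B: "B \<in> F" for B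
    using B
  proof (cases B rule: face_cases)
    case (tri a b c)
    have BE: "B \<subseteq> E" using triE[OF B] .
    have "B \<in> FS \<or> B \<in> F3 \<or> B \<in> T0 \<or> B \<in> T1"
    proof (rule ccontr)
      assume no: "\<not> ?thesis"
      have one: "{x, y} \<in> D \<longleftrightarrow> x \<in> S \<or> y \<in> S" "{x, y} \<in> ER \<longleftrightarrow> x \<notin> S \<and> y \<notin> S" "\<not> (x \<in> S \<and> y \<in> S)"
        if "{x, y} \<in> B" for x y
      proof -
        have xyE: "{x, y} \<in> E" using that BE by blast
        show ns: "\<not> (x \<in> S \<and> y \<in> S)" using no B that xyE unfolding FS_def ES_def by blast
        then have "{x, y} \<inter> S = (if x \<in> S then {x} else if y \<in> S then {y} else {})" by auto
        then have "card ({x, y} \<inter> S) = (if x \<in> S \<or> y \<in> S then 1 else 0)" by simp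
        then show "{x, y} \<in> D \<longleftrightarrow> x \<in> S \<or> y \<in> S" using xyE unfolding D_def by simp
        show "{x, y} \<in> ER \<longleftrightarrow> x \<notin> S \<and> y \<notin> S" using xyE unfolding ER_def by auto
      qed
      have eB: "{a, b} \<in> B" "{b, c} \<in> B" "{c, a} \<in> B" using tri(2) by simp_all
      have dist: "{a, b} \<noteq> {b, c}" "{a, b} \<noteq> {c, a}" "{b, c} \<noteq> {c, a}" using tri(1) by (auto simp: doubleton_eq_iff)
      have "\<not> B \<subseteq> ER" using no B tri(3) unfolding T0_def by blast
      then have some: "a \<in> S \<or> b \<in> S \<or> c \<in> S"
        using one(2)[OF eB(1)] one(2)[OF eB(2)] one(2)[OF eB(3)] unfolding tri(2) by blast
      have two: "2 \<le> card (B \<inter> D)" if "f \<in> B" "g \<in> B" "f \<noteq> g" "f \<in> D" "g \<in> D" for f g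
      proof -
        have "card {f, g} \<le> card (B \<inter> D)" using that finite_face[OF B] by (intro card_mono) auto
        then show ?thesis using that(3) by simp
      qed
      have "2 \<le> card (B \<inter> D)"
        using some one(1)[OF eB(1)] one(1)[OF eB(2)] one(1)[OF eB(3)] two eB dist by metis
      then show False using no B tri(3) unfolding T1_def F3_def by blast
    qed
    then show ?thesis using tri(3) by auto
  next
    case (quad a b c d)
    have BE: "B \<subseteq> E" using triE[OF B] .
    have "B \<in> FS \<or> B \<in> F4 \<or> B \<in> q"
    proof -
      obtain s b' c' d' where r: "c4 E s b' c' d'" "B = {{s, b'}, {b', c'}, {c', d'}, {d', s}}" "s \<in> S"
      proof -
        have "{a, b, c, d} \<inter> S \<noteq> {}" using hit_S[OF quadI[OF quad(1)]] .
        then consider "a \<in> S" | "b \<in> S" | "c \<in> S" | "d \<in> S" by blast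
        then show thesis
        proof cases
          case 1
          then show thesis using that quad by blast
        next
          case 2
          have "B = {{b, c}, {c, d}, {d, a}, {a, b}}" unfolding quad(2) by blast
          then show thesis using that c4_rotate[OF quad(1)] 2 by blast
        next
          case 3
          have "B = {{c, d}, {d, a}, {a, b}, {b, c}}" unfolding quad(2) by blast
          then show thesis using that c4_rotate[OF c4_rotate[OF quad(1)]] 3 by blast
        next
          case 4
          have "B = {{d, a}, {a, b}, {b, c}, {c, d}}" unfolding quad(2) by blast
          then show thesis using that c4_rotate[OF c4_rotate[OF c4_rotate[OF quad(1)]]] 4 by blast
        qed
      qed
      have eE: "{s, b'} \<in> E" "{b', c'} \<in> E" "{c', d'} \<in> E" "{d', s} \<in> E" using r(1) by (auto simp: c4_def)
      have eB: "{s, b'} \<in> B" "{s, d'} \<in> B" unfolding r(2) by (auto simp: insert_commute)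
      show ?thesis
      proof (cases "b' \<in> S \<or> d' \<in> S")
        case True
        then have "B \<in> FS" using B eB eE r(3) unfolding FS_def ES_def by (auto simp: insert_commute)
        then show ?thesis by blast
      next
        case nbd: False
        show ?thesis
        proof (cases "c' \<in> S")
          case True
          have xyD: "{x, y} \<in> D" if "{x, y} \<in> E" "(x \<in> S) \<noteq> (y \<in> S)" for x y
          proof -
            have "{x, y} \<inter> S = {x} \<or> {x, y} \<inter> S = {y}" using that(2) by blast
            then show ?thesis using that(1) by (auto simp: D_def)
          qed
          have "B \<subseteq> D"
            using xyD[OF eE(1)] xyD[OF eE(2)] xyD[OF eE(3)] xyD[OF eE(4)] nbd True r(3) unfolding r(2) by simp
          then show ?thesis using B quad(3) unfolding q_def by blast
        next
          case False
          have "{s, b', c', d'} \<inter> Q s \<noteq> {}" using inter[OF quadI[OF r(1)] Q(1)] .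
          then have "b' \<in> Q s \<or> c' \<in> Q s \<or> d' \<in> Q s" using Q(2)[of s] by blast
          moreover have "b' \<in> nbrs s \<inter> nbrs c'" using eE by (simp add: nbrs_def insert_commute)
          ultimately have "b' \<in> N2 s \<or> d' \<in> N2 s" using False unfolding N2_def by blast
          then have "{s, b'} \<in> X2 \<or> {s, d'} \<in> X2" using r(3) BE eB unfolding X2_def by blast
          then show ?thesis using B eB unfolding F4_def by blast
        qed
      qed
    qed
    then show ?thesis using quad(3) by auto
  next
    case large
    then show ?thesis by simp
  qed
  have cnt: "(\<Sum>B\<in>F. of_bool (B \<in> H)) = card H" if "H \<subseteq> F" for H
    using that finite_F by (simp add: Int_absorb1)
  have "(\<Sum>B\<in>F. 5 - card B) \<le> (\<Sum>B\<in>F. 2 * of_bool (B \<in> FS) + 2 * of_bool (B \<in> F3) + of_bool (B \<in> F4)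
      + 2 * of_bool (B \<in> T0) + 2 * of_bool (B \<in> T1) + of_bool (B \<in> q))"
    by (rule sum_mono) (rule split)
  also have "\<dots> = 2 * card FS + 2 * card F3 + card F4 + 2 * card T0 + 2 * card T1 + card q"
    using subF by (simp only: sum.distrib sum_distrib_left[symmetric] cnt)
  finally have w: "(\<Sum>B\<in>F. 5 - card B) \<le> 2 * card FS + 2 * card F3 + card F4 + 2 * card T0 + 2 * card T1 + card q" .
  have "5 * card F = (\<Sum>B\<in>F. 5)" by simp
  also have "\<dots> \<le> (\<Sum>B\<in>F. card (B \<inter> E) + (5 - card B))"
    using F_sub by (intro sum_mono) (auto simp: Int_absorb2)
  also have "\<dots> \<le> 2 * card E + (\<Sum>B\<in>F. 5 - card B)"
    using double_count2[of F E] by (simp add: sum.distrib)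
  finally have "5 * card F \<le> 2 * card E + (\<Sum>B\<in>F. 5 - card B)" .
  \<comment> \<open>The exceptional faces contribute at most \<open>40 + 80 + 240 = 360\<close>.
    From \<open>b5\<close> and \<open>b6\<close>, \<open>2 * card T1 + card q\<close> is at most
    \<open>5/4 * card D\<close>. With \<open>b4\<close> and Euler's inequality,
    \<open>card E\<close> is at most \<open>15/7 * card V + 150 + card D / 4\<close>, and
    \<open>b7\<close> turns this into \<open>7 * card E \<le> 37/2 * card V + 1043\<close>.\<close>
  then show ?thesis using w b1 b2 b3 b4 b5 b6 b7 euler n by linarith
qed

end

section \<open>Upper bound for planar graphs without two disjoint 4-cycles\<close>

lemma two_C4_verts: "verts two_C4 = Inl ` {0, 1, 2, 3} \<union> Inr ` {0, 1, 2, 3}"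
  and two_C4_edges: "edges two_C4 =
    (`) Inl ` {{0, 1}, {1, 2}, {2, 3}, {3, 0}} \<union> (`) Inr ` {{0, 1}, {1, 2}, {2, 3}, {3, 0}}"
proof -
  have four: "{..<4::nat} = {0, 1, 2, 3}" by auto
  show "verts two_C4 = Inl ` {0, 1, 2, 3} \<union> Inr ` {0, 1, 2, 3}"
    by (simp add: two_C4_def disjoint_union_def cycle_graph_def four)
  show "edges two_C4 = (`) Inl ` {{0, 1}, {1, 2}, {2, 3}, {3, 0}} \<union> (`) Inr ` {{0, 1}, {1, 2}, {2, 3}, {3, 0}}"
    by (simp add: two_C4_def disjoint_union_def cycle_graph_def four numeral_2_eq_2[symmetric] numeral_3_eq_3[symmetric])
qed

lemma disjoint_c4_contains_copy:
  assumes "simple_graph G" "c4 (edges G) a b c d" "c4 (edges G) a' b' c' d'"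
    and disj: "{a, b, c, d} \<inter> {a', b', c', d'} = {}"
  shows "contains_copy G two_C4"
proof -
  have sub: "{a, b, c, d, a', b', c', d'} \<subseteq> verts G"
  proof -
    have x: "x \<in> verts G" if "{x, y} \<in> edges G" for x y
      using that assms(1) unfolding simple_graph_def by blast
    have e: "{a, b} \<in> edges G" "{b, c} \<in> edges G" "{c, d} \<in> edges G" "{d, a} \<in> edges G"
      "{a', b'} \<in> edges G" "{b', c'} \<in> edges G" "{c', d'} \<in> edges G" "{d', a'} \<in> edges G"
      using assms(2,3) by (simp_all add: c4_def)
    show ?thesis by (simp add: x[OF e(1)] x[OF e(2)] x[OF e(3)] x[OF e(4)] x[OF e(5)] x[OF e(6)] x[OF e(7)] x[OF e(8)])
  qed
  define f where "f z = (case z of Inl i \<Rightarrow> [a, b, c, d] ! i | Inr i \<Rightarrow> [a', b', c', d'] ! i)" for z :: "nat + nat"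
  have v: "f (Inl 0) = a" "f (Inl 1) = b" "f (Inl 2) = c" "f (Inl 3) = d"
    "f (Inr 0) = a'" "f (Inr 1) = b'" "f (Inr 2) = c'" "f (Inr 3) = d'"
    by (simp_all add: f_def numeral_2_eq_2 numeral_3_eq_3)
  show ?thesis
    unfolding contains_copy_def
  proof (intro exI[of _ f] conjI)
    show "inj_on f (verts two_C4)"
      unfolding two_C4_verts inj_on_def using v assms(2,3) disj unfolding c4_def by auto
    show "f ` verts two_C4 \<subseteq> verts G" unfolding two_C4_verts using v sub by auto
    show "\<forall>e\<in>edges two_C4. f ` e \<in> edges G"
      unfolding two_C4_edges using v assms(2,3) unfolding c4_def by (simp add: image_Un)
  qed
qed

theorem planar_2C4_free_upper:
  fixes G :: "'a sgraph"
  assumes G: "simple_graph G" "planar G" "\<not> contains_copy G two_C4" and n: "card (verts G) \<ge> 2661"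
  shows "7 * card (edges G) + 34 \<le> 19 * card (verts G) \<and> 7 * card (edges G) + 35 \<noteq> 19 * card (verts G)"
proof (cases "card (verts G) < card (edges G)")
  case False
  \<comment> \<open>Face families exist only when edges outnumber vertices; otherwise the bound is
    immediate, since \<open>7 * n + 35 < 19 * n\<close>.\<close>
  then show ?thesis using n by linarith
next
  case True
  have fam: "\<exists>F. face_family (verts G) E F" if E: "E \<subseteq> edges G" "card (verts G) < card E" for E
  proof -
    obtain F where "F \<subseteq> Pow E" "card E + 2 \<le> card F + card (verts G)"
      "\<And>B. B \<in> F \<Longrightarrow> B \<noteq> {}" "\<And>B. B \<in> F \<Longrightarrow> even_degrees B"
      "\<And>e. e \<in> E \<Longrightarrow> card {B \<in> F. e \<in> B} \<le> 2"
      using planar_faces[OF G(1,2) E] by blast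
    then have "face_family (verts G) E F"
      using G(1) E(1) unfolding face_family_def simple_graph_def by blast
    then show ?thesis by blast
  qed
  obtain F where "face_family (verts G) (edges G) F" using fam[OF order_refl True] by blast
  then interpret face_family "verts G" "edges G" F .
  show ?thesis
  proof (cases "\<exists>v\<in>verts G. \<forall>a b c d. c4 (edges G) a b c d \<longrightarrow> v \<in> {a, b, c, d}")
    case True
    then show ?thesis using hitting_vertex_bound by blast
  next
    case False
    have "7 * card (edges G) + 42 \<le> 19 * card (verts G)"
    proof (rule no_hitting_vertex_bound[OF _ _ _ n])
      show "Q \<inter> R \<noteq> {}" if "quad Q" "quad R" for Q R
        using that disjoint_c4_contains_copy[OF G(1)] G(3) unfolding quad_def by metis
      have ne: "verts G \<noteq> {}" using n by auto
      have qV: "Q \<subseteq> verts G" if "quad Q" for Q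
        using that edge(1) unfolding quad_def c4_def by blast
      show "\<exists>Q. quad Q \<and> v \<notin> Q" for v
      proof (cases "v \<in> verts G")
        case True
        then show ?thesis using False quadI by blast
      next
        case v: False
        \<comment> \<open>The choice of \<open>Q\<close> in \<open>no_hitting_vertex_bound\<close>
          is total, so points outside the graph need a 4-cycle too; any 4-cycle avoids them.\<close>
        obtain Q where "quad Q" using ne False quadI by blast
        then show ?thesis using qV v by blast
      qed
      show "card D + 4 \<le> 2 * card (verts G)"
        if D: "D \<subseteq> edges G" "\<And>e. e \<in> D \<Longrightarrow> card (e \<inter> S) = 1" for D S
      proof (cases "card (verts G) < card D")
        case True
        then obtain F' where "face_family (verts G) D F'" using fam[OF D(1)] by blast
        then show ?thesis using face_family.bipartite_bound D(2) by blast
      next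
        case False
        then show ?thesis using n by linarith
      qed
    qed
    then show ?thesis by linarith
  qed
qed

section \<open>Extremal graphs\<close>

text \<open>Graphs on \<open>{0..p}\<close> without \<open>C\<^sub>4\<close> that are outerplanar with the vertices in this order on the outer face.\<close>

definition outer :: "nat \<Rightarrow> nat set set \<Rightarrow> bool" where
  "outer p H \<longleftrightarrow> (\<forall>e\<in>H. \<exists>i j. e = {i, j} \<and> i < j \<and> j \<le> p) \<and>
    (\<forall>i j k l. {i, j} \<in> H \<longrightarrow> {k, l} \<in> H \<longrightarrow> \<not> (i < k \<and> k < j \<and> j < l)) \<and>
    (\<forall>a b c d. \<not> c4 H a b c d)"

lemma outer_edge: "outer p H \<Longrightarrow> {x, y} \<in> H \<Longrightarrow> x \<le> p \<and> y \<le> p \<and> x \<noteq> y"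
  unfolding outer_def by (metis doubleton_eq_iff le_trans less_imp_le_nat less_irrefl_nat)

lemma outer_finite: "outer p H \<Longrightarrow> finite H"
proof (rule finite_subset)
  show "outer p H \<Longrightarrow> H \<subseteq> Pow {..p}" by (fastforce simp: outer_def)
qed simp

text \<open>New edges join vertices from \<open>p\<close> on to each other or to 0, so none of them
  starts strictly inside an old edge or ends there. A 4-cycle with a new vertex can be rotated to
  begin at it, and one without new vertices is old.\<close>

lemma outerI:
  assumes H: "outer p H" and K: "\<And>e. e \<in> K \<Longrightarrow> \<exists>i j. e = {i, j} \<and> i < j \<and> j \<le> q" and pq: "p \<le> q"
    and far: "\<And>i j. {i, j} \<in> K \<Longrightarrow> i < j \<Longrightarrow> p < j \<and> (i = 0 \<or> p \<le> i)"
    and cross: "\<And>i j k l. {i, j} \<in> K \<Longrightarrow> {k, l} \<in> K \<Longrightarrow> i < k \<Longrightarrow> k < j \<Longrightarrow> j < l \<Longrightarrow> False"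
    and new: "\<And>x b c d. p < x \<Longrightarrow> x \<le> q \<Longrightarrow> \<not> c4 (H \<union> K) x b c d"
  shows "outer q (H \<union> K)"
  unfolding outer_def
proof (intro conjI ballI allI impI notI)
  fix e assume "e \<in> H \<union> K"
  then show "\<exists>i j. e = {i, j} \<and> i < j \<and> j \<le> q"
    using H K pq unfolding outer_def by (meson UnE le_trans)
next
  fix i j k l assume *: "{i, j} \<in> H \<union> K" "{k, l} \<in> H \<union> K" "i < k \<and> k < j \<and> j < l"
  have "i < j" "k < l" using *(3) by auto
  consider "{i, j} \<in> H" "{k, l} \<in> H" | "{i, j} \<in> H" "{k, l} \<in> K" | "{i, j} \<in> K" "{k, l} \<in> H" | "{i, j} \<in> K" "{k, l} \<in> K"
    using *(1,2) by blast
  then show False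
  proof cases
    case 1
    then show False using H *(3) unfolding outer_def by blast
  next
    case 2
    then show False using outer_edge[OF H 2(1)] far[OF 2(2) \<open>k < l\<close>] *(3) by linarith
  next
    case 3
    then show False using outer_edge[OF H 3(2)] far[OF 3(1) \<open>i < j\<close>] *(3) by linarith
  next
    case 4
    then show False using cross *(3) by blast
  qed
next
  fix a b c d assume c: "c4 (H \<union> K) a b c d"
  have le: "x \<le> q" if "{x, y} \<in> H \<union> K" for x y
    using that outer_edge[OF H, of x y] pq K[of "{x, y}"] by (fastforce simp: doubleton_eq_iff)
  have old: "{x, y} \<in> H" if "{x, y} \<in> H \<union> K" "x \<le> p" "y \<le> p" for x y
  proof (rule ccontr)
    assume "{x, y} \<notin> H"
    then have k: "{x, y} \<in> K" using that(1) by blast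
    then obtain i j where ij: "{x, y} = {i, j}" "i < j" using K by blast
    then have "p < j" using far k by simp
    moreover have "j = x \<or> j = y" using ij(1) by blast
    ultimately show False using that(2,3) by linarith
  qed
  have "a \<le> p" "b \<le> p" "c \<le> p" "d \<le> p"
    using new[of a b c d] new[of b c d a] new[of c d a b] new[of d a b c] c c4_rotate le
    unfolding c4_def by (meson not_le)+
  then have "c4 H a b c d" using c old unfolding c4_def by blast
  then show False using H unfolding outer_def by blast
qed

lemma outer_tail:
  assumes H: "outer p H" and z: "z = 0 \<or> z = p"
  shows "outer (p + 1) (H \<union> {{z, p + 1}})"
proof (rule outerI[OF H])
  show "\<not> c4 (H \<union> {{z, p + 1}}) x b c d" if x: "p < x" "x \<le> p + 1" for x b c d
  proof
    assume c: "c4 (H \<union> {{z, p + 1}}) x b c d"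
    have N: "y = z" if "{x, y} \<in> H \<union> {{z, p + 1}}" for y
      using that outer_edge[OF H, of x y] x z by (auto simp: doubleton_eq_iff)
    show False using c N[of b] N[of d] unfolding c4_def by (auto simp: insert_commute)
  qed
qed (use z in \<open>auto simp: doubleton_eq_iff\<close>)

text \<open>The new vertices are joined only to each other and to \<open>z\<close>. A 4-cycle
  through one of them would contain \<open>z\<close> and the other one, which have no further common
  neighbour.\<close>

lemma outer_triangle:
  assumes H: "outer p H" and z: "z = 0 \<or> z = p"
  shows "outer (p + 2) (H \<union> {{z, p + 1}, {p + 1, p + 2}, {z, p + 2}})"
proof (rule outerI[OF H])
  let ?H = "H \<union> {{z, p + 1}, {p + 1, p + 2}, {z, p + 2}}"
  show "\<not> c4 ?H x b c d" if x: "p < x" "x \<le> p + 2" for x b c d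
  proof
    assume c: "c4 ?H x b c d"
    have N1: "y = z \<or> y = p + 2" if "{p + 1, y} \<in> ?H" for y
      using that outer_edge[OF H, of "p + 1" y] z by (auto simp: doubleton_eq_iff)
    have N2: "y = z \<or> y = p + 1" if "{p + 2, y} \<in> ?H" for y
      using that outer_edge[OF H, of "p + 2" y] z by (auto simp: doubleton_eq_iff)
    define R where "R x y \<longleftrightarrow> {x, y} \<in> ?H" for x y
    have d: "x \<noteq> c" "b \<noteq> d" "b \<noteq> c" "c \<noteq> d" and e: "R x b" "R b c" "R d c" "R x d"
      using c unfolding c4_def R_def by (simp_all add: insert_commute)
    note N = N1[folded R_def] N2[folded R_def]
    have "x = p + 1 \<or> x = p + 2" using x by linarith
    then show False
    proof
      assume x: "x = p + 1"
      then have "b = z \<and> d = p + 2 \<or> b = p + 2 \<and> d = z" using N(1)[of b] N(1)[of d] e d(2) by blast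
      then have "R (p + 2) c" "c \<noteq> z" using e d by auto
      then show False using N(2)[of c] d(1) x by blast
    next
      assume x: "x = p + 2"
      then have "b = z \<and> d = p + 1 \<or> b = p + 1 \<and> d = z" using N(2)[of b] N(2)[of d] e d(2) by blast
      then have "R (p + 1) c" "c \<noteq> z" using e d by auto
      then show False using N(1)[of c] d(1) x by blast
    qed
  qed
  show "\<exists>i j. e = {i, j} \<and> i < j \<and> j \<le> p + 2" if "e \<in> {{z, p + 1}, {p + 1, p + 2}, {z, p + 2}}" for e
  proof -
    have ex: "\<exists>i j. {a, b} = {i, j} \<and> i < j \<and> j \<le> p + 2" if "a < b" "b \<le> p + 2" for a b
      using that by blast
    have "z < p + 1" "z < p + 2" using z by auto
    then show ?thesis
      using that ex[of z "p + 1"] ex[of "p + 1" "p + 2"] ex[of z "p + 2"] by (elim insertE emptyE) simp_all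
  qed
qed (use z in \<open>auto simp: doubleton_eq_iff\<close>)

text \<open>A chain of three triangles from \<open>q\<close> back to \<open>0\<close>; the bases of the triangles and a path of length two
  from \<open>0\<close> to \<open>q\<close> bound a pentagon.\<close>

definition chain :: "nat \<Rightarrow> nat set set" where
  "chain q = {{q, q + 1}, {q + 1, q + 2}, {q, q + 2}, {q + 2, q + 3}, {q + 3, q + 4}, {q + 2, q + 4},
    {q + 4, q + 5}, {0, q + 5}, {0, q + 4}}"

lemma chain_pairs:
  assumes "{i, j} \<in> chain q" "i < j"
  shows "i = q \<and> j = q + 1 \<or> i = q + 1 \<and> j = q + 2 \<or> i = q \<and> j = q + 2 \<or> i = q + 2 \<and> j = q + 3 \<or>
    i = q + 3 \<and> j = q + 4 \<or> i = q + 2 \<and> j = q + 4 \<or> i = q + 4 \<and> j = q + 5 \<or>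
    i = 0 \<and> j = q + 5 \<or> i = 0 \<and> j = q + 4"
proof -
  have "{i, j} = {a, b} \<longleftrightarrow> i = a \<and> j = b" if "a < b" for a b
    using assms(2) that by (auto simp: doubleton_eq_iff)
  then show ?thesis using assms(1) unfolding chain_def by simp
qed

text \<open>The tips \<open>q + 1\<close>, \<open>q + 3\<close> and \<open>q + 5\<close> have two
  neighbours each, and these have no other common neighbour; so the tips lie on no 4-cycle. A
  4-cycle through \<open>q + 2\<close> or \<open>q + 4\<close> could then only be
  \<open>q, q + 2, q + 4, 0\<close>, and this is why \<open>{0, q}\<close> must not be an
  edge.\<close>

lemma outer_chain:
  assumes H: "outer q H" and q: "q \<noteq> 0" "{0, q} \<notin> H"
  shows "outer (q + 5) (H \<union> chain q)"
proof (rule outerI[OF H])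
  let ?H = "H \<union> chain q"
  have old: "{x, y} \<notin> H" if "q < x" for x y using outer_edge[OF H, of x y] that by auto
  have N1: "y = q \<or> y = q + 2" if "{q + 1, y} \<in> ?H" for y
    using that old[of "q + 1" y] q unfolding chain_def by (auto simp: doubleton_eq_iff)
  have N2: "y = q \<or> y = q + 1 \<or> y = q + 3 \<or> y = q + 4" if "{q + 2, y} \<in> ?H" for y
    using that old[of "q + 2" y] q unfolding chain_def by (auto simp: doubleton_eq_iff)
  have N3: "y = q + 2 \<or> y = q + 4" if "{q + 3, y} \<in> ?H" for y
    using that old[of "q + 3" y] q unfolding chain_def by (auto simp: doubleton_eq_iff)
  have N4: "y = q + 2 \<or> y = q + 3 \<or> y = q + 5 \<or> y = 0" if "{q + 4, y} \<in> ?H" for y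
    using that old[of "q + 4" y] q unfolding chain_def by (auto simp: doubleton_eq_iff)
  have N5: "y = q + 4 \<or> y = 0" if "{q + 5, y} \<in> ?H" for y
    using that old[of "q + 5" y] q unfolding chain_def by (auto simp: doubleton_eq_iff)
  have N0: "{0, q} \<notin> ?H"
    using q unfolding chain_def by (auto simp: doubleton_eq_iff)
  define R where "R x y \<longleftrightarrow> {x, y} \<in> ?H" for x y
  note N = N1[folded R_def] N2[folded R_def] N3[folded R_def] N4[folded R_def] N5[folded R_def]
  have sym: "R x y \<longleftrightarrow> R y x" for x y by (simp add: R_def insert_commute)
  have R0: "\<not> R 0 q" "\<not> R q 0" using N0 sym unfolding R_def by blast+
  have c4D: "R x b" "R b c" "R d c" "R x d" "x \<noteq> b" "x \<noteq> c" "x \<noteq> d" "b \<noteq> c" "b \<noteq> d" "c \<noteq> d"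
    if "c4 ?H x b c d" for x b c d
    using that unfolding c4_def R_def by (simp_all add: insert_commute)
  have apart: "\<not> R (q + 2) 0" "\<not> R (q + 3) 0" "\<not> R (q + 3) q" "\<not> R (q + 4) q"
    using N(2)[of 0] N(3)[of 0] N(3)[of q] N(4)[of q] q by auto
  have no1: "\<not> c4 ?H (q + 1) b c d" for b c d
  proof
    assume "c4 ?H (q + 1) b c d"
    note c = c4D[OF this]
    have "b = q \<and> d = q + 2 \<or> b = q + 2 \<and> d = q" using N(1)[OF c(1)] N(1)[OF c(4)] c(9) by blast
    then show False
    proof (elim disjE conjE)
      assume bd: "b = q" "d = q + 2"
      then have "c = q + 3 \<or> c = q + 4" using N(2)[of c] c by auto
      then show False using apart c(2) bd sym by blast
    next
      assume bd: "b = q + 2" "d = q"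
      then have "c = q + 3 \<or> c = q + 4" using N(2)[of c] c by auto
      then show False using apart c(3) bd sym by blast
    qed
  qed
  have no3: "\<not> c4 ?H (q + 3) b c d" for b c d
  proof
    assume "c4 ?H (q + 3) b c d"
    note c = c4D[OF this]
    have "b = q + 2 \<and> d = q + 4 \<or> b = q + 4 \<and> d = q + 2" using N(3)[OF c(1)] N(3)[OF c(4)] c(9) by blast
    then have "R (q + 2) c" "R (q + 4) c" using c by auto
    then show False using N(2)[of c] N(4)[of c] c(6) q by auto
  qed
  have no5: "\<not> c4 ?H (q + 5) b c d" for b c d
  proof
    assume "c4 ?H (q + 5) b c d"
    note c = c4D[OF this]
    have "b = 0 \<and> d = q + 4 \<or> b = q + 4 \<and> d = 0" using N(5)[OF c(1)] N(5)[OF c(4)] c(9) by blast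
    then have 0: "R 0 c" "R (q + 4) c" "c \<noteq> 0" using c by auto
    then have "c = q + 2 \<or> c = q + 3" using N(4)[of c] c(6) by auto
    then show False using 0(1) apart sym by blast
  qed
  have odd: "y \<noteq> q + 1" "y \<noteq> q + 3" "y \<noteq> q + 5" if "c4 ?H x b c d" "y \<in> {b, c, d}" for x b c d y
  proof -
    have r: "c4 ?H b c d x" "c4 ?H c d x b" "c4 ?H d x b c"
      by (rule c4_rotate[OF that(1)], rule c4_rotate[OF c4_rotate[OF that(1)]],
        rule c4_rotate[OF c4_rotate[OF c4_rotate[OF that(1)]]])
    show "y \<noteq> q + 1" using no1 r that(2) by blast
    show "y \<noteq> q + 3" using no3 r that(2) by blast
    show "y \<noteq> q + 5" using no5 r that(2) by blast
  qed
  show "\<not> c4 ?H x b c d" if x: "q < x" "x \<le> q + 5" for x b c d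
  proof
    assume c4: "c4 ?H x b c d"
    note c = c4D[OF c4] and o = odd[OF c4, of b, simplified] odd[OF c4, of c, simplified] odd[OF c4, of d, simplified]
    have "x = q + 1 \<or> x = q + 2 \<or> x = q + 3 \<or> x = q + 4 \<or> x = q + 5" using x by linarith
    then have "x = q + 2 \<or> x = q + 4" using c4 no1 no3 no5 by blast
    then show False
    proof
      assume x: "x = q + 2"
      have "b = q \<and> d = q + 4 \<or> b = q + 4 \<and> d = q"
        using N(2)[of b] N(2)[of d] c x o by auto
      then have qc: "R q c" "R (q + 4) c" using c by auto
      then have "c = 0" using N(4)[of c] c(6) x o by auto
      then show False using qc R0 by blast
    next
      assume x: "x = q + 4"
      have "b = q + 2 \<and> d = 0 \<or> b = 0 \<and> d = q + 2"
        using N(4)[of b] N(4)[of d] c x o by auto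
      then have qc: "R (q + 2) c" "R 0 c" using c by auto
      then have "c = q" using N(2)[of c] c(6) x o by auto
      then show False using qc R0 by blast
    qed
  qed
  show "\<exists>i j. e = {i, j} \<and> i < j \<and> j \<le> q + 5" if "e \<in> chain q" for e
    using that unfolding chain_def
    by (elim insertE emptyE) (rule exI, rule exI, rule conjI, assumption, simp)+
  show "q < j \<and> (i = 0 \<or> q \<le> i)" if "{i, j} \<in> chain q" "i < j" for i j
    using chain_pairs[OF that] q(1) by auto
  show False if "{i, j} \<in> chain q" "{k, l} \<in> chain q" "i < k" "k < j" "j < l" for i j k l
    using chain_pairs[OF that(1)] chain_pairs[OF that(2)] that(3-5) q(1) by auto
qed simp

lemma card_add:
  assumes H: "outer p H" and K: "finite K" "\<And>e. e \<in> K \<Longrightarrow> \<exists>x\<in>e. p < x"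
  shows "card (H \<union> K) = card H + card K"
proof (rule card_Un_disjoint)
  show "finite H" using H by (rule outer_finite)
  show "H \<inter> K = {}" using K(2) H unfolding outer_def by fastforce
qed (rule K(1))

lemma card_chain: "q \<noteq> 0 \<Longrightarrow> card (chain q) = 9"
  unfolding chain_def by (simp add: doubleton_eq_iff card_insert_if)

lemma add_tail:
  assumes "outer p H" "z = 0 \<or> z = p" "q = p + 1" "e = card H + 1"
  shows "\<exists>H'. outer q H' \<and> card H' = e"
proof -
  have "card (H \<union> {{z, p + 1}}) = card H + card {{z, p + 1}}" by (rule card_add[OF assms(1)]) auto
  then show ?thesis using outer_tail[OF assms(1,2)] assms(3,4) by (intro exI[of _ "H \<union> {{z, p + 1}}"]) simp
qed

lemma add_triangle:
  assumes "outer p H" "z = 0 \<or> z = p" "q = p + 2" "e = card H + 3"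
  shows "\<exists>H'. outer q H' \<and> card H' = e"
proof -
  have "card (H \<union> {{z, p + 1}, {p + 1, p + 2}, {z, p + 2}}) = card H + card {{z, p + 1}, {p + 1, p + 2}, {z, p + 2}}"
    by (rule card_add[OF assms(1)]) auto
  moreover have "card {{z, p + 1}, {p + 1, p + 2}, {z, p + 2}} = 3"
    using assms(2) by (auto simp: doubleton_eq_iff)
  ultimately show ?thesis using outer_triangle[OF assms(1,2)] assms(3,4) by metis
qed

text \<open>The tail \<open>{p, p + 1}\<close> moves the start of the chain to a vertex that is not
  adjacent to 0; it brings \<open>1 + 9\<close> edges for 6 vertices.\<close>

lemma add_pentagon3:
  assumes H: "outer p H" and p: "p \<noteq> 0"
  shows "\<exists>H'. outer (p + 6) H' \<and> card H' = card H + 10"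
proof -
  let ?H = "H \<union> {{p, p + 1}}"
  have o: "outer (p + 1) ?H" using outer_tail[OF H] by simp
  have "{0, p + 1} \<notin> ?H" using outer_edge[OF H, of 0 "p + 1"] p by (auto simp: doubleton_eq_iff)
  then have "outer (p + 1 + 5) (?H \<union> chain (p + 1))" by (intro outer_chain[OF o]) simp
  moreover have "p + 1 + 5 = p + 6" by simp
  ultimately have o2: "outer (p + 6) (?H \<union> chain (p + 1))" by metis
  have "card ?H = card H + card {{p, p + 1}}" by (rule card_add[OF H]) auto
  moreover have "card (?H \<union> chain (p + 1)) = card ?H + card (chain (p + 1))"
    by (rule card_add[OF o]) (auto simp: chain_def)
  ultimately show ?thesis using o2 card_chain[of "p + 1"] by (intro exI[of _ "?H \<union> chain (p + 1)"]) simp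
qed

text \<open>A triangle at \<open>p\<close> takes the place of the tail and brings
  \<open>3 + 9\<close> edges for 7 vertices. With 7 edges to the apex these are the 19 edges per 7
  vertices of the theorem.\<close>

lemma add_pentagon4:
  assumes H: "outer p H" and p: "p \<noteq> 0"
  shows "\<exists>H'. outer (p + 7) H' \<and> card H' = card H + 12"
proof -
  let ?K = "{{p, p + 1}, {p + 1, p + 2}, {p, p + 2}}"
  have o: "outer (p + 2) (H \<union> ?K)" using outer_triangle[OF H] by simp
  have "{0, p + 2} \<notin> H \<union> ?K" using outer_edge[OF H, of 0 "p + 2"] p by (auto simp: doubleton_eq_iff)
  then have "outer (p + 2 + 5) ((H \<union> ?K) \<union> chain (p + 2))" by (intro outer_chain[OF o]) simp
  moreover have "p + 2 + 5 = p + 7" by simp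
  ultimately have o2: "outer (p + 7) ((H \<union> ?K) \<union> chain (p + 2))" by metis
  have "card (H \<union> ?K) = card H + card ?K" by (rule card_add[OF H]) auto
  moreover have "card ?K = 3" by (auto simp: doubleton_eq_iff)
  moreover have "card ((H \<union> ?K) \<union> chain (p + 2)) = card (H \<union> ?K) + card (chain (p + 2))"
    by (rule card_add[OF o]) (auto simp: chain_def)
  ultimately show ?thesis using o2 card_chain[of "p + 2"] by (intro exI[of _ "(H \<union> ?K) \<union> chain (p + 2)"]) simp
qed

text \<open>One start for each residue of \<open>p\<close> modulo 7. Up to \<open>p = 6\<close> they
  are triangles sharing the vertex 0, with a tail for odd \<open>p\<close>; at \<open>p = 7\<close>
  a pentagon with three triangles has one edge more than this pattern would give.\<close>

lemma outer_base:
  "\<exists>H. outer 1 H \<and> card H = 1" "\<exists>H. outer 2 H \<and> card H = 3" "\<exists>H. outer 3 H \<and> card H = 4"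
  "\<exists>H. outer 4 H \<and> card H = 6" "\<exists>H. outer 5 H \<and> card H = 7" "\<exists>H. outer 6 H \<and> card H = 9"
  "\<exists>H. outer 7 H \<and> card H = 11"
proof -
  have 0: "outer 0 {}" by (simp add: outer_def c4_def)
  obtain H1 where 1: "outer 1 H1" "card H1 = 1" using add_tail[OF 0, of 0 1 1] by auto
  obtain H2 where 2: "outer 2 H2" "card H2 = 3" using add_triangle[OF 0, of 0 2 3] by auto
  obtain H3 where 3: "outer 3 H3" "card H3 = 4" using add_tail[OF 2(1), of 0 3 4] 2(2) by auto
  obtain H4 where 4: "outer 4 H4" "card H4 = 6" using add_triangle[OF 2(1), of 0 4 6] 2(2) by auto
  obtain H5 where 5: "outer 5 H5" "card H5 = 7" using add_tail[OF 4(1), of 0 5 7] 4(2) by auto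
  obtain H6 where 6: "outer 6 H6" "card H6 = 9" using add_triangle[OF 4(1), of 0 6 9] 4(2) by auto
  obtain H7 where 7: "outer 7 H7" "card H7 = 11" using add_pentagon3[OF 1(1)] 1(2) by auto
  show "\<exists>H. outer 1 H \<and> card H = 1" "\<exists>H. outer 2 H \<and> card H = 3" "\<exists>H. outer 3 H \<and> card H = 4"
    "\<exists>H. outer 4 H \<and> card H = 6" "\<exists>H. outer 5 H \<and> card H = 7" "\<exists>H. outer 6 H \<and> card H = 9"
    "\<exists>H. outer 7 H \<and> card H = 11"
    using 1 2 3 4 5 6 7 by blast+
qed

lemma outer_extend:
  assumes "\<exists>H. outer p H \<and> card H = e" "p \<noteq> 0"
  shows "\<exists>H. outer (p + 7 * k) H \<and> card H = e + 12 * k"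
proof (induction k)
  case 0
  then show ?case using assms(1) by simp
next
  case (Suc k)
  then obtain H where "outer (p + 7 * k) H" "card H = e + 12 * k" by blast
  then show ?case using add_pentagon4[of "p + 7 * k" H] assms(2) by (auto simp: algebra_simps)
qed

section \<open>Straight-line drawing of the cone\<close>

definition cone :: "nat \<Rightarrow> nat set set \<Rightarrow> nat sgraph" where
  "cone p H = ({..p + 1}, H \<union> (\<lambda>i. {i, p + 1}) ` {..p})"

text \<open>The vertices \<open>0..p\<close> lie on the parabola \<open>y = x\<^sup>2\<close>. Edges between them are chords, which run above the
  parabola; the apex is so far down that its edges run below.\<close>

definition pos :: "nat \<Rightarrow> nat \<Rightarrow> complex" where
  "pos p i = (if i \<le> p then Complex (real i) ((real i)\<^sup>2) else Complex 0 (- (real p + 1)\<^sup>2))"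

definition seg :: "nat \<Rightarrow> nat set \<Rightarrow> real \<Rightarrow> complex" where
  "seg p e = linepath (pos p (Min e)) (pos p (Max e))"

text \<open>The height of a chord above the parabola is the product of the horizontal distances to
  its ends. It vanishes only at the ends, and comparing two such products decides where chords
  meet.\<close>

lemma chord_point:
  assumes "z \<in> closed_segment (Complex a (a\<^sup>2)) (Complex b (b\<^sup>2))" "a < b"
  shows "a \<le> Re z" "Re z \<le> b" "Im z - (Re z)\<^sup>2 = (Re z - a) * (b - Re z)"
proof -
  obtain u where u: "0 \<le> u" "u \<le> 1" "z = (1 - u) *\<^sub>R Complex a (a\<^sup>2) + u *\<^sub>R Complex b (b\<^sup>2)"
    using assms(1) unfolding closed_segment_def by blast
  have re: "Re z = a + u * (b - a)" unfolding u(3) by (simp add: algebra_simps)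
  have im: "Im z = a\<^sup>2 + u * (b\<^sup>2 - a\<^sup>2)" unfolding u(3) by (simp add: algebra_simps)
  show "a \<le> Re z" unfolding re using u(1) assms(2) by simp
  have "u * (b - a) \<le> 1 * (b - a)" using u(2) assms(2) by (intro mult_right_mono) auto
  then show "Re z \<le> b" unfolding re by simp
  show "Im z - (Re z)\<^sup>2 = (Re z - a) * (b - Re z)" unfolding re im by algebra
qed

lemma spoke_point:
  assumes "z \<in> closed_segment (Complex a (a\<^sup>2)) (Complex 0 (- M))"
  shows "\<exists>t. 0 \<le> t \<and> t \<le> 1 \<and> Re z = t * a \<and> Im z = t * (a\<^sup>2 + M) - M"
proof -
  obtain u where u: "0 \<le> u" "u \<le> 1" "z = (1 - u) *\<^sub>R Complex a (a\<^sup>2) + u *\<^sub>R Complex 0 (- M)"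
    using assms unfolding closed_segment_def by blast
  show ?thesis
  proof (intro exI[of _ "1 - u"] conjI)
    show "Re z = (1 - u) * a" "Im z = (1 - u) * (a\<^sup>2 + M) - M"
      unfolding u(3) by (simp_all add: algebra_simps)
  qed (use u in simp_all)
qed

text \<open>The height of the spoke over the parabola factors as
  \<open>- ((1 - t) * (M - t * a\<^sup>2))\<close>, which is negative before the foot
  \<open>t = 1\<close>.\<close>

lemma spoke_height:
  fixes t a M :: real
  assumes "0 \<le> t" "t \<le> 1" "a\<^sup>2 < M" "0 \<le> t * (a\<^sup>2 + M) - M - (t * a)\<^sup>2"
  shows "t = 1"
proof (rule ccontr)
  assume "t \<noteq> 1"
  have "t * a\<^sup>2 \<le> 1 * a\<^sup>2" using assms(2) by (intro mult_right_mono) auto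
  then have "0 < M - t * a\<^sup>2" using assms(3) by simp
  then have "0 < (1 - t) * (M - t * a\<^sup>2)" using assms(2) \<open>t \<noteq> 1\<close> by simp
  moreover have "t * (a\<^sup>2 + M) - M - (t * a)\<^sup>2 = - ((1 - t) * (M - t * a\<^sup>2))" by algebra
  ultimately show False using assms(4) by linarith
qed

lemma inj_pos: "inj_on (pos p) {..p + 1}"
proof -
  have "pos p i = pos p j \<Longrightarrow> i = j" if "i \<le> p + 1" "j \<le> p + 1" for i j
  proof -
    assume eq: "pos p i = pos p j"
    have pp: "- (real p + 1)\<^sup>2 < 0" by simp
    have neg: "Im (pos p k) < 0 \<longleftrightarrow> \<not> k \<le> p" for k using pp by (simp add: pos_def)
    then have "i \<le> p \<longleftrightarrow> j \<le> p" using eq by metis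
    then show "i = j" using eq that by (cases "i \<le> p") (auto simp: pos_def)
  qed
  then show ?thesis by (auto simp: inj_on_def)
qed

text \<open>This fixes the depth of the apex: for \<open>i = j\<close> it keeps the spoke below the
  parabola, and for \<open>i \<noteq> j\<close> it makes the directions of two spokes
  differ.\<close>

lemma small_square:
  assumes "i \<le> p" "j \<le> p"
  shows "real i * real j < (real p + 1)\<^sup>2"
proof -
  have "real i * real j \<le> real p * real p" using assms by (intro mult_mono) auto
  also have "\<dots> < (real p + 1)\<^sup>2" by (simp add: power2_eq_square algebra_simps)
  finally show ?thesis .
qed

lemma seg_chord:
  assumes "i < j" "j \<le> p"
  shows "path_image (seg p {i, j}) = closed_segment (Complex (real i) ((real i)\<^sup>2)) (Complex (real j) ((real j)\<^sup>2))"
  using assms by (simp add: seg_def pos_def)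

lemma seg_spoke:
  assumes "i \<le> p"
  shows "path_image (seg p {i, p + 1}) = closed_segment (Complex (real i) ((real i)\<^sup>2)) (Complex 0 (- (real p + 1)\<^sup>2))"
  using assms by (simp add: seg_def pos_def)

lemma pos_on_parabola: "i \<le> p \<Longrightarrow> Im z = (Re z)\<^sup>2 \<Longrightarrow> Re z = real i \<Longrightarrow> z = pos p i"
  by (simp add: pos_def complex_eq_iff)

lemma spoke_above:
  assumes "i \<le> p" "z \<in> path_image (seg p {i, p + 1})" "(Re z)\<^sup>2 \<le> Im z"
  shows "z = pos p i"
proof -
  obtain t where t: "0 \<le> t" "t \<le> 1" "Re z = t * real i" "Im z = t * ((real i)\<^sup>2 + (real p + 1)\<^sup>2) - (real p + 1)\<^sup>2"
    using spoke_point assms(2) unfolding seg_spoke[OF assms(1)] by metis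
  have "t = 1"
  proof (rule spoke_height[OF t(1,2)])
    show "(real i)\<^sup>2 < (real p + 1)\<^sup>2" using small_square[OF assms(1,1)] by (simp add: power2_eq_square)
    show "0 \<le> t * ((real i)\<^sup>2 + (real p + 1)\<^sup>2) - (real p + 1)\<^sup>2 - (t * real i)\<^sup>2"
      using assms(3) t(3,4) by simp
  qed
  then show ?thesis using t assms(1) by (simp add: pos_def complex_eq_iff)
qed

lemma chord_props:
  assumes "i < j" "j \<le> p" "z \<in> path_image (seg p {i, j})"
  shows "real i \<le> Re z" "Re z \<le> real j" "Im z - (Re z)\<^sup>2 = (Re z - real i) * (real j - Re z)" "(Re z)\<^sup>2 \<le> Im z"
proof -
  show 1: "real i \<le> Re z" "Re z \<le> real j" "Im z - (Re z)\<^sup>2 = (Re z - real i) * (real j - Re z)"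
    using chord_point assms unfolding seg_chord[OF assms(1,2)] by simp_all
  have "0 \<le> (Re z - real i) * (real j - Re z)" using 1(1,2) by simp
  then show "(Re z)\<^sup>2 \<le> Im z" using 1(3) by linarith
qed

lemma chord_on_parabola:
  assumes "i < j" "j \<le> p" "z \<in> path_image (seg p {i, j})" "Im z = (Re z)\<^sup>2"
  shows "z = pos p i \<or> z = pos p j"
proof -
  have "(Re z - real i) * (real j - Re z) = 0" using chord_props(3)[OF assms(1-3)] assms(4) by simp
  then have "Re z = real i \<or> Re z = real j" by auto
  then show ?thesis using pos_on_parabola[of _ p z] assms by auto
qed

text \<open>The outer height exceeds the inner one by
  \<open>(k - i) * (j - x) + (x - k) * (j - l)\<close>. Both terms are nonnegative, so at a common
  point both vanish, which forces a common end.\<close>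

lemma nested_chords:
  assumes "i \<le> k" "l \<le> j" "k < l" "j \<le> p" "(i, j) \<noteq> (k, l)"
    and "z \<in> path_image (seg p {i, j})" "z \<in> path_image (seg p {k, l})"
  shows "z \<in> pos p ` ({i, j} \<inter> {k, l})"
proof -
  have ij: "i < j" and lp: "l \<le> p" using assms by linarith+
  note 1 = chord_props[OF ij assms(4,6)] and 2 = chord_props[OF assms(3) lp assms(7)]
  let ?x = "Re z"
  have "(real k - real i) * (real j - ?x) + (?x - real k) * (real j - real l) = 0"
    using 1(3) 2(3) by (simp add: algebra_simps)
  moreover have nn: "0 \<le> (real k - real i) * (real j - ?x)" "0 \<le> (?x - real k) * (real j - real l)"
    using 1 2 assms(1,2) by simp_all
  ultimately have z: "(real k - real i) * (real j - ?x) = 0" "(?x - real k) * (real j - real l) = 0" by linarith+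
  show ?thesis
  proof (cases "i = k")
    case False
    then have x: "?x = real j" using z(1) by simp
    then have "j = l" using 2(2) assms(2) by simp
    then show ?thesis using x pos_on_parabola[OF assms(4) _ x] 1(3) by auto
  next
    case True
    then have "j \<noteq> l" using assms(5) by simp
    then have x: "?x = real k" using z(2) by simp
    have "k \<le> p" using assms(3) lp by simp
    then show ?thesis using True pos_on_parabola[OF _ _ x] 2(3) x by auto
  qed
qed

lemma consecutive_chords:
  assumes "i < j" "j \<le> k" "k < l" "l \<le> p"
    and "z \<in> path_image (seg p {i, j})" "z \<in> path_image (seg p {k, l})"
  shows "z \<in> pos p ` ({i, j} \<inter> {k, l})"
proof -
  have jp: "j \<le> p" using assms by linarith
  note 1 = chord_props[OF assms(1) jp assms(5)] and 2 = chord_props[OF assms(3,4,6)]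
  have x: "Re z = real j" "j = k" using 1(2) 2(1) assms(2) by linarith+
  then have "z = pos p j" using pos_on_parabola[OF jp _ x(1)] 1(3) by auto
  then show ?thesis using x(2) by blast
qed

lemma spokes_meet:
  assumes "i \<le> p" "j \<le> p" "i \<noteq> j" "z \<in> path_image (seg p {i, p + 1})" "z \<in> path_image (seg p {j, p + 1})"
  shows "z = pos p (p + 1)"
proof -
  let ?M = "(real p + 1)\<^sup>2"
  have M: "?M > 0" by simp
  obtain t where t: "0 \<le> t" "t \<le> 1" "Re z = t * real i" "Im z = t * ((real i)\<^sup>2 + ?M) - ?M"
    using spoke_point assms(4) unfolding seg_spoke[OF assms(1)] by metis
  obtain s where s: "Re z = s * real j" "Im z = s * ((real j)\<^sup>2 + ?M) - ?M"
    using spoke_point assms(5) unfolding seg_spoke[OF assms(2)] by metis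
  have eq: "t * real i = s * real j" "t * ((real i)\<^sup>2 + ?M) = s * ((real j)\<^sup>2 + ?M)" using t s by simp_all
  have jM: "(real j)\<^sup>2 + ?M \<noteq> 0" using M by (smt (verit) zero_le_power2)
  have "t = 0"
  proof (rule ccontr)
    assume t0: "t \<noteq> 0"
    have "t * (real i * ((real j)\<^sup>2 + ?M)) = (t * real i) * ((real j)\<^sup>2 + ?M)" by simp
    also have "\<dots> = real j * (s * ((real j)\<^sup>2 + ?M))" unfolding eq(1) by simp
    also have "\<dots> = t * (real j * ((real i)\<^sup>2 + ?M))" unfolding eq(2)[symmetric] by simp
    finally have "real i * ((real j)\<^sup>2 + ?M) = real j * ((real i)\<^sup>2 + ?M)" using t0 by simp
    then have "(real i - real j) * (?M - real i * real j) = 0" by algebra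
    then show False using assms(3) small_square[OF assms(1,2)] by simp
  qed
  then show ?thesis using t by (simp add: pos_def complex_eq_iff)
qed

lemma cone_edge_cases:
  assumes "outer p H" "e \<in> edges (cone p H)"
  obtains (chord) i j where "e = {i, j}" "i < j" "j \<le> p" "{i, j} \<in> H"
    | (spoke) i where "e = {i, p + 1}" "i \<le> p"
  using assms unfolding cone_def outer_def by (auto; metis)

lemma plane_drawing_cone:
  assumes H: "outer p H"
  shows "plane_drawing (cone p H) (pos p) (seg p)"
proof -
  have V: "verts (cone p H) = {..p + 1}" by (simp add: cone_def)
  have inj: "pos p i = pos p j \<longleftrightarrow> i = j" if "i \<le> p + 1" "j \<le> p + 1" for i j
    using inj_on_eq_iff[OF inj_pos, of i p j] that by simp
  have Im_neg: "Im (pos p (p + 1)) < (Re (pos p (p + 1)))\<^sup>2" by (simp add: pos_def)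
  have par: "Im (pos p i) = (Re (pos p i))\<^sup>2" if "i \<le> p" for i using that by (simp add: pos_def)
  have single: "arc (seg p e) \<and> {pathstart (seg p e), pathfinish (seg p e)} = pos p ` e \<and>
      path_image (seg p e) \<inter> pos p ` {..p + 1} = pos p ` e" if e: "e \<in> edges (cone p H)" for e
  proof -
    obtain i j where ij: "e = {i, j}" "i < j" "j \<le> p + 1"
      using H e by (cases rule: cone_edge_cases) auto
    have mm: "Min e = i" "Max e = j" using ij by auto
    have "pos p i \<noteq> pos p j" using inj ij by simp
    then have a: "arc (seg p e)" unfolding seg_def mm by (rule arc_linepath)
    have en: "{pathstart (seg p e), pathfinish (seg p e)} = pos p ` e"
      unfolding seg_def mm by (simp add: ij(1))
    have sub: "pos p ` e \<subseteq> path_image (seg p e)"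
      using en pathstart_in_path_image pathfinish_in_path_image by (metis empty_subsetI insert_subset)
    have "path_image (seg p e) \<inter> pos p ` {..p + 1} \<subseteq> pos p ` e"
    proof
      fix z assume z: "z \<in> path_image (seg p e) \<inter> pos p ` {..p + 1}"
      then obtain k where k: "k \<le> p + 1" "z = pos p k" by auto
      from H e show "z \<in> pos p ` e"
      proof (cases rule: cone_edge_cases)
        case (chord i j)
        then have zi: "z \<in> path_image (seg p {i, j})" using z by simp
        have "k \<le> p" using chord_props(4)[OF chord(2,3) zi] Im_neg k by (metis le_Suc_eq Suc_eq_plus1 not_le)
        then show ?thesis using chord_on_parabola[OF chord(2,3) zi] par k(2) chord(1) by auto
      next
        case (spoke i)
        show ?thesis
        proof (cases "k \<le> p")
          case True
          then show ?thesis using spoke_above[OF spoke(2)] z par k(2) spoke(1) by auto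
        next
          case False
          then have "k = p + 1" using k(1) by simp
          then show ?thesis using k(2) spoke(1) by blast
        qed
      qed
    qed
    moreover have "pos p ` e \<subseteq> pos p ` {..p + 1}" using ij by auto
    ultimately show ?thesis using a en sub by blast
  qed
  have mixed: "path_image (seg p e) \<inter> path_image (seg p e') \<subseteq> pos p ` (e \<inter> e')"
    if c: "e = {i, j}" "i < j" "j \<le> p" and s: "e' = {k, p + 1}" "k \<le> p" for e e' i j k
  proof
    fix z assume "z \<in> path_image (seg p e) \<inter> path_image (seg p e')"
    then have z: "z \<in> path_image (seg p {i, j})" "z \<in> path_image (seg p {k, p + 1})" using c s by auto
    have zk: "z = pos p k" using spoke_above[OF s(2) z(2)] chord_props(4)[OF c(2,3) z(1)] by blast
    then have "z = pos p i \<or> z = pos p j" using chord_on_parabola[OF c(2,3) z(1)] par[OF s(2)] by simp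
    then have "k = i \<or> k = j" using zk inj[of k i] inj[of k j] c s by auto
    then show "z \<in> pos p ` (e \<inter> e')" using zk c(1) s(1) by blast
  qed
  have pair: "path_image (seg p e) \<inter> path_image (seg p e') \<subseteq> pos p ` (e \<inter> e')"
    if e: "e \<in> edges (cone p H)" "e' \<in> edges (cone p H)" "e \<noteq> e'" for e e'
    using H e(1)
  proof (cases rule: cone_edge_cases)
    case 1: (chord i j)
    from H e(2) show ?thesis
    proof (cases rule: cone_edge_cases)
      case 2: (chord k l)
      show ?thesis
      proof
        fix z assume "z \<in> path_image (seg p e) \<inter> path_image (seg p e')"
        then have z: "z \<in> path_image (seg p {i, j})" "z \<in> path_image (seg p {k, l})" using 1 2 by auto
        have ne: "(i, j) \<noteq> (k, l)" using e(3) 1(1) 2(1) by blast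
        \<comment> \<open>Chords whose ends do not interleave span nested intervals or intervals
          with at most an end in common.\<close>
        have "\<not> (i < k \<and> k < j \<and> j < l)" "\<not> (k < i \<and> i < l \<and> l < j)"
          using H 1(4) 2(4) unfolding outer_def by blast+
        then consider "j \<le> k" | "l \<le> i" | "i \<le> k" "l \<le> j" | "k \<le> i" "j \<le> l" by linarith
        then show "z \<in> pos p ` (e \<inter> e')"
        proof cases
          case 1
          then show ?thesis using consecutive_chords[OF \<open>i < j\<close> _ 2(2,3) z] \<open>e = {i, j}\<close> 2(1) by simp
        next
          case 22: 2
          then show ?thesis using consecutive_chords[OF 2(2) _ 1(2,3) z(2,1)] 1(1) 2(1) by (simp add: Int_commute)
        next
          case 3
          then show ?thesis using nested_chords[OF _ _ 2(2) 1(3) ne z] 1(1) 2(1) by simp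
        next
          case 4
          then show ?thesis using nested_chords[OF _ _ 1(2) 2(3) ne[symmetric] z(2,1)] 1(1) 2(1)
            by (simp add: Int_commute)
        qed
      qed
    next
      case (spoke k)
      then show ?thesis using mixed 1 by blast
    qed
  next
    case 1: (spoke i)
    from H e(2) show ?thesis
    proof (cases rule: cone_edge_cases)
      case (chord k l)
      then show ?thesis using mixed[of e' k l e i] 1 by (simp add: Int_commute)
    next
      case (spoke k)
      then have "i \<noteq> k" using e(3) 1(1) by blast
      then show ?thesis using spokes_meet[OF 1(2) spoke(2)] 1(1) spoke(1) by blast
    qed
  qed
  show ?thesis
    unfolding plane_drawing_def V using inj_pos single pair by blast
qed

section \<open>The extremal values\<close>

lemma contains_copy_two_C4D:
  assumes "contains_copy G two_C4"
  obtains a b c d a' b' c' d' where "c4 (edges G) a b c d" "c4 (edges G) a' b' c' d'"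
    "{a, b, c, d} \<inter> {a', b', c', d'} = {}"
proof -
  obtain f where f: "inj_on f (verts two_C4)" "\<forall>e\<in>edges two_C4. f ` e \<in> edges G"
    using assms unfolding contains_copy_def by blast
  have inj: "f x = f y \<longleftrightarrow> x = y" if "x \<in> verts two_C4" "y \<in> verts two_C4" for x y
    using inj_on_eq_iff[OF f(1) that] .
  show thesis
  proof
    show "c4 (edges G) (f (Inl 0)) (f (Inl 1)) (f (Inl 2)) (f (Inl 3))"
      "c4 (edges G) (f (Inr 0)) (f (Inr 1)) (f (Inr 2)) (f (Inr 3))"
      using f(2) unfolding c4_def two_C4_edges by (auto simp: inj two_C4_verts)
    show "{f (Inl 0), f (Inl 1), f (Inl 2), f (Inl 3)} \<inter> {f (Inr 0), f (Inr 1), f (Inr 2), f (Inr 3)} = {}"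
      by (auto simp: inj two_C4_verts)
  qed
qed

text \<open>Of two disjoint 4-cycles one avoids the apex and would be a 4-cycle of
  \<open>H\<close>.\<close>

lemma cone_in_planar_free_sizes:
  assumes H: "outer p H"
  shows "card H + p + 1 \<in> planar_free_sizes (p + 2) two_C4"
proof -
  let ?G = "cone p H"
  have "simple_graph ?G"
    unfolding simple_graph_def
  proof (intro conjI ballI)
    show "finite (verts ?G)" by (simp add: cone_def)
    fix e assume e: "e \<in> edges ?G"
    show "e \<subseteq> verts ?G" using H e by (cases rule: cone_edge_cases) (auto simp: cone_def)
    show "card e = 2" using H e by (cases rule: cone_edge_cases) auto
  qed
  moreover have "card (verts ?G) = p + 2" by (simp add: cone_def)
  moreover have "planar ?G" using plane_drawing_cone[OF H] unfolding planar_def by blast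
  moreover have "\<not> contains_copy ?G two_C4"
  proof
    assume "contains_copy ?G two_C4"
    then obtain a b c d a' b' c' d' where c: "c4 (edges ?G) a b c d" "c4 (edges ?G) a' b' c' d'"
      "{a, b, c, d} \<inter> {a', b', c', d'} = {}" by (rule contains_copy_two_C4D)
    have inH: "{x, y} \<in> H" if "{x, y} \<in> edges ?G" "x \<noteq> p + 1" "y \<noteq> p + 1" for x y
      using that by (auto simp: cone_def)
    have "c4 H x y z w" if "c4 (edges ?G) x y z w" "p + 1 \<notin> {x, y, z, w}" for x y z w
      using that inH unfolding c4_def by auto
    then have "c4 H a b c d \<or> c4 H a' b' c' d'" using c by blast
    then show False using H unfolding outer_def by blast
  qed
  moreover have "card (edges ?G) = card H + p + 1"
  proof -
    have "card (H \<union> (\<lambda>i. {i, p + 1}) ` {..p}) = card H + card ((\<lambda>i. {i, p + 1}) ` {..p})"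
      by (rule card_add[OF H]) auto
    moreover have "card ((\<lambda>i. {i, p + 1}) ` {..p}) = p + 1"
      by (subst card_image) (auto simp: inj_on_def doubleton_eq_iff)
    ultimately show ?thesis by (simp add: cone_def)
  qed
  ultimately show ?thesis
    unfolding planar_free_sizes_def by (metis (mono_tags, lifting) mem_Collect_eq)
qed

theorem theorem1p5:
  fixes n :: nat
  assumes "n \<ge> 2661"
  shows "real (ex_planar n two_C4) =
    (if 7 dvd n then 19 * real n / 7 - 6 else real_of_int \<lfloor>(19 * real n - 34) / 7\<rfloor>)"
proof -
  \<comment> \<open>The cone over a graph on \<open>{0..p}\<close> has \<open>p + 2\<close>
    vertices, and the starting graphs have \<open>p = r + 1\<close> between 1 and 7; hence the shift
    by 3.\<close>
  define k where "k = (n - 3) div 7"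
  define r where "r = (n - 3) mod 7"
  have n: "n = 7 * k + r + 3" "r < 7" using assms by (auto simp: k_def r_def)
  \<comment> \<open>These are the edges of the cone over the starting graph: those of
    \<open>outer_base\<close> at \<open>r + 1\<close>, plus \<open>r + 2\<close> spokes.\<close>
  define e :: nat where "e = (if r = 0 then 3 else if r = 1 then 6 else if r = 2 then 8 else if r = 3 then 11
    else if r = 4 then 13 else if r = 5 then 16 else 19)"
  have rc: "r = 0 \<or> r = 1 \<or> r = 2 \<or> r = 3 \<or> r = 4 \<or> r = 5 \<or> r = 6" using n(2) by linarith
  have val: "real (19 * k + e) =
    (if 7 dvd n then 19 * real n / 7 - 6 else real_of_int \<lfloor>(19 * real n - 34) / 7\<rfloor>)"
  \<comment> \<open>This is the case \<open>7 dvd n\<close>. There the floor would be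
    \<open>19 * k + 14\<close>, one more than the value reached.\<close>
  proof (cases "r = 4")
    case True
    then have "n = 7 * (k + 1)" using n(1) by simp
    then show ?thesis using True by (simp add: e_def)
  next
    case False
    have nd: "\<not> 7 dvd n" using False rc n(1) by presburger
    have "\<lfloor>(19 * real n - 34) / 7\<rfloor> = int (19 * k + e)"
      unfolding floor_eq_iff using rc False n(1) by (elim disjE) (simp_all add: e_def field_simps)
    then show ?thesis using nd by simp
  qed
  have lower: "19 * k + e \<in> planar_free_sizes n two_C4"
  proof -
    obtain H where H: "outer (r + 1 + 7 * k) H" "card H + (r + 1) + 1 = e + 12 * k"
    proof -
      have ex: "\<exists>H. outer (r + 1) H \<and> card H = e - (r + 2)"
        using rc outer_base by (elim disjE) (simp_all add: e_def numeral_eq_Suc)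
      obtain H where "outer (r + 1 + 7 * k) H" "card H = e - (r + 2) + 12 * k"
        using outer_extend[OF ex] by auto
      moreover have "r + 2 \<le> e" using rc by (auto simp: e_def)
      ultimately show thesis using that by simp
    qed
    have "card H + (r + 1 + 7 * k) + 1 \<in> planar_free_sizes (r + 1 + 7 * k + 2) two_C4"
      using H(1) by (rule cone_in_planar_free_sizes)
    moreover have "card H + (r + 1 + 7 * k) + 1 = 19 * k + e" using H(2) by simp
    moreover have "r + 1 + 7 * k + 2 = n" using n(1) by simp
    ultimately show ?thesis by metis
  qed
  have upper: "m \<le> 19 * k + e" if m: "m \<in> planar_free_sizes n two_C4" for m
  proof -
    obtain G :: "nat sgraph" where G: "simple_graph G" "card (verts G) = n" "planar G" "\<not> contains_copy G two_C4"
      "m = card (edges G)" using m unfolding planar_free_sizes_def by blast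
    have "7 * m + 34 \<le> 19 * n \<and> 7 * m + 35 \<noteq> 19 * n"
      using planar_2C4_free_upper[OF G(1,3,4)] G(2,5) assms by simp
    \<comment> \<open>For \<open>r = 4\<close> the inequality alone would allow
      \<open>m = 19 * k + 14\<close>, which is the excluded equality
      \<open>7 * m + 35 = 19 * n\<close>.\<close>
    then show ?thesis using rc n(1) by (elim disjE) (simp_all add: e_def, presburger+)
  qed
  have "ex_planar n two_C4 = 19 * k + e"
    unfolding ex_planar_def by (rule Max_eqI[OF finite_planar_free_sizes upper lower])
  then show ?thesis using val by simp
qed

end
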